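(* Let $k\ge2$ and $f,g,f_n\in\mathcal L_k$ for $n\in\mathbb Z_+$. Assume that there exists a probability measure $m$ equivalent to $\mu$, with $\psi=d\mu/dm\in(0,\infty)$ $m$-a.e., such that $L^\alpha\ln^{k-1}L\bigl(g\cdot(\psi^{\otimes k})^{1/\alpha},m\bigr)<\infty$. Moreover, suppose that $f_n\to f$ $\mu^k$-a.e. and that $f_n\le g$ $\mu^k$-a.e. for all $n\in\mathbb Z_+$. Then, as $n\to\infty$, $$I_k^e(f_n)\to I_k^e(f)\quad\text{a.s.}$$
   Context: $\mathbb Z_+=\{1,2,\dots\}$, $\alpha\in(0,\infty)$, $\bigvee$ denotes supremum. $(E,\mathcal E)$ is a Borel space (there is a measurable bijection, with measurable inverse, onto a Borel subset of $[0,1]$) and $\mu$ is a nonzero $\sigma$-finite measure on it. Notation: $\ln_+x=\ln(x\vee1)$. For a measure $\nu$ on $E$ and measurable $h:E^k\to[0,\infty]$, $L^\alpha\ln^{k-1}L(h,\nu)=\int_{E^k}h^\alpha(\boldsymbol u)\bigl(1+(\ln_+h(\boldsymbol u))^{k-1}\bigr)\nu^k(d\boldsymbol u)$. $\psi^{\otimes k}(x_1,\dots,x_k)=\psi(x_1)\cdots\psi(x_k)$. $M_\alpha=(M_\alpha(A))_{A\in\mathcal E}$ is an independently scattered $\alpha$-Fréchet random sup measure with control measure $\mu$: $[0,\infty]$-valued random variables such that (i) $M_\alpha(A_1),\dots,M_\alpha(A_n)$ are independent for disjoint $A_i\in\mathcal E$; (ii) $\mathbb P(M_\alpha(A)\le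 x)=\exp\{-\mu(A)x^{-\alpha}\}$, $x\in(0,\infty)$ (so $M_\alpha(A)=\infty$ a.s. if $\mu(A)=\infty$); (iii) $M_\alpha(\bigcup_{j\ge1}A_j)=\bigvee_{j\ge1}M_\alpha(A_j)$ a.s. for $A_j\in\mathcal E$. Off-diagonal space: $D^{(k)}=\{(x_1,\dots,x_k)\in E^k:x_i=x_j\text{ for some }i\ne j\}$, $E^{(k)}=E^k\setminus D^{(k)}$, $\mathcal E^{(k)}=\{A\cap E^{(k)}:A\in\mathcal E^k\}$. $\mathcal L_k$ is the class of measurable $f:E^k\to[0,\infty]$ vanishing on $D^{(k)}$. Product random sup measure $M_\alpha^{(k)}$ on $\mathcal E^{(k)}$: when the control measure is finite, $M_\alpha^{(k)}(A_1\times\cdots\times A_k)=M_\alpha(A_1)\cdots M_\alpha(A_k)$ for pairwise disjoint $A_i\in\mathcal E$; $M_\alpha^{(k)}(\bigcup_{i=1}^mB_i)=\bigvee_{i=1}^mM_\alpha^{(k)}(B_i)$ for such off-diagonal rectangles $B_i$; and for $A\in\mathcal E^{(k)}$, $M_\alpha^{(k)}(A)$ is the $L^\gamma$-limit ($\gamma\in(0,\alpha)$) of $M_\alpha^{(k)}(A_n)$ for finite unions $A_n$ of off-diagonal rectangles with $\mu^k(A_n\Delta A)\to0$. For $\sigma$-finite $\mu$, take $E_n\uparrow E$ with $\mu(E_n)\in(0,\infty)$, let $M_{\alpha,E_n}(\cdot)=M_\alpha(\cdot\cap E_n)$ and $M_\alpha^{(k)}(A)=\bigvee_nM_{\alpha,E_n}^{(k)}(A)$.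 All of this is a.s. independent of choices. Multiple extremal integral: for simple $f=\sum_{i=1}^Na_i\mathbf 1_{A_i}$ with $a_i\in(0,\infty)$ and disjoint $A_i\in\mathcal E^{(k)}$, $I_k^e(f)=\bigvee_{i=1}^Na_iM_\alpha^{(k)}(A_i)$. For $f\in\mathcal L_k$, $I_k^e(f)$ is the a.s. limit of $I_k^e(f_n)$ for any such simple $f_n\le f_{n+1}$ with $f_n\to f$ $\mu^k$-a.e. (a.s. independent of the choice). Equivalently in law (LePage representation), jointly over $f\in\mathcal L_k$ and $k\in\mathbb Z_+$ and for any probability measure $m$ equivalent to $\mu$ with $\psi=d\mu/dm\in(0,\infty)$ $m$-a.e., $I_k^e(f)\overset d=\bigvee_{\boldsymbol j}f(T_{j_1},\dots,T_{j_k})\prod_{r=1}^k\Gamma_{j_r}^{-1/\alpha}\psi(T_{j_r})^{1/\alpha}$, the supremum being over $\boldsymbol j\in\mathbb Z_+^k$ with distinct entries, $(\Gamma_i)$ the arrival times of a standard Poisson process, and $(T_i)$ i.i.d. with law $m$ independent of $(\Gamma_i)$. *)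

theory Defs
  imports "HOL-Probability.Probability"
begin

definition borel_space :: "'e measure \<Rightarrow> bool" where
  "borel_space \<mu> \<longleftrightarrow> (\<exists>(B :: real set) \<phi>. B \<in> sets borel \<and> B \<subseteq> {0..1} \<and>
     bij_betw \<phi> (space \<mu>) B \<and>
     \<phi> \<in> measurable \<mu> (restrict_space borel B) \<and>
     the_inv_into (space \<mu>) \<phi> \<in> measurable (restrict_space borel B) \<mu>)"

text \<open>Powers and logarithms on \<open>[0,\<infinity>]\<close>; \<open>ennreal_powr\<close> is meant for exponents \<open>p > 0\<close> only,
  where \<open>0\<close> and \<open>\<infinity>\<close> are fixed.\<close>

definition ennreal_powr :: "ennreal \<Rightarrow> real \<Rightarrow> ennreal" where
  "ennreal_powr x p = (if x = \<top> then \<top> else ennreal (enn2real x powr p))"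

definition ln_plus :: "ennreal \<Rightarrow> ennreal" where
  "ln_plus x = (if x = \<top> then \<top> else ennreal (ln (max (enn2real x) 1)))"

text \<open>Points of \<open>E\<^sup>k\<close> are extensional functions on \<open>{..<k}\<close>.\<close>

abbreviation power_measure :: "nat \<Rightarrow> 'e measure \<Rightarrow> (nat \<Rightarrow> 'e) measure" where
  "power_measure k \<mu> \<equiv> Pi\<^sub>M {..<k} (\<lambda>_. \<mu>)"

definition LlnL :: "real \<Rightarrow> nat \<Rightarrow> ((nat \<Rightarrow> 'e) \<Rightarrow> ennreal) \<Rightarrow> 'e measure \<Rightarrow> ennreal" where
  "LlnL \<alpha> k h \<nu> =
     (\<integral>\<^sup>+ u. ennreal_powr (h u) \<alpha> * (1 + ln_plus (h u) ^ (k - 1)) \<partial>power_measure k \<nu>)"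

definition tensor_power :: "nat \<Rightarrow> ('e \<Rightarrow> ennreal) \<Rightarrow> (nat \<Rightarrow> 'e) \<Rightarrow> ennreal" where
  "tensor_power k \<psi> u = (\<Prod>i<k. \<psi> (u i))"

definition frechet_sup_measure ::
    "'w measure \<Rightarrow> 'e measure \<Rightarrow> real \<Rightarrow> ('e set \<Rightarrow> 'w \<Rightarrow> ennreal) \<Rightarrow> bool" where
  "frechet_sup_measure P \<mu> \<alpha> M \<longleftrightarrow>
     (\<forall>A\<in>sets \<mu>. M A \<in> borel_measurable P) \<and>
     (\<forall>n A. A ` {..<n} \<subseteq> sets \<mu> \<longrightarrow> disjoint_family_on A {..<n} \<longrightarrow>
        prob_space.indep_vars P (\<lambda>_. borel) (\<lambda>i. M (A i)) {..<(n::nat)}) \<and>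
     (\<forall>A\<in>sets \<mu>. \<forall>x>0. measure P {\<omega>\<in>space P. M A \<omega> \<le> ennreal x} =
        (if emeasure \<mu> A = \<infinity> then 0 else exp (- measure \<mu> A * x powr (-\<alpha>)))) \<and>
     (\<forall>A :: nat \<Rightarrow> 'e set. range A \<subseteq> sets \<mu> \<longrightarrow>
        (AE \<omega> in P. M (\<Union>j. A j) \<omega> = (SUP j. M (A j) \<omega>)))"

definition diagonal_set :: "nat \<Rightarrow> 'e measure \<Rightarrow> (nat \<Rightarrow> 'e) set" where
  "diagonal_set k \<mu> = {x \<in> space (power_measure k \<mu>). \<exists>i<k. \<exists>j<k. i \<noteq> j \<and> x i = x j}"

definition offdiag_space :: "nat \<Rightarrow> 'e measure \<Rightarrow> (nat \<Rightarrow> 'e) set" where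
  "offdiag_space k \<mu> = space (power_measure k \<mu>) - diagonal_set k \<mu>"

definition offdiag_sets :: "nat \<Rightarrow> 'e measure \<Rightarrow> (nat \<Rightarrow> 'e) set set" where
  "offdiag_sets k \<mu> = {A \<inter> offdiag_space k \<mu> | A. A \<in> sets (power_measure k \<mu>)}"

definition offdiag_functions :: "nat \<Rightarrow> 'e measure \<Rightarrow> ((nat \<Rightarrow> 'e) \<Rightarrow> ennreal) set" where
  "offdiag_functions k \<mu> =
     {f \<in> borel_measurable (power_measure k \<mu>). \<forall>x\<in>diagonal_set k \<mu>. f x = 0}"

text \<open>Off-diagonal rectangles are represented by their families of sides.\<close>

definition offdiag_sides :: "nat \<Rightarrow> 'e measure \<Rightarrow> (nat \<Rightarrow> 'e set) set" where
  "offdiag_sides k \<mu> = {R. R ` {..<k} \<subseteq> sets \<mu> \<and> disjoint_family_on R {..<k}}"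

definition offdiag_rect_unions :: "nat \<Rightarrow> 'e measure \<Rightarrow> (nat \<Rightarrow> 'e) set set" where
  "offdiag_rect_unions k \<mu> =
     {\<Union>i<m. Pi\<^sub>E {..<k} (R i) | (m::nat) R. R ` {..<m} \<subseteq> offdiag_sides k \<mu>}"

text \<open>\<open>L\<^sup>\<gamma>\<close>-convergence of \<open>[0,\<infinity>]\<close>-valued variables; the sum of the two truncated differences
  is the absolute difference wherever one of the variables is finite. It is \<open>\<infinity>\<close> where both
  are infinite, so convergence forces almost sure finiteness of the limit whenever the
  approximating variables are almost surely finite.\<close>

definition Lgamma_tendsto ::
    "'w measure \<Rightarrow> real \<Rightarrow> (nat \<Rightarrow> 'w \<Rightarrow> ennreal) \<Rightarrow> ('w \<Rightarrow> ennreal) \<Rightarrow> bool" where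
  "Lgamma_tendsto P \<gamma> X Y \<longleftrightarrow>
     (\<lambda>n. \<integral>\<^sup>+ \<omega>. ennreal_powr ((X n \<omega> - Y \<omega>) + (Y \<omega> - X n \<omega>)) \<gamma> \<partial>P) \<longlonglongrightarrow> 0"

text \<open>The predicates below say that a given family of random variables is obtained by the
  respective construction from \<^emph>\<open>some\<close> admissible choice of approximations. As different
  choices agree almost surely, this describes all versions of the object.\<close>

definition finite_product_sup_measure ::
    "'w measure \<Rightarrow> 'e measure \<Rightarrow> real \<Rightarrow> nat \<Rightarrow> ('e set \<Rightarrow> 'w \<Rightarrow> ennreal) \<Rightarrow>
     ((nat \<Rightarrow> 'e) set \<Rightarrow> 'w \<Rightarrow> ennreal) \<Rightarrow> bool" where
  "finite_product_sup_measure P \<mu> \<alpha> k M Mk \<longleftrightarrow>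
     (\<forall>A\<in>offdiag_sets k \<mu>. Mk A \<in> borel_measurable P) \<and>
     (\<forall>R\<in>offdiag_sides k \<mu>. AE \<omega> in P. Mk (Pi\<^sub>E {..<k} R) \<omega> = (\<Prod>i<k. M (R i) \<omega>)) \<and>
     (\<forall>(m::nat) R. R ` {..<m} \<subseteq> offdiag_sides k \<mu> \<longrightarrow>
        (AE \<omega> in P. Mk (\<Union>i<m. Pi\<^sub>E {..<k} (R i)) \<omega> = (SUP i\<in>{..<m}. Mk (Pi\<^sub>E {..<k} (R i)) \<omega>))) \<and>
     (\<forall>A\<in>offdiag_sets k \<mu>. \<exists>B. range B \<subseteq> offdiag_rect_unions k \<mu> \<and>
        (\<lambda>n. emeasure (power_measure k \<mu>) (sym_diff (B n) A)) \<longlonglongrightarrow> 0 \<and>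
        (\<forall>\<gamma>\<in>{0<..<\<alpha>}. Lgamma_tendsto P \<gamma> (\<lambda>n. Mk (B n)) (Mk A)))"

definition product_sup_measure ::
    "'w measure \<Rightarrow> 'e measure \<Rightarrow> real \<Rightarrow> nat \<Rightarrow> ('e set \<Rightarrow> 'w \<Rightarrow> ennreal) \<Rightarrow>
     ((nat \<Rightarrow> 'e) set \<Rightarrow> 'w \<Rightarrow> ennreal) \<Rightarrow> bool" where
  "product_sup_measure P \<mu> \<alpha> k M Mk \<longleftrightarrow>
     (\<forall>A\<in>offdiag_sets k \<mu>. Mk A \<in> borel_measurable P) \<and>
     (\<exists>(E :: nat \<Rightarrow> 'e set) MkE.
        range E \<subseteq> sets \<mu> \<and> incseq E \<and> (\<Union>n. E n) = space \<mu> \<and>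
        (\<forall>n. 0 < emeasure \<mu> (E n) \<and> emeasure \<mu> (E n) < \<infinity>) \<and>
        (\<forall>n. finite_product_sup_measure P (density \<mu> (indicator (E n))) \<alpha> k
               (\<lambda>A. M (A \<inter> E n)) (MkE n)) \<and>
        (\<forall>A\<in>offdiag_sets k \<mu>. AE \<omega> in P. Mk A \<omega> = (SUP n. MkE n A \<omega>)))"

text \<open>\<open>f = \<Sum>i<N. a i * indicator (A i)\<close> is simple and \<open>X\<close> is its integral.\<close>

definition simple_extremal_integral ::
    "'w measure \<Rightarrow> 'e measure \<Rightarrow> nat \<Rightarrow> ((nat \<Rightarrow> 'e) set \<Rightarrow> 'w \<Rightarrow> ennreal) \<Rightarrow>
     ((nat \<Rightarrow> 'e) \<Rightarrow> ennreal) \<Rightarrow> ('w \<Rightarrow> ennreal) \<Rightarrow> bool" where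
  "simple_extremal_integral P \<mu> k Mk f X \<longleftrightarrow>
     (\<exists>(N::nat) (a :: nat \<Rightarrow> real) A.
        (\<forall>i<N. 0 < a i) \<and> A ` {..<N} \<subseteq> offdiag_sets k \<mu> \<and> disjoint_family_on A {..<N} \<and>
        (\<forall>x\<in>space (power_measure k \<mu>). f x = (\<Sum>i<N. ennreal (a i) * indicator (A i) x)) \<and>
        (AE \<omega> in P. X \<omega> = (SUP i\<in>{..<N}. ennreal (a i) * Mk (A i) \<omega>)))"

definition multiple_extremal_integral ::
    "'w measure \<Rightarrow> 'e measure \<Rightarrow> nat \<Rightarrow> ((nat \<Rightarrow> 'e) set \<Rightarrow> 'w \<Rightarrow> ennreal) \<Rightarrow>
     ((nat \<Rightarrow> 'e) \<Rightarrow> ennreal) \<Rightarrow> ('w \<Rightarrow> ennreal) \<Rightarrow> bool" where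
  "multiple_extremal_integral P \<mu> k Mk f X \<longleftrightarrow>
     X \<in> borel_measurable P \<and>
     (\<exists>F Y.
        (\<forall>n. simple_extremal_integral P \<mu> k Mk (F n) (Y n)) \<and>
        (\<forall>n. \<forall>x\<in>space (power_measure k \<mu>). F n x \<le> F (Suc n) x) \<and>
        (AE x in power_measure k \<mu>. (\<lambda>n. F n x) \<longlonglongrightarrow> f x) \<and>
        (AE \<omega> in P. (\<lambda>n. Y n \<omega>) \<longlonglongrightarrow> X \<omega>))"

end

theory Submission
  imports Defs
begin

text \<open>The proof rests on a formula that no longer mentions approximating sequences: almost surely
\<open>I\<^sub>k(f)\<close> is the supremum of \<open>q\<close> times the product sup measure of \<open>{f > q}\<close> over the positive
rationals \<open>q\<close> (\<open>multiple_extremal_integral_eq_level_sup\<close>). Behind it is one property of the product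
sup measure: a set that is covered, up to a null set, by countably many others has almost surely at
most the supremum of their values (\<open>Mk_countable_cover\<close>). The formula and this property make the
integral monotone, compatible with maxima, and lower semicontinuous for almost everywhere
convergence; the lower half \<open>I(f) \<le> liminf I(f\<^sub>n)\<close> follows without any domination.

For the upper half let \<open>c > 1\<close>, let \<open>h\<^sub>N\<close> be the supremum of the \<open>f\<^sub>n\<close> with \<open>n \<ge> N\<close>, and let \<open>r\<^sub>N\<close> be
\<open>h\<^sub>N\<close> where \<open>h\<^sub>N > c f\<close> and \<open>0\<close> elsewhere. Then \<open>f\<^sub>n \<le> max (c f) r\<^sub>N\<close> for \<open>n \<ge> N\<close>, so that
\<open>I(f\<^sub>n) \<le> max (c I(f)) I(r\<^sub>N)\<close>, while \<open>r\<^sub>N \<le> g\<close> and \<open>r\<^sub>N\<close> tends to \<open>0\<close> almost everywhere. It remains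
to see that almost surely some \<open>I(r\<^sub>N)\<close> is as small as desired, and this is where the
\<open>L\<^sup>\<alpha> ln\<^bsup>k-1\<^esup> L\<close> condition enters.

The tool is the tail bound \<open>level_sup_tail\<close>. Cut \<open>E\<close> into cells on which \<open>\<psi>\<close> is constant up to a
factor 2. Rescaled on each cell, \<open>M\<close> behaves like a sup measure with control measure \<open>m\<close>, and all
its rescaled values are at most \<open>K\<close> outside an event of probability at most \<open>K\<^bsup>-\<alpha>\<^esup>\<close>. On the complement of
this event the product of \<open>k\<close> independent values exceeds \<open>1/z\<close> with a probability of order at most
\<open>z\<^sup>\<alpha> (ln z)\<^bsup>k-1\<^esup>\<close> times the product of the control measures
(\<open>prob_prod_gt_bounded_factors\<close>): the logarithms count the dyadic sizes that the first \<open>k - 1\<close>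
factors can have. Summing over the pieces of a partition bounds the probability that \<open>I(h) > x\<close> by
\<open>K\<^bsup>-\<alpha>\<^esup>\<close> plus an integral over \<open>m\<^sup>k\<close>. For \<open>h = r\<^sub>N\<close> this integral vanishes in the limit by dominated
convergence, and then \<open>K\<close> can be taken large.

The same truncation yields the covering property. Finite unions of off-diagonal rectangles satisfy
it by construction, and for them the probability that the product sup measure exceeds \<open>t\<close> is at most
\<open>\<delta>\<close> plus a multiple of the control measure (\<open>Phi_rect_union_small\<close>). This continuity at the empty
set carries over to all sets along their \<open>L\<^sup>\<gamma>\<close>-approximations (\<open>Phi_excess\<close>).\<close>

section \<open>Preliminaries on extended nonnegative reals and null sets\<close>

lemma ennreal_mult_less_iff:
  assumes "0 < (s::real)"
  shows "ennreal s * a < ennreal s * b \<longleftrightarrow> a < b"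
proof
  assume "ennreal s * a < ennreal s * b"
  then show "a < b" by (meson leD leI mult_left_mono zero_le)
qed (use assms in \<open>auto intro: ennreal_mult_strict_left_mono\<close>)

text \<open>Error terms below come as multiples of an approximation error \<open>\<eta>\<close> by a constant that does not depend
on \<open>\<eta>\<close>.\<close>

lemma ennreal_le_if_le_plus_multiples:
  fixes a b :: ennreal
  assumes "\<And>\<eta>::real. 0 < \<eta> \<Longrightarrow> a \<le> b + ennreal C * ennreal \<eta>" "0 \<le> C"
  shows "a \<le> b"
proof (rule ennreal_le_epsilon)
  fix e :: real assume e: "0 < e"
  have "a \<le> b + ennreal C * ennreal (e / (C + 1))" using e \<open>0 \<le> C\<close> by (intro assms) auto
  also have "ennreal C * ennreal (e / (C + 1)) \<le> ennreal e"
  proof -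
    have "C * (e / (C + 1)) \<le> e"
      using e \<open>0 \<le> C\<close> by (simp add: pos_divide_le_eq)
    then show ?thesis
      using e \<open>0 \<le> C\<close> by (simp add: ennreal_mult[symmetric] ennreal_leI del: times_divide_eq_right)
  qed
  finally show "a \<le> b + ennreal e" by simp
qed

lemma prod_mono_ennreal:
  fixes f g :: "nat \<Rightarrow> ennreal"
  assumes "\<And>i. i < k \<Longrightarrow> f i \<le> g i"
  shows "(\<Prod>i<k. f i) \<le> (\<Prod>i<k. g i)"
  using assms by (induction k) (auto intro!: mult_mono)

lemma AE_le_if_excess_null:
  fixes X Y :: "'w \<Rightarrow> ennreal"
  assumes [measurable]: "X \<in> borel_measurable P" "Y \<in> borel_measurable P"
    and null: "\<And>x::real. 0 < x \<Longrightarrow> emeasure P {\<omega>\<in>space P. Y \<omega> + ennreal x < X \<omega>} = 0"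
  shows "AE \<omega> in P. X \<omega> \<le> Y \<omega>"
proof -
  have "AE \<omega> in P. \<forall>n::nat. X \<omega> \<le> Y \<omega> + ennreal (1 / Suc n)"
  proof (subst AE_all_countable, rule allI)
    fix n :: nat
    have "{\<omega>\<in>space P. Y \<omega> + ennreal (1 / Suc n) < X \<omega>} \<in> null_sets P"
      by (intro null_setsI null) auto
    from AE_not_in[OF this] AE_space show "AE \<omega> in P. X \<omega> \<le> Y \<omega> + ennreal (1 / Suc n)"
      by eventually_elim (simp add: not_less)
  qed
  then show ?thesis
  proof eventually_elim
    case (elim \<omega>)
    show ?case
    proof (rule ennreal_le_epsilon)
      fix e :: real assume "0 < e"
      then obtain n where "inverse (real (Suc n)) < e" using reals_Archimedean by blast
      then have "ennreal (1 / Suc n) \<le> ennreal e" by (intro ennreal_leI) (simp add: inverse_eq_divide)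
      with elim[rule_format, of n] show "X \<omega> \<le> Y \<omega> + ennreal e"
        by (meson add_left_mono order_trans)
    qed
  qed
qed

lemma emeasure_Diff_eq_0_if_AE:
  assumes "AE x in N. x \<in> A \<longrightarrow> x \<in> B"
  shows "emeasure N (A - B) = 0"
proof -
  have "AE x in N. x \<notin> A - B" using assms by eventually_elim auto
  show ?thesis
  proof (cases "A - B \<in> sets N")
    case True
    then show ?thesis using \<open>AE x in N. x \<notin> A - B\<close> AE_iff_null_sets by blast
  qed (simp add: emeasure_notin_sets)
qed

section \<open>Products of densities\<close>

text \<open>Both sides agree on rectangles by Tonelli, which determines a product of sigma-finite measures.\<close>

lemma power_measure_density:
  assumes "sigma_finite_measure m" "sigma_finite_measure (density m \<psi>)"
    and [measurable]: "\<psi> \<in> borel_measurable m"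
  shows "power_measure k (density m \<psi>) = density (power_measure k m) (tensor_power k \<psi>)"
proof -
  interpret D: product_sigma_finite "\<lambda>_::nat. density m \<psi>"
    using assms(2) by (simp add: product_sigma_finite_def)
  interpret N: product_sigma_finite "\<lambda>_::nat. m"
    using assms(1) by (simp add: product_sigma_finite_def)
  have T[measurable]: "tensor_power k \<psi> \<in> borel_measurable (power_measure k m)"
    unfolding tensor_power_def by measurable
  show ?thesis
  proof (rule D.PiM_eqI[symmetric])
    show "sets (density (power_measure k m) (tensor_power k \<psi>)) = sets (power_measure k (density m \<psi>))"
      unfolding sets_density by (rule sets_PiM_cong) auto
  next
    fix A assume A: "\<And>i. i \<in> {..<k} \<Longrightarrow> A i \<in> sets (density m \<psi>)"
    have [measurable]: "Pi\<^sub>E {..<k} A \<in> sets (power_measure k m)"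
      using A by (intro sets_PiM_I_finite) auto
    have "emeasure (density (power_measure k m) (tensor_power k \<psi>)) (Pi\<^sub>E {..<k} A)
      = (\<integral>\<^sup>+x. tensor_power k \<psi> x * indicator (Pi\<^sub>E {..<k} A) x \<partial>power_measure k m)"
      by (simp add: emeasure_density)
    also have "\<dots> = (\<integral>\<^sup>+x. (\<Prod>i<k. \<psi> (x i) * indicator (A i) (x i)) \<partial>power_measure k m)"
    proof (rule nn_integral_cong)
      fix x assume "x \<in> space (power_measure k m)"
      then have "x \<in> extensional {..<k}" by (auto simp: space_PiM PiE_def)
      then have "indicator (Pi\<^sub>E {..<k} A) x = (\<Prod>i<k. indicator (A i) (x i) :: ennreal)"
        by (auto simp: indicator_def PiE_def Pi_iff intro!: prod_zero[symmetric])
      then show "tensor_power k \<psi> x * indicator (Pi\<^sub>E {..<k} A) x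
          = (\<Prod>i<k. \<psi> (x i) * indicator (A i) (x i))"
        by (simp add: tensor_power_def prod.distrib)
    qed
    also have "\<dots> = (\<Prod>i<k. \<integral>\<^sup>+x. \<psi> x * indicator (A i) x \<partial>m)"
    proof (rule N.product_nn_integral_prod)
      fix i assume "i \<in> {..<k}"
      then have "A i \<in> sets m" using A by auto
      then show "(\<lambda>x. \<psi> x * indicator (A i) x) \<in> borel_measurable m" by measurable
    qed simp
    also have "\<dots> = (\<Prod>i<k. emeasure (density m \<psi>) (A i))"
      using A by (intro prod.cong) (auto simp: emeasure_density)
    finally show "emeasure (density (power_measure k m) (tensor_power k \<psi>)) (Pi\<^sub>E {..<k} A)
        = (\<Prod>i\<in>{..<k}. emeasure (density m \<psi>) (A i))" .
  qed simp
qed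

section \<open>Products of independent heavy-tailed variables\<close>

text \<open>The volume estimate for \<open>{\<gamma> \<in> [K\<^bsup>-\<alpha>\<^esup>, \<infinity>)\<^sup>k. \<Prod>\<gamma>\<^sub>r < z\<^sup>\<alpha>}\<close>, up to constants: the ceiling bounds the
number of dyadic intervals that one coordinate can meet, and one of the \<open>k\<close> coordinates is
determined by the others.\<close>

definition product_tail :: "real \<Rightarrow> nat \<Rightarrow> real \<Rightarrow> real \<Rightarrow> real" where
  "product_tail \<alpha> k K z =
     2 powr (\<alpha> * real (k - 1)) * z powr \<alpha> * real (nat \<lceil>log 2 (K ^ k * z)\<rceil>) ^ (k - 1)"

lemma product_tail_nonneg: "0 \<le> product_tail \<alpha> k K z"
  by (simp add: product_tail_def)

text \<open>Fix the dyadic interval of each of the first \<open>k - 1\<close> factors. The last factor must then exceed the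
quotient of \<open>1/z\<close> by the upper ends, and by independence the resulting event has probability
at most \<open>z\<^sup>\<alpha>\<close> times a factor that does not depend on the chosen intervals. Since no factor exceeds \<open>K\<close>,
none can be below \<open>1 / (z K\<^bsup>k-1\<^esup>)\<close>, so only logarithmically many intervals matter.\<close>

lemma (in prob_space) prob_prod_gt_bounded_factors:
  fixes X :: "nat \<Rightarrow> 'a \<Rightarrow> ennreal" and l :: "nat \<Rightarrow> real"
  assumes indep: "indep_vars (\<lambda>_. borel) X {..<k}"
    and tail: "\<And>r t. r < k \<Longrightarrow> 0 < t \<Longrightarrow> prob {\<omega>\<in>space M. ennreal t < X r \<omega>} \<le> l r * t powr (-\<alpha>)"
    and pos: "0 < \<alpha>" "0 < K" "0 < z" "0 < k"
  shows "prob {\<omega>\<in>space M. ennreal (1 / z) < (\<Prod>r<k. X r \<omega>) \<and> (\<forall>r<k. X r \<omega> \<le> ennreal K)}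
    \<le> (\<Prod>r<k. l r) * product_tail \<alpha> k K z"
    (is "prob ?E \<le> _")
proof -
  obtain d where k: "k = Suc d" using pos(4) by (cases k) auto
  have X[measurable]: "X r \<in> borel_measurable M" if "r < k" for r
    using indep that by (auto simp: indep_vars_def)
  define N where "N = nat \<lceil>log 2 (K ^ k * z)\<rceil>"
  define up where "up i = K * 2 powr (- real i)" for i :: nat
  define t where "t i r = (if r < d then up (i r) / 2 else 1 / (z * (\<Prod>s<d. up (i s))))" for i r
  \<comment> \<open>Here \<open>i r\<close> numbers the dyadic interval \<open>(up (i r) / 2, up (i r)]\<close> of the \<open>r\<close>-th factor, \<open>r < d\<close>.\<close>
  define B where "B i = (\<Inter>r\<in>{..<k}. X r -` {ennreal (t i r)<..} \<inter> space M)" for i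
  have up_pos: "0 < up i" for i using pos by (simp add: up_def)
  have t_pos: "0 < t i r" for i r
    using up_pos pos by (auto simp: t_def intro!: divide_pos_pos mult_pos_pos prod_pos)
  \<comment> \<open>The upper ends cancel in the product of the thresholds, so it does not depend on \<open>i\<close>.\<close>
  have prod_t: "(\<Prod>r<k. t i r) = 2 powr (- real d) / z" for i
  proof -
    have "(\<Prod>r<k. t i r) = (\<Prod>r<d. up (i r) / 2) / (z * (\<Prod>s<d. up (i s)))"
      by (simp add: k t_def)
    also have "(\<Prod>r<d. up (i r) / 2) = (\<Prod>s<d. up (i s)) / 2 ^ d"
      by (simp add: prod_dividef)
    finally show ?thesis
      using up_pos by (auto simp: powr_minus powr_realpow field_simps prod_zero_iff less_imp_neq[symmetric])
  qed
  have B_le: "prob (B i) \<le> (\<Prod>r<k. l r) * (2 powr (\<alpha> * real d) * z powr \<alpha>)" for i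
  proof -
    have "prob (B i) = (\<Prod>r<k. prob (X r -` {ennreal (t i r)<..} \<inter> space M))"
      unfolding B_def using pos by (intro indep_varsD_finite[OF indep]) auto
    also have "\<dots> \<le> (\<Prod>r<k. l r * t i r powr (-\<alpha>))"
    proof (rule prod_mono, safe)
      fix r assume "r < k"
      then show "prob (X r -` {ennreal (t i r)<..} \<inter> space M) \<le> l r * t i r powr (-\<alpha>)"
        using tail[OF _ t_pos, of r i r] by (simp add: vimage_def Int_def conj_commute)
    qed simp
    also have "\<dots> = (\<Prod>r<k. l r) * (\<Prod>r<k. t i r) powr (-\<alpha>)"
      using t_pos by (simp add: prod.distrib prod_powr_distrib less_imp_le)
    also have "(\<Prod>r<k. t i r) powr (-\<alpha>) = 2 powr (\<alpha> * real d) * z powr \<alpha>"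
      unfolding prod_t using pos by (simp add: powr_divide powr_powr powr_minus_divide powr_minus powr_mult field_simps)
    finally show ?thesis .
  qed
  have B_meas: "B i \<in> events" for i
    unfolding B_def using pos by (intro sets.finite_INT measurable_sets[OF X]) auto
  have E_sub: "?E \<subseteq> (\<Union>i\<in>Pi\<^sub>E {..<d} (\<lambda>_. {..<N}). B i)"
  proof
    fix \<omega> assume \<omega>: "\<omega> \<in> ?E"
    define x where "x r = enn2real (X r \<omega>)" for r
    have Xx: "X r \<omega> = ennreal (x r)" and xK: "x r \<le> K" if "r < k" for r
    proof -
      have le: "X r \<omega> \<le> ennreal K" using \<omega> that by auto
      then show "X r \<omega> = ennreal (x r)" unfolding x_def by (auto simp: top_unique intro!: ennreal_enn2real[symmetric] le_less_trans[OF le])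
      then show "x r \<le> K" using le pos unfolding x_def by (intro enn2real_leI) auto
    qed
    have x0: "0 \<le> x r" for r by (simp add: x_def)
    have "(\<Prod>r<k. X r \<omega>) = ennreal (\<Prod>r<k. x r)"
      using x0 by (simp add: Xx prod_ennreal)
    then have gt: "1 / z < (\<Prod>r<k. x r)" using \<omega> pos x0 by (simp add: ennreal_less_iff)
    moreover have "0 < 1 / z" using pos by simp
    ultimately have nz: "(\<Prod>r<k. x r) \<noteq> 0" by linarith
    have xp: "0 < x r" if "r < k" for r
    proof -
      have "x r \<noteq> 0" using nz that by (auto simp: prod_zero_iff)
      then show ?thesis using x0[of r] by simp
    qed
    define i where "i = (\<lambda>r\<in>{..<d}. nat \<lfloor>log 2 (K / x r)\<rfloor>)"
    have i_bd: "up (i r) / 2 < x r \<and> x r \<le> up (i r) \<and> i r < N" if r: "r < d" for r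
    proof -
      have rk: "r < k" using r k by simp
      note xr = xp[OF rk] xK[OF rk]
      have "1 \<le> K / x r" using xr by simp
      then have L0: "0 \<le> log 2 (K / x r)" by simp
      have iL: "real (i r) = of_int \<lfloor>log 2 (K / x r)\<rfloor>" using r L0 by (simp add: i_def)
      have a: "real (i r) \<le> log 2 (K / x r)" "log 2 (K / x r) < real (i r) + 1"
        unfolding iL by linarith+
      have "2 powr real (i r) \<le> K / x r" using a(1) xr pos by (simp add: le_log_iff)
      then have 1: "x r \<le> up (i r)" using xr by (simp add: up_def powr_minus field_simps)
      have "K / x r < 2 powr (real (i r) + 1)" using a(2) xr pos by (simp add: log_less_iff)
      then have 2: "up (i r) / 2 < x r" using xr by (simp add: up_def powr_minus powr_add field_simps)
      have "(\<Prod>s<k. x s) = x r * (\<Prod>s\<in>{..<k} - {r}. x s)"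
        using rk by (simp add: prod.remove)
      also have "\<dots> \<le> x r * (\<Prod>s\<in>{..<k} - {r}. K)"
        using x0 xK by (intro mult_left_mono prod_mono) auto
      also have "\<dots> = x r * K ^ d" using rk k by simp
      finally have "1 / z < x r * K ^ d" using gt by linarith
      then have "K / x r < K ^ k * z" using pos xr by (simp add: k field_simps)
      then have "log 2 (K / x r) < log 2 (K ^ k * z)" using xr pos by (intro log_less) auto
      then have "i r < N" using a unfolding N_def by linarith
      then show ?thesis using 1 2 by simp
    qed
    have "\<omega> \<in> B i"
    proof -
      have "ennreal (t i r) < X r \<omega>" if r: "r < k" for r
      proof (cases "r < d")
        case True
        then show ?thesis using i_bd[OF True] Xx[OF r] t_pos[of i r] by (simp add: t_def ennreal_less_iff)
      next
        case False
        then have rd: "r = d" using r k by simp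
        have "(\<Prod>s<d. x s) \<le> (\<Prod>s<d. up (i s))" using i_bd x0 by (intro prod_mono) auto
        then have "(\<Prod>s<d. x s) * x d \<le> (\<Prod>s<d. up (i s)) * x d" using x0 by (intro mult_right_mono) auto
        moreover have "1 / z < (\<Prod>s<d. x s) * x d" using gt by (simp add: k)
        ultimately have "1 / z < (\<Prod>s<d. up (i s)) * x d" by linarith
        moreover have "0 < (\<Prod>s<d. up (i s))" using up_pos by (intro prod_pos) auto
        ultimately have "t i d < x d" using pos by (simp add: t_def field_simps)
        then show ?thesis using Xx[OF r] t_pos[of i r] by (simp add: rd ennreal_less_iff)
      qed
      then show ?thesis using \<omega> by (auto simp: B_def)
    qed
    moreover have "i \<in> Pi\<^sub>E {..<d} (\<lambda>_. {..<N})" using i_bd by (auto simp: i_def)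
    ultimately show "\<omega> \<in> (\<Union>i\<in>Pi\<^sub>E {..<d} (\<lambda>_. {..<N}). B i)" by blast
  qed
  have fin: "finite (Pi\<^sub>E {..<d} (\<lambda>_::nat. {..<N}))" by (intro finite_PiE) auto
  have "prob ?E \<le> prob (\<Union>i\<in>Pi\<^sub>E {..<d} (\<lambda>_. {..<N}). B i)"
    using E_sub B_meas fin by (intro finite_measure_mono sets.finite_UN) auto
  also have "\<dots> \<le> (\<Sum>i\<in>Pi\<^sub>E {..<d} (\<lambda>_. {..<N}). prob (B i))"
    using B_meas fin by (intro finite_measure_subadditive_finite) auto
  also have "\<dots> \<le> (\<Sum>i\<in>Pi\<^sub>E {..<d} (\<lambda>_::nat. {..<N}). (\<Prod>r<k. l r) * (2 powr (\<alpha> * real d) * z powr \<alpha>))"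
    by (intro sum_mono B_le)
  also have "\<dots> = (\<Prod>r<k. l r) * product_tail \<alpha> k K z"
    by (simp add: card_PiE product_tail_def k N_def)
  finally show ?thesis .
qed

lemma product_tail_mono:
  assumes "0 < \<alpha>" "0 < K" "0 \<le> z" "z \<le> z'"
  shows "product_tail \<alpha> k K z \<le> product_tail \<alpha> k K z'"
proof (cases "z = 0")
  case True
  then show ?thesis using product_tail_nonneg by (simp add: product_tail_def)
next
  case False
  then have z: "0 < z" using assms by simp
  have "log 2 (K ^ k * z) \<le> log 2 (K ^ k * z')" using z assms by (intro log_mono) auto
  then have "nat \<lceil>log 2 (K ^ k * z)\<rceil> \<le> nat \<lceil>log 2 (K ^ k * z')\<rceil>"
    by (intro nat_mono ceiling_mono)
  then show ?thesis unfolding product_tail_def using z assms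
    by (intro mult_mono power_mono powr_mono2) auto
qed

text \<open>A product of \<open>k\<close> factors bounded by \<open>K\<close> never exceeds \<open>K\<^sup>k\<close>; the estimate reflects this when there
is at least one logarithmic factor.\<close>

lemma product_tail_eq_0:
  assumes "0 < K" "0 \<le> z" "K ^ k * z \<le> 1" "2 \<le> k"
  shows "product_tail \<alpha> k K z = 0"
proof (cases "z = 0")
  case False
  then have "log 2 (K ^ k * z) \<le> 0" using assms by simp
  then have "nat \<lceil>log 2 (K ^ k * z)\<rceil> = 0" by simp
  then show ?thesis using assms by (simp add: product_tail_def zero_power)
qed (simp add: product_tail_def)

text \<open>This is the integrand of \<open>LlnL\<close> up to a constant: a fixed scaling inside the logarithm changes
\<open>1 + ln\<^bsup>k-1\<^esup>\<close> by a bounded factor only.\<close>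

lemma product_tail_le_log:
  assumes "0 < \<alpha>" "0 < K" "0 < L"
  shows "\<exists>C\<ge>0. \<forall>y\<ge>0. product_tail \<alpha> k K (L * y) \<le> C * (y powr \<alpha> * (1 + ln (max y 1) ^ (k - 1)))"
proof -
  define a where "a = \<bar>log 2 (K ^ k * L)\<bar>"
  have a0: "0 \<le> a" by (simp add: a_def)
  define b where "b = a + 1 + 1 / ln 2"
  have b1: "1 \<le> b" using a0 by (simp add: b_def)
  define C where "C = 2 powr (\<alpha> * real (k - 1)) * L powr \<alpha> * (2 * b) ^ (k - 1)"
  have "product_tail \<alpha> k K (L * y) \<le> C * (y powr \<alpha> * (1 + ln (max y 1) ^ (k - 1)))" if y: "0 \<le> y" for y
  proof (cases "y = 0")
    case True
    then show ?thesis by (simp add: product_tail_def)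
  next
    case False
    then have y: "0 < y" using that by simp
    define u where "u = ln (max y 1)"
    have u0: "0 \<le> u" by (simp add: u_def)
    have "log 2 (K ^ k * (L * y)) = log 2 (K ^ k * L) + log 2 y"
      using y assms by (simp add: log_mult mult.assoc)
    also have "log 2 y \<le> u / ln 2"
      using y by (auto simp: log_def u_def intro!: divide_right_mono)
    finally have 1: "log 2 (K ^ k * (L * y)) \<le> a + u / ln 2" by (simp add: a_def)
    have nn: "0 \<le> u / ln 2" using u0 by simp
    have "real (nat \<lceil>log 2 (K ^ k * (L * y))\<rceil>) \<le> a + u / ln 2 + 1"
      using 1 nn a0 by linarith
    also have "\<dots> \<le> b * (1 + u)"
    proof -
      have "b * (1 + u) = a + 1 + 1 / ln 2 + (a + 1) * u + u / ln 2"
        by (simp add: b_def algebra_simps add_divide_distrib)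
      moreover have "0 \<le> (a + 1) * u" using u0 a0 by simp
      moreover have "0 \<le> 1 / ln (2::real)" by simp
      ultimately show ?thesis by linarith
    qed
    also have "\<dots> \<le> b * (2 * max 1 u)" using b1 by (intro mult_left_mono) auto
    finally have "real (nat \<lceil>log 2 (K ^ k * (L * y))\<rceil>) \<le> 2 * b * max 1 u" by simp
    then have "real (nat \<lceil>log 2 (K ^ k * (L * y))\<rceil>) ^ (k - 1) \<le> (2 * b * max 1 u) ^ (k - 1)"
      by (intro power_mono) auto
    also have "\<dots> = (2 * b) ^ (k - 1) * max 1 u ^ (k - 1)" by (simp add: power_mult_distrib)
    also have "max 1 u ^ (k - 1) \<le> 1 + u ^ (k - 1)" using u0 by (auto simp: max_def)
    finally have 2: "real (nat \<lceil>log 2 (K ^ k * (L * y))\<rceil>) ^ (k - 1) \<le> (2 * b) ^ (k - 1) * (1 + u ^ (k - 1))"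
      using b1 by simp
    have "product_tail \<alpha> k K (L * y) \<le> 2 powr (\<alpha> * real (k - 1)) * (L * y) powr \<alpha> * ((2 * b) ^ (k - 1) * (1 + u ^ (k - 1)))"
      unfolding product_tail_def using 2 by (intro mult_left_mono) auto
    also have "\<dots> = C * (y powr \<alpha> * (1 + u ^ (k - 1)))"
      using y assms by (simp add: C_def powr_mult mult_ac)
    finally show ?thesis by (simp add: u_def)
  qed
  moreover have "0 \<le> C" using b1 by (simp add: C_def)
  ultimately show ?thesis by blast
qed

section \<open>Off-diagonal rectangles\<close>

definition offdiag_rects :: "nat \<Rightarrow> 'e measure \<Rightarrow> (nat \<Rightarrow> 'e) set set" where
  "offdiag_rects k \<mu> = Pi\<^sub>E {..<k} ` offdiag_sides k \<mu>"

lemma offdiag_sides_subset: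
  assumes "R \<in> offdiag_sides k \<mu>" "\<And>i. i < k \<Longrightarrow> S i \<in> sets \<mu>" "\<And>i. i < k \<Longrightarrow> S i \<subseteq> R i"
  shows "S \<in> offdiag_sides k \<mu>"
proof -
  have "disjoint_family_on S {..<k}"
    unfolding disjoint_family_on_def
  proof safe
    fix i j x assume ij: "i < k" "j < k" "i \<noteq> j" and x: "x \<in> S i" "x \<in> S j"
    then have "x \<in> R i \<inter> R j" using assms(3) by blast
    then show "x \<in> {}" using assms(1) ij by (auto simp: offdiag_sides_def disjoint_family_on_def)
  qed
  then show ?thesis using assms(2) by (auto simp: offdiag_sides_def)
qed

lemma offdiag_sides_sets: "R \<in> offdiag_sides k \<mu> \<Longrightarrow> i < k \<Longrightarrow> R i \<in> sets \<mu>"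
  by (auto simp: offdiag_sides_def)

lemma offdiag_rects_in_offdiag_sets:
  assumes "R \<in> offdiag_sides k \<mu>"
  shows "Pi\<^sub>E {..<k} R \<in> offdiag_sets k \<mu>" "Pi\<^sub>E {..<k} R \<in> sets (power_measure k \<mu>)"
proof -
  show m: "Pi\<^sub>E {..<k} R \<in> sets (power_measure k \<mu>)"
    using assms by (intro sets_PiM_I_finite) (auto dest: offdiag_sides_sets)
  have "x \<notin> diagonal_set k \<mu>" if "x \<in> Pi\<^sub>E {..<k} R" for x
  proof
    assume "x \<in> diagonal_set k \<mu>"
    then obtain i j where ij: "i < k" "j < k" "i \<noteq> j" "x i = x j" by (auto simp: diagonal_set_def)
    then have "x i \<in> R i \<inter> R j" using PiE_mem[OF that, of i] PiE_mem[OF that, of j] by simp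
    then show False using assms ij by (auto simp: offdiag_sides_def disjoint_family_on_def)
  qed
  then have "Pi\<^sub>E {..<k} R = Pi\<^sub>E {..<k} R \<inter> offdiag_space k \<mu>"
    using sets.sets_into_space[OF m] by (auto simp: offdiag_space_def)
  then show "Pi\<^sub>E {..<k} R \<in> offdiag_sets k \<mu>" using m by (auto simp: offdiag_sets_def)
qed

text \<open>A point of the first rectangle outside the second is classified by the first coordinate that leaves
the second rectangle; this makes the pieces disjoint.\<close>

lemma PiE_Diff_decomposition:
  fixes x :: "nat \<Rightarrow> 'a"
  assumes "x \<in> Pi\<^sub>E {..<k} R"
  shows "x \<notin> Pi\<^sub>E {..<k} S \<longleftrightarrow>
    (\<exists>j<k. x \<in> Pi\<^sub>E {..<k} (\<lambda>i. if i < j then R i \<inter> S i else if i = j then R i - S i else R i))"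
    (is "?L \<longleftrightarrow> ?R")
proof
  assume ?L
  then have ex: "\<exists>j. j < k \<and> x j \<notin> S j" using assms by (auto simp: PiE_def Pi_iff)
  define j where "j = (LEAST j. j < k \<and> x j \<notin> S j)"
  have j: "j < k" "x j \<notin> S j" using LeastI_ex[of "\<lambda>j. j < k \<and> x j \<notin> S j"] ex by (auto simp: j_def)
  have "x i \<in> S i" if "i < j" for i using not_less_Least[of i "\<lambda>j. j < k \<and> x j \<notin> S j"] that j by (auto simp: j_def)
  then show ?R using j assms by (intro exI[of _ j]) (auto simp: PiE_def Pi_iff)
next
  assume ?R
  then obtain j where j: "j < k"
    "x \<in> Pi\<^sub>E {..<k} (\<lambda>i. if i < j then R i \<inter> S i else if i = j then R i - S i else R i)" by blast
  then have "x j \<notin> S j" using PiE_mem[OF j(2), of j] by simp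
  then show ?L using j(1) by (auto simp: PiE_def Pi_iff)
qed

text \<open>Shrinking the sides of an off-diagonal rectangle keeps them pairwise disjoint, so the usual semiring
structure of rectangles survives. It gives disjoint decompositions of finite unions and the closure
of finite unions under differences.\<close>

lemma semiring_offdiag_rects:
  assumes "0 < k"
  shows "semiring_of_sets (space (power_measure k \<mu>)) (offdiag_rects k \<mu>)"
proof
  show "offdiag_rects k \<mu> \<subseteq> Pow (space (power_measure k \<mu>))"
    using offdiag_rects_in_offdiag_sets(2)[THEN sets.sets_into_space] by (auto simp: offdiag_rects_def)
  have "(\<lambda>_. {}) \<in> offdiag_sides k \<mu>" by (auto simp: offdiag_sides_def disjoint_family_on_def)
  moreover have "{} = Pi\<^sub>E {..<k} (\<lambda>_. {} :: 'a set)" using assms by (auto simp: PiE_eq_empty_iff)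
  ultimately show "{} \<in> offdiag_rects k \<mu>" unfolding offdiag_rects_def by (metis imageI)
next
  fix a b assume "a \<in> offdiag_rects k \<mu>" "b \<in> offdiag_rects k \<mu>"
  then obtain R S where R: "R \<in> offdiag_sides k \<mu>" "a = Pi\<^sub>E {..<k} R"
    and S: "S \<in> offdiag_sides k \<mu>" "b = Pi\<^sub>E {..<k} S" by (auto simp: offdiag_rects_def)
  have "(\<lambda>i. R i \<inter> S i) \<in> offdiag_sides k \<mu>"
    by (rule offdiag_sides_subset[OF R(1)]) (auto intro!: sets.Int offdiag_sides_sets[OF R(1)] offdiag_sides_sets[OF S(1)])
  then show "a \<inter> b \<in> offdiag_rects k \<mu>" unfolding R S PiE_Int by (auto simp: offdiag_rects_def)
  define T where "T j = (\<lambda>i. if i < j then R i \<inter> S i else if i = j then R i - S i else R i)" for j :: nat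
  have T: "T j \<in> offdiag_sides k \<mu>" for j
    by (rule offdiag_sides_subset[OF R(1)])
       (auto simp: T_def intro!: sets.Int sets.Diff offdiag_sides_sets[OF R(1)] offdiag_sides_sets[OF S(1)])
  have "Pi\<^sub>E {..<k} (T j) \<inter> Pi\<^sub>E {..<k} (T j') = {}" if "j < j'" "j' < k" for j j'
  proof safe
    fix x assume x: "x \<in> Pi\<^sub>E {..<k} (T j)" "x \<in> Pi\<^sub>E {..<k} (T j')"
    have "x j \<in> T j j" "x j \<in> T j' j" using PiE_mem[OF x(1), of j] PiE_mem[OF x(2), of j] that by simp_all
    then show "x \<in> {}" using that by (simp add: T_def)
  qed
  then have "disjoint_family_on (\<lambda>j. Pi\<^sub>E {..<k} (T j)) {..<k}"
    unfolding disjoint_family_on_def by (metis Int_commute lessThan_iff linorder_neqE_nat)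
  then have "disjoint ((\<lambda>j. Pi\<^sub>E {..<k} (T j)) ` {..<k})" by (rule disjoint_family_on_disjoint_image)
  moreover have "Pi\<^sub>E {..<k} R - Pi\<^sub>E {..<k} S = (\<Union>j<k. Pi\<^sub>E {..<k} (T j))"
  proof (intro set_eqI iffI)
    fix x assume "x \<in> Pi\<^sub>E {..<k} R - Pi\<^sub>E {..<k} S"
    then show "x \<in> (\<Union>j<k. Pi\<^sub>E {..<k} (T j))" using PiE_Diff_decomposition[of x k R S] unfolding T_def by blast
  next
    fix x assume x: "x \<in> (\<Union>j<k. Pi\<^sub>E {..<k} (T j))"
    have "Pi\<^sub>E {..<k} (T j) \<subseteq> Pi\<^sub>E {..<k} R" for j by (intro PiE_mono) (auto simp: T_def)
    then have "x \<in> Pi\<^sub>E {..<k} R" using x by blast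
    then show "x \<in> Pi\<^sub>E {..<k} R - Pi\<^sub>E {..<k} S" using PiE_Diff_decomposition[of x k R S] x unfolding T_def by blast
  qed
  ultimately show "\<exists>C\<subseteq>offdiag_rects k \<mu>. finite C \<and> disjoint C \<and> a - b = \<Union> C"
    unfolding R S using T by (intro exI[of _ "(\<lambda>j. Pi\<^sub>E {..<k} (T j)) ` {..<k}"]) (auto simp: offdiag_rects_def)
qed

lemma offdiag_rect_unions_eq_generated_ring:
  assumes "0 < k"
  shows "offdiag_rect_unions k \<mu> = semiring_of_sets.generated_ring (offdiag_rects k \<mu>)"
proof -
  interpret S: semiring_of_sets "space (power_measure k \<mu>)" "offdiag_rects k \<mu>"
    by (rule semiring_offdiag_rects[OF assms])
  interpret G: ring_of_sets "space (power_measure k \<mu>)" S.generated_ring by (rule S.generating_ring)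
  show ?thesis
  proof (intro set_eqI iffI)
    fix B assume "B \<in> offdiag_rect_unions k \<mu>"
    then obtain m :: nat and R where "R ` {..<m} \<subseteq> offdiag_sides k \<mu>" "B = (\<Union>i<m. Pi\<^sub>E {..<k} (R i))"
      by (auto simp: offdiag_rect_unions_def)
    then show "B \<in> S.generated_ring"
      by (simp, intro G.finite_UN S.generated_ringI_Basic) (auto simp: offdiag_rects_def)
  next
    fix B assume "B \<in> S.generated_ring"
    then obtain C where C: "finite C" "C \<subseteq> offdiag_rects k \<mu>" "B = \<Union>C" by (auto elim: S.generated_ringE)
    obtain h where h: "bij_betw h {..<card C} C" using ex_bij_betw_nat_finite[OF C(1)] by (auto simp: atLeast0LessThan)
    have "\<forall>i\<in>{..<card C}. \<exists>R\<in>offdiag_sides k \<mu>. h i = Pi\<^sub>E {..<k} R"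
      using bij_betw_apply[OF h] C(2) unfolding offdiag_rects_def by blast
    then obtain R where R: "\<forall>i\<in>{..<card C}. R i \<in> offdiag_sides k \<mu> \<and> h i = Pi\<^sub>E {..<k} (R i)" by metis
    have "B = (\<Union>i<card C. Pi\<^sub>E {..<k} (R i))" using h R C(3) by (auto simp: bij_betw_def)
    then show "B \<in> offdiag_rect_unions k \<mu>" using R unfolding offdiag_rect_unions_def by blast
  qed
qed

lemma ring_offdiag_rect_unions:
  "0 < k \<Longrightarrow> ring_of_sets (space (power_measure k \<mu>)) (offdiag_rect_unions k \<mu>)"
  by (simp add: offdiag_rect_unions_eq_generated_ring semiring_of_sets.generating_ring semiring_offdiag_rects)

lemma offdiag_rect_unions_disjoint:
  assumes "0 < k" "B \<in> offdiag_rect_unions k \<mu>"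
  obtains C where "finite C" "disjoint C" "C \<subseteq> offdiag_rects k \<mu>" "B = \<Union>C"
proof -
  interpret S: semiring_of_sets "space (power_measure k \<mu>)" "offdiag_rects k \<mu>"
    by (rule semiring_offdiag_rects[OF assms(1)])
  show thesis using assms that by (auto simp: offdiag_rect_unions_eq_generated_ring elim: S.generated_ringE)
qed

lemma offdiag_setsI:
  "A \<in> sets (power_measure k \<mu>) \<Longrightarrow> A \<inter> diagonal_set k \<mu> = {} \<Longrightarrow> A \<in> offdiag_sets k \<mu>"
  using sets.sets_into_space[of A "power_measure k \<mu>"]
  by (auto simp: offdiag_sets_def offdiag_space_def intro!: exI[of _ A])

text \<open>A measurable injection into the reals turns the coincidence of two coordinates into an equation
between real-valued measurable functions.\<close>

lemma borel_space_diagonal_set: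
  assumes "borel_space \<mu>"
  shows "diagonal_set k \<mu> \<in> sets (power_measure k \<mu>)"
proof -
  obtain B :: "real set" and \<phi> where bij: "bij_betw \<phi> (space \<mu>) B"
    and "\<phi> \<in> measurable \<mu> (restrict_space borel B)"
    using assms unfolding borel_space_def by blast
  then have phi: "\<phi> \<in> borel_measurable \<mu>" by (simp add: measurable_restrict_space2_iff)
  have inj: "\<phi> a = \<phi> b \<longleftrightarrow> a = b" if "a \<in> space \<mu>" "b \<in> space \<mu>" for a b
    using bij that by (auto simp: bij_betw_def inj_on_def)
  have comp: "x i \<in> space \<mu>" if "x \<in> space (power_measure k \<mu>)" "i \<in> {..<k}" for x i
    using that by (auto simp: space_PiM)
  have "diagonal_set k \<mu> = {x \<in> space (power_measure k \<mu>). \<exists>i\<in>{..<k}. \<exists>j\<in>{..<k}. i \<noteq> j \<and> \<phi> (x i) = \<phi> (x j)}"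
    unfolding diagonal_set_def
  proof (rule Collect_cong, rule conj_cong[OF refl])
    fix x assume x: "x \<in> space (power_measure k \<mu>)"
    show "(\<exists>i<k. \<exists>j<k. i \<noteq> j \<and> x i = x j) \<longleftrightarrow> (\<exists>i\<in>{..<k}. \<exists>j\<in>{..<k}. i \<noteq> j \<and> \<phi> (x i) = \<phi> (x j))"
    proof -
      have "(\<exists>i\<in>{..<k}. \<exists>j\<in>{..<k}. i \<noteq> j \<and> \<phi> (x i) = \<phi> (x j)) \<longleftrightarrow> (\<exists>i\<in>{..<k}. \<exists>j\<in>{..<k}. i \<noteq> j \<and> x i = x j)"
        by (intro bex_cong refl conj_cong inj comp x)
      then show ?thesis unfolding Bex_def lessThan_iff by (rule sym)
    qed
  qed
  moreover have "{x \<in> space (power_measure k \<mu>). i \<noteq> j \<and> \<phi> (x i) = \<phi> (x j)} \<in> sets (power_measure k \<mu>)"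
    if "i \<in> {..<k}" "j \<in> {..<k}" for i j
  proof -
    have *: "(\<lambda>x. \<phi> (x l)) \<in> borel_measurable (power_measure k \<mu>)" if "l \<in> {..<k}" for l
      by (rule measurable_compose[OF measurable_component_singleton[OF that] phi])
    show ?thesis using borel_measurable_eq[OF *[OF that(1)] *[OF that(2)]] by (cases "i = j") auto
  qed
  ultimately show ?thesis by (simp only:) (intro sets.sets_Collect_finite_Ex finite_lessThan, blast)
qed

lemma offdiag_density:
  "offdiag_sides k (density \<mu> f) = offdiag_sides k \<mu>"
  "offdiag_sets k (density \<mu> f) = offdiag_sets k \<mu>"
  "offdiag_rect_unions k (density \<mu> f) = offdiag_rect_unions k \<mu>"
proof -
  have 1: "sets (power_measure k (density \<mu> f)) = sets (power_measure k \<mu>)"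
    by (rule sets_PiM_cong) auto
  have 2: "space (power_measure k (density \<mu> f)) = space (power_measure k \<mu>)"
    by (rule sets_eq_imp_space_eq[OF 1])
  show 3: "offdiag_sides k (density \<mu> f) = offdiag_sides k \<mu>" by (simp add: offdiag_sides_def)
  show "offdiag_sets k (density \<mu> f) = offdiag_sets k \<mu>"
    unfolding offdiag_sets_def offdiag_space_def diagonal_set_def 1 2 ..
  show "offdiag_rect_unions k (density \<mu> f) = offdiag_rect_unions k \<mu>"
    unfolding offdiag_rect_unions_def 3 ..
qed

section \<open>Tails of products over rectangles\<close>

locale frechet_noise = prob_space P + E: sigma_finite_measure \<mu>
  for P :: "'w measure" and \<mu> :: "'e measure" +
  fixes \<alpha> :: real and k :: nat and M :: "'e set \<Rightarrow> 'w \<Rightarrow> ennreal"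
  assumes alpha_pos: "0 < \<alpha>" and k_pos: "0 < k"
    and frechet: "frechet_sup_measure P \<mu> \<alpha> M"
    and diagonal_measurable: "diagonal_set k \<mu> \<in> sets (power_measure k \<mu>)"
begin

lemma offdiag_sets_iff:
  "A \<in> offdiag_sets k \<mu> \<longleftrightarrow> A \<in> sets (power_measure k \<mu>) \<and> A \<inter> diagonal_set k \<mu> = {}"
proof
  assume "A \<in> offdiag_sets k \<mu>"
  then show "A \<in> sets (power_measure k \<mu>) \<and> A \<inter> diagonal_set k \<mu> = {}"
    using diagonal_measurable by (auto simp: offdiag_sets_def offdiag_space_def)
qed (auto intro: offdiag_setsI)

lemma M_measurable[measurable (raw)]: "A \<in> sets \<mu> \<Longrightarrow> M A \<in> borel_measurable P"
  using frechet by (auto simp: frechet_sup_measure_def)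

lemma M_mono:
  assumes A: "A \<in> sets \<mu>" and B: "B \<in> sets \<mu>" and "A \<subseteq> B"
  shows "AE \<omega> in P. M A \<omega> \<le> M B \<omega>"
proof -
  define C where "C j = (if j = 0 then A else B)" for j :: nat
  have "range C \<subseteq> sets \<mu>" using A B by (auto simp: C_def)
  then have "AE \<omega> in P. M (\<Union>j. C j) \<omega> = (SUP j. M (C j) \<omega>)"
    using frechet by (auto simp: frechet_sup_measure_def)
  moreover have "(\<Union>j. C j) = B" using \<open>A \<subseteq> B\<close> by (auto simp: C_def split: if_splits)
  moreover have "M A \<omega> \<le> (SUP j. M (C j) \<omega>)" for \<omega>
    by (rule SUP_upper2[of 0]) (auto simp: C_def)
  ultimately show ?thesis by auto
qed

lemma M_tail:
  assumes A: "A \<in> sets \<mu>" and fin: "emeasure \<mu> A < \<infinity>" and t: "0 < t"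
  shows "prob {\<omega>\<in>space P. ennreal t < M A \<omega>} \<le> measure \<mu> A * t powr (-\<alpha>)"
proof -
  note [measurable] = M_measurable[OF A]
  have "prob {\<omega>\<in>space P. ennreal t < M A \<omega>} = 1 - prob {\<omega>\<in>space P. M A \<omega> \<le> ennreal t}"
    by (subst prob_compl[symmetric]) (auto intro!: arg_cong[where f=prob])
  also have "prob {\<omega>\<in>space P. M A \<omega> \<le> ennreal t} = exp (- measure \<mu> A * t powr (-\<alpha>))"
    using frechet A t fin unfolding frechet_sup_measure_def by auto
  also have "1 - exp (- measure \<mu> A * t powr (-\<alpha>)) \<le> measure \<mu> A * t powr (-\<alpha>)"
    using exp_ge_add_one_self[of "- measure \<mu> A * t powr (-\<alpha>)"] by linarith
  finally show ?thesis .
qed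

lemma M_tail_emeasure:
  assumes A: "A \<in> sets \<mu>" and t: "0 < t"
  shows "emeasure P {\<omega>\<in>space P. ennreal t < M A \<omega>} \<le> emeasure \<mu> A * ennreal (t powr (-\<alpha>))"
proof (cases "emeasure \<mu> A < \<infinity>")
  case True
  then have "emeasure \<mu> A * ennreal (t powr (-\<alpha>)) = ennreal (measure \<mu> A * t powr (-\<alpha>))"
    by (simp add: emeasure_eq_ennreal_measure ennreal_mult)
  then show ?thesis using M_tail[OF A True t] by (simp add: emeasure_eq_measure)
next
  case False
  then have "emeasure \<mu> A * ennreal (t powr (-\<alpha>)) = \<infinity>"
    using t by (simp add: less_top[symmetric] ennreal_top_mult)
  then show ?thesis by simp
qed

lemma M_indep:
  assumes "R \<in> offdiag_sides k \<mu>"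
  shows "indep_vars (\<lambda>_. borel) (\<lambda>i. M (R i)) {..<k}"
  using assms frechet by (auto simp: frechet_sup_measure_def offdiag_sides_def)

text \<open>The constant in front of the control measure in tail bounds for sets inside a rectangle on whose
\<open>i\<close>-th side \<open>M\<close> is rescaled by \<open>s i\<close>.\<close>

definition cell_bound :: "(nat \<Rightarrow> real) \<Rightarrow> real \<Rightarrow> real \<Rightarrow> ennreal" where
  "cell_bound s K t =
     ennreal (\<Prod>i<k. s i powr \<alpha>) * ennreal (product_tail \<alpha> k K (1 / (t * (\<Prod>i<k. s i))))"

lemma cell_bound_finite: "cell_bound s K t < \<infinity>"
  by (simp add: cell_bound_def ennreal_mult_less_top)

text \<open>Rescaling by \<open>s i\<close> multiplies the control measure by \<open>s i powr \<alpha>\<close>. The truncation is imposed on the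
larger sets \<open>D i\<close>, so that one event serves all rectangles inside the same cell.\<close>

lemma rect_tail:
  assumes R: "R \<in> offdiag_sides k \<mu>" and D: "\<And>i. i < k \<Longrightarrow> D i \<in> sets \<mu>" "\<And>i. i < k \<Longrightarrow> R i \<subseteq> D i"
    and fin: "\<And>i. i < k \<Longrightarrow> emeasure \<mu> (R i) < \<infinity>"
    and s: "\<And>i. i < k \<Longrightarrow> 0 < s i" and K: "0 < K" and t: "0 < t"
  shows "emeasure P {\<omega>\<in>space P. ennreal t < (\<Prod>i<k. M (R i) \<omega>) \<and> (\<forall>i<k. ennreal (s i) * M (D i) \<omega> \<le> ennreal K)}
    \<le> cell_bound s K t * (\<Prod>i<k. emeasure \<mu> (R i))"
    (is "emeasure P ?E \<le> _")
proof -
  have Rm: "R i \<in> sets \<mu>" if "i < k" for i using R that by (rule offdiag_sides_sets)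
  note [measurable] = M_measurable[OF Rm] M_measurable[OF D(1)]
  define X where "X i \<omega> = ennreal (s i) * M (R i) \<omega>" for i \<omega>
  define z where "z = 1 / (t * (\<Prod>i<k. s i))"
  have sp: "0 < (\<Prod>i<k. s i)" using s by (intro prod_pos) auto
  then have z: "0 < z" "1 / z = t * (\<Prod>i<k. s i)" using t by (auto simp: z_def)
  have Xm[measurable]: "X i \<in> borel_measurable P" if "i < k" for i
    unfolding X_def using that by measurable
  let ?F = "{\<omega>\<in>space P. ennreal (1 / z) < (\<Prod>i<k. X i \<omega>) \<and> (\<forall>i<k. X i \<omega> \<le> ennreal K)}"
  have "AE \<omega> in P. \<forall>i\<in>{..<k}. M (R i) \<omega> \<le> M (D i) \<omega>"
    using Rm D by (intro AE_finite_allI) (auto intro!: M_mono)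
  then have "AE \<omega> in P. \<omega> \<in> ?E \<longrightarrow> \<omega> \<in> ?F"
  proof eventually_elim
    case (elim \<omega>)
    show ?case
    proof safe
      assume gt: "ennreal t < (\<Prod>i<k. M (R i) \<omega>)" and G: "\<forall>i<k. ennreal (s i) * M (D i) \<omega> \<le> ennreal K"
      have "(\<Prod>i<k. X i \<omega>) = ennreal (\<Prod>i<k. s i) * (\<Prod>i<k. M (R i) \<omega>)"
        unfolding X_def prod.distrib using s by (subst prod_ennreal) (auto intro: less_imp_le)
      moreover have "ennreal (1 / z) = ennreal (\<Prod>i<k. s i) * ennreal t"
        using z sp t by (simp add: ennreal_mult[symmetric] mult.commute)
      ultimately show "ennreal (1 / z) < (\<Prod>i<k. X i \<omega>)"
        using gt sp by (simp add: ennreal_mult_strict_left_mono)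
      fix i assume i: "i < k"
      have "X i \<omega> \<le> ennreal (s i) * M (D i) \<omega>"
        unfolding X_def using elim i by (intro mult_left_mono) auto
      then show "X i \<omega> \<le> ennreal K" using G i by force
    qed
  qed
  moreover have "?F \<in> sets P" by measurable
  ultimately have "emeasure P ?E \<le> emeasure P ?F" by (rule emeasure_mono_AE)
  also have "emeasure P ?F \<le> ennreal ((\<Prod>i<k. measure \<mu> (R i) * s i powr \<alpha>) * product_tail \<alpha> k K z)"
    unfolding emeasure_eq_measure
  proof (intro ennreal_leI prob_prod_gt_bounded_factors)
    have "indep_vars (\<lambda>_. borel) (\<lambda>i \<omega>. ennreal (s i) * M (R i) \<omega>) {..<k}"
      by (rule indep_vars_compose2[OF M_indep[OF R]]) simp
    then show "indep_vars (\<lambda>_. borel) X {..<k}" by (simp add: X_def[abs_def])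
  next
    fix r u assume r: "r < k" and u: "0 < (u::real)"
    have eq: "ennreal u < X r \<omega> \<longleftrightarrow> ennreal (u / s r) < M (R r) \<omega>" for \<omega>
    proof -
      have u': "ennreal u = ennreal (s r) * ennreal (u / s r)"
        using s[OF r] u by (simp add: ennreal_mult[symmetric])
      show ?thesis unfolding X_def u' using s[OF r] by (rule ennreal_mult_less_iff)
    qed
    have "prob {\<omega>\<in>space P. ennreal u < X r \<omega>} \<le> measure \<mu> (R r) * (u / s r) powr (-\<alpha>)"
      unfolding eq using u s[OF r] Rm[OF r] fin[OF r] by (intro M_tail) auto
    also have "(u / s r) powr (-\<alpha>) = s r powr \<alpha> * u powr (-\<alpha>)"
      using u s[OF r] by (simp add: powr_divide powr_minus field_simps)
    finally show "prob {\<omega>\<in>space P. ennreal u < X r \<omega>} \<le> measure \<mu> (R r) * s r powr \<alpha> * u powr (-\<alpha>)"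
      by (simp add: mult_ac)
  qed (use alpha_pos k_pos K z in auto)
  also have "\<dots> = cell_bound s K t * (\<Prod>i<k. emeasure \<mu> (R i))"
  proof -
    have "(\<Prod>i<k. emeasure \<mu> (R i)) = ennreal (\<Prod>i<k. measure \<mu> (R i))"
    proof (subst prod_ennreal[symmetric])
      show "(\<Prod>i<k. emeasure \<mu> (R i)) = (\<Prod>i<k. ennreal (measure \<mu> (R i)))"
        by (intro prod.cong refl emeasure_eq_ennreal_measure less_imp_neq[of _ \<top>]) (use fin in auto)
    qed simp
    moreover have "0 \<le> (\<Prod>i<k. measure \<mu> (R i))" "0 \<le> (\<Prod>i<k. s i powr \<alpha>)" by (auto intro: prod_nonneg)
    ultimately show ?thesis
      using product_tail_nonneg[of \<alpha> k K z]
      by (simp add: cell_bound_def z_def[symmetric] prod.distrib ennreal_mult[symmetric] mult_ac)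
  qed
  finally show ?thesis .
qed

end

section \<open>Convergence in the mean of order gamma\<close>

lemma ennreal_powr_top_iff: "ennreal_powr y p = \<top> \<longleftrightarrow> y = \<top>"
  by (simp add: ennreal_powr_def)

text \<open>Markov's inequality. If one variable exceeds the other by a positive amount, the smaller one is
finite, so the truncated differences in \<open>Lgamma_tendsto\<close> measure the gap correctly.\<close>

lemma Lgamma_tendsto_imp_prob:
  assumes [measurable]: "\<And>n. X n \<in> borel_measurable P" "Y \<in> borel_measurable P"
    and L: "Lgamma_tendsto P \<gamma> X Y" and pos: "0 < \<gamma>" "0 < (x::real)"
  shows "(\<lambda>n. emeasure P {\<omega>\<in>space P. Y \<omega> + ennreal x < X n \<omega> \<or> X n \<omega> + ennreal x < Y \<omega>}) \<longlonglongrightarrow> 0"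
    (is "(\<lambda>n. emeasure P (?E n)) \<longlonglongrightarrow> 0")
proof -
  define I where "I n = (\<integral>\<^sup>+ \<omega>. ennreal_powr ((X n \<omega> - Y \<omega>) + (Y \<omega> - X n \<omega>)) \<gamma> \<partial>P)" for n
  have I: "I \<longlonglongrightarrow> 0" using L by (simp add: Lgamma_tendsto_def I_def[abs_def])
  have diff: "ennreal x \<le> a - b" if "b + ennreal x < a" for a b
  proof -
    have "b \<noteq> \<top>" using that by auto
    then show ?thesis using that
      by (metis add.commute ennreal_add_diff_cancel_left ennreal_minus_mono less_imp_le order_refl)
  qed
  have powr: "ennreal (x powr \<gamma>) \<le> ennreal_powr z \<gamma>" if "ennreal x \<le> z" for z
  proof (cases "z = \<top>")
    case False
    then obtain y where y: "z = ennreal y" "0 \<le> y" by (cases z) auto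
    then have "x \<le> y" using that pos by simp
    then show ?thesis using y pos by (auto simp: ennreal_powr_def intro!: ennreal_leI powr_mono2)
  qed (simp add: ennreal_powr_def)
  have bound: "emeasure P (?E n) \<le> ennreal (1 / x powr \<gamma>) * I n" for n
  proof -
    have "ennreal (x powr \<gamma>) * emeasure P (?E n) = (\<integral>\<^sup>+ \<omega>. ennreal (x powr \<gamma>) * indicator (?E n) \<omega> \<partial>P)"
      by (simp add: nn_integral_cmult_indicator)
    also have "\<dots> \<le> I n"
      unfolding I_def
    proof (rule nn_integral_mono)
      fix \<omega>
      have "ennreal x \<le> (X n \<omega> - Y \<omega>) + (Y \<omega> - X n \<omega>)" if "\<omega> \<in> ?E n"
        using that diff[of "Y \<omega>" "X n \<omega>"] diff[of "X n \<omega>" "Y \<omega>"]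
        by (auto intro: add_increasing add_increasing2)
      then show "ennreal (x powr \<gamma>) * indicator (?E n) \<omega> \<le> ennreal_powr ((X n \<omega> - Y \<omega>) + (Y \<omega> - X n \<omega>)) \<gamma>"
        using powr by (auto simp: indicator_def)
    qed
    finally have "ennreal (1 / x powr \<gamma>) * (ennreal (x powr \<gamma>) * emeasure P (?E n)) \<le> ennreal (1 / x powr \<gamma>) * I n"
      by (rule mult_left_mono) simp
    then show ?thesis using pos by (simp add: mult.assoc[symmetric] ennreal_mult[symmetric])
  qed
  have "(\<lambda>n. ennreal (1 / x powr \<gamma>) * I n) \<longlonglongrightarrow> ennreal (1 / x powr \<gamma>) * 0"
    by (intro ennreal_tendsto_cmult I) simp
  then show ?thesis
    by (intro tendsto_sandwich[of "\<lambda>_. 0" "\<lambda>n. emeasure P (?E n)" sequentially "\<lambda>n. ennreal (1 / x powr \<gamma>) * I n" 0])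
       (auto intro!: always_eventually bound)
qed

section \<open>The product sup measure over a set of finite control measure\<close>

locale finite_frechet_product = frechet_noise P \<mu> \<alpha> k M
  for P :: "'w measure" and \<mu> :: "'e measure" and \<alpha> k M +
  fixes F :: "'e set" and \<Phi> :: "(nat \<Rightarrow> 'e) set \<Rightarrow> 'w \<Rightarrow> ennreal"
  assumes F: "F \<in> sets \<mu>" "emeasure \<mu> F < \<infinity>"
    and Phi: "finite_product_sup_measure P (density \<mu> (indicator F)) \<alpha> k (\<lambda>A. M (A \<inter> F)) \<Phi>"
begin

abbreviation \<nu> :: "(nat \<Rightarrow> 'e) measure" where
  "\<nu> \<equiv> power_measure k (density \<mu> (indicator F))"

lemma sets_nu: "sets \<nu> = sets (power_measure k \<mu>)"
  by (rule sets_PiM_cong) auto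

lemma emeasure_restricted: "A \<in> sets \<mu> \<Longrightarrow> emeasure (density \<mu> (indicator F)) A = emeasure \<mu> (A \<inter> F)"
  using F(1) by (subst emeasure_density) (auto simp: Int_commute indicator_inter_arith[symmetric])

lemma finite_measure_restricted: "finite_measure (density \<mu> (indicator F))"
proof
  have "emeasure (density \<mu> (indicator F)) (space \<mu>) = emeasure \<mu> (space \<mu> \<inter> F)"
    by (rule emeasure_restricted) simp
  also have "space \<mu> \<inter> F = F" using sets.sets_into_space[OF F(1)] by auto
  finally show "emeasure (density \<mu> (indicator F)) (space (density \<mu> (indicator F))) \<noteq> \<infinity>" using F(2) by auto
qed

lemma emeasure_nu_PiE:
  assumes "\<And>i. i < k \<Longrightarrow> A i \<in> sets \<mu>"
  shows "emeasure \<nu> (Pi\<^sub>E {..<k} A) = (\<Prod>i<k. emeasure \<mu> (A i \<inter> F))"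
proof -
  interpret N: finite_measure "density \<mu> (indicator F)" by (rule finite_measure_restricted)
  interpret N: product_sigma_finite "\<lambda>_::nat. density \<mu> (indicator F)" by standard
  show ?thesis using assms
    by (subst N.emeasure_PiM) (auto intro!: prod.cong simp: emeasure_restricted)
qed

lemma finite_nu: "emeasure \<nu> A < \<infinity>"
proof -
  have "emeasure \<nu> A \<le> emeasure \<nu> (Pi\<^sub>E {..<k} (\<lambda>_. space \<mu>))"
    using emeasure_space[of \<nu> A] by (simp add: space_PiM)
  also have "\<dots> = (\<Prod>i<k. emeasure \<mu> (space \<mu> \<inter> F))" by (rule emeasure_nu_PiE) simp
  also have "space \<mu> \<inter> F = F" using sets.sets_into_space[OF F(1)] by auto
  finally show ?thesis using F(2) by (auto simp: power_less_top_ennreal elim!: le_less_trans)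
qed

lemma nu_density: "\<nu> = density (power_measure k \<mu>) (tensor_power k (indicator F))"
proof (rule power_measure_density)
  interpret N: finite_measure "density \<mu> (indicator F)" by (rule finite_measure_restricted)
  show "sigma_finite_measure (density \<mu> (indicator F))" ..
qed (use F(1) E.sigma_finite_measure_axioms in auto)

lemma emeasure_nu:
  assumes "A \<in> sets (power_measure k \<mu>)"
  shows "emeasure \<nu> A = (\<integral>\<^sup>+x. tensor_power k (indicator F) x * indicator A x \<partial>power_measure k \<mu>)"
proof -
  have "tensor_power k (indicator F) \<in> borel_measurable (power_measure k \<mu>)"
    unfolding tensor_power_def using F(1) by measurable
  then show ?thesis unfolding nu_density using assms by (simp add: emeasure_density)
qed

lemma nu_le: "emeasure \<nu> A \<le> emeasure (power_measure k \<mu>) A"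
proof (cases "A \<in> sets (power_measure k \<mu>)")
  case True
  then have "emeasure \<nu> A = (\<integral>\<^sup>+x. tensor_power k (indicator F) x * indicator A x \<partial>power_measure k \<mu>)"
    by (rule emeasure_nu)
  also have "\<dots> \<le> (\<integral>\<^sup>+x. indicator A x \<partial>power_measure k \<mu>)"
  proof (intro nn_integral_mono)
    fix x
    have "tensor_power k (indicator F) x \<le> (1::ennreal)"
      unfolding tensor_power_def by (intro prod_le_1) (auto simp: indicator_def)
    then show "tensor_power k (indicator F) x * indicator A x \<le> (indicator A x :: ennreal)"
      by (auto simp: indicator_def)
  qed
  finally show ?thesis using True by simp
qed (simp add: emeasure_notin_sets sets_nu)

lemmas Phi_unfolded = Phi[unfolded finite_product_sup_measure_def offdiag_density]

lemma Phi_measurable: "A \<in> offdiag_sets k \<mu> \<Longrightarrow> \<Phi> A \<in> borel_measurable P"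
  by (rule Phi_unfolded[THEN conjunct1, rule_format])

lemma offdiag_sets_nu: "A \<in> offdiag_sets k \<mu> \<Longrightarrow> A \<in> sets \<nu>"
  unfolding offdiag_sets_iff sets_nu by (rule conjunct1)

lemma offdiag_rect_unions_subset: "offdiag_rect_unions k \<mu> \<subseteq> offdiag_sets k \<mu>"
proof
  fix B assume "B \<in> offdiag_rect_unions k \<mu>"
  then obtain m :: nat and R where R: "R ` {..<m} \<subseteq> offdiag_sides k \<mu>" "B = (\<Union>i<m. Pi\<^sub>E {..<k} (R i))"
    unfolding offdiag_rect_unions_def by blast
  have "Pi\<^sub>E {..<k} (R i) \<in> offdiag_sets k \<mu>" if "i < m" for i
    using R(1) that by (intro offdiag_rects_in_offdiag_sets) auto
  then have "Pi\<^sub>E {..<k} (R i) \<in> sets (power_measure k \<mu>)" "Pi\<^sub>E {..<k} (R i) \<inter> diagonal_set k \<mu> = {}" if "i < m" for i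
    using that unfolding offdiag_sets_iff by auto
  then show "B \<in> offdiag_sets k \<mu>" unfolding R(2) offdiag_sets_iff by (intro conjI sets.finite_UN) auto
qed

lemmas rect_unions_offdiag = subsetD[OF offdiag_rect_unions_subset]

lemma Phi_rect:
  "R \<in> offdiag_sides k \<mu> \<Longrightarrow> AE \<omega> in P. \<Phi> (Pi\<^sub>E {..<k} R) \<omega> = (\<Prod>i<k. M (R i \<inter> F) \<omega>)"
  by (rule Phi_unfolded[THEN conjunct2, THEN conjunct1, rule_format])

lemma Phi_Union_rects:
  assumes "finite C" "C \<subseteq> offdiag_rects k \<mu>"
  shows "AE \<omega> in P. \<Phi> (\<Union>C) \<omega> = (SUP c\<in>C. \<Phi> c \<omega>)"
proof -
  obtain h where h: "bij_betw h {..<card C} C" using ex_bij_betw_nat_finite[OF assms(1)] by (auto simp: atLeast0LessThan)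
  have "\<forall>i\<in>{..<card C}. \<exists>R\<in>offdiag_sides k \<mu>. h i = Pi\<^sub>E {..<k} R"
    using bij_betw_apply[OF h] assms(2) unfolding offdiag_rects_def by blast
  then obtain R where R: "\<forall>i\<in>{..<card C}. R i \<in> offdiag_sides k \<mu> \<and> h i = Pi\<^sub>E {..<k} (R i)" by metis
  then have "R ` {..<card C} \<subseteq> offdiag_sides k \<mu>" by auto
  then have "AE \<omega> in P. \<Phi> (\<Union>i<card C. Pi\<^sub>E {..<k} (R i)) \<omega> = (SUP i\<in>{..<card C}. \<Phi> (Pi\<^sub>E {..<k} (R i)) \<omega>)"
    using Phi unfolding finite_product_sup_measure_def offdiag_density by blast
  moreover have C: "C = h ` {..<card C}" using h by (auto simp: bij_betw_def)
  have "(\<Union>i<card C. Pi\<^sub>E {..<k} (R i)) = \<Union>C" using R by (subst (2) C) auto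
  moreover have "(SUP i\<in>{..<card C}. \<Phi> (Pi\<^sub>E {..<k} (R i)) \<omega>) = (SUP c\<in>C. \<Phi> c \<omega>)" for \<omega>
    using R by (subst (2) C) (auto simp: image_image intro!: SUP_cong)
  ultimately show ?thesis by simp
qed

lemma Phi_Union:
  assumes "finite I" "\<And>i. i \<in> I \<Longrightarrow> B i \<in> offdiag_rect_unions k \<mu>"
  shows "AE \<omega> in P. \<Phi> (\<Union>i\<in>I. B i) \<omega> = (SUP i\<in>I. \<Phi> (B i) \<omega>)"
proof -
  have "\<exists>C. finite C \<and> C \<subseteq> offdiag_rects k \<mu> \<and> B i = \<Union>C" if "i \<in> I" for i
    using offdiag_rect_unions_disjoint[OF k_pos assms(2)[OF that]] by metis
  then obtain C where C: "\<And>i. i \<in> I \<Longrightarrow> finite (C i)" "\<And>i. i \<in> I \<Longrightarrow> C i \<subseteq> offdiag_rects k \<mu>"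
    "\<And>i. i \<in> I \<Longrightarrow> B i = \<Union>(C i)" by metis
  have "AE \<omega> in P. \<Phi> (\<Union>(\<Union>i\<in>I. C i)) \<omega> = (SUP c\<in>(\<Union>i\<in>I. C i). \<Phi> c \<omega>)"
    using C(1,2) assms(1) by (intro Phi_Union_rects) auto
  moreover have "\<Union>(\<Union>i\<in>I. C i) = (\<Union>i\<in>I. B i)" using C(3) by auto
  moreover have "AE \<omega> in P. \<forall>i\<in>I. \<Phi> (B i) \<omega> = (SUP c\<in>C i. \<Phi> c \<omega>)"
    using assms(1) C by (intro AE_finite_allI) (auto intro!: Phi_Union_rects)
  ultimately have "AE \<omega> in P. \<Phi> (\<Union>i\<in>I. B i) \<omega> = (SUP c\<in>(\<Union>i\<in>I. C i). \<Phi> c \<omega>) \<and>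
      (\<forall>i\<in>I. \<Phi> (B i) \<omega> = (SUP c\<in>C i. \<Phi> c \<omega>))" by simp
  then show ?thesis by eventually_elim (simp add: SUP_UNION cong: SUP_cong)
qed

lemma Phi_rect_union_mono:
  assumes "A \<in> offdiag_rect_unions k \<mu>" "B \<in> offdiag_rect_unions k \<mu>" "A \<subseteq> B"
  shows "AE \<omega> in P. \<Phi> A \<omega> \<le> \<Phi> B \<omega>"
proof -
  have "AE \<omega> in P. \<Phi> (\<Union>c\<in>{A, B}. c) \<omega> = (SUP c\<in>{A, B}. \<Phi> c \<omega>)"
    using assms by (intro Phi_Union) auto
  moreover have "(\<Union>c\<in>{A, B}. c) = B" using assms(3) by auto
  ultimately have "AE \<omega> in P. \<Phi> B \<omega> = sup (\<Phi> A \<omega>) (\<Phi> B \<omega>)" by simp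
  then show ?thesis by eventually_elim (simp add: sup.absorb_iff2)
qed

lemma rect_union_Int_PiE:
  assumes "B \<in> offdiag_rect_unions k \<mu>" "\<And>i. i < k \<Longrightarrow> D i \<in> sets \<mu>"
  shows "B \<inter> Pi\<^sub>E {..<k} D \<in> offdiag_rect_unions k \<mu>"
proof -
  obtain m :: nat and R where R: "R ` {..<m} \<subseteq> offdiag_sides k \<mu>" "B = (\<Union>i<m. Pi\<^sub>E {..<k} (R i))"
    using assms(1) by (auto simp: offdiag_rect_unions_def)
  have "(\<lambda>i j. R i j \<inter> D j) ` {..<m} \<subseteq> offdiag_sides k \<mu>"
  proof safe
    fix i assume "i < m"
    then have "R i \<in> offdiag_sides k \<mu>" using R(1) by auto
    then show "(\<lambda>j. R i j \<inter> D j) \<in> offdiag_sides k \<mu>"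
      by (rule offdiag_sides_subset) (auto intro!: sets.Int assms(2) offdiag_sides_sets[OF \<open>R i \<in> _\<close>])
  qed
  moreover have "B \<inter> Pi\<^sub>E {..<k} D = (\<Union>i<m. Pi\<^sub>E {..<k} (\<lambda>j. R i j \<inter> D j))"
    unfolding R(2) PiE_Int[symmetric] by blast
  ultimately show ?thesis unfolding offdiag_rect_unions_def
    by (intro CollectI exI[of _ m] exI[of _ "\<lambda>i j. R i j \<inter> D j"] conjI)
qed

text \<open>Union bound over the pieces of a disjoint decomposition, whose control measures add up.\<close>

lemma Phi_rect_union_tail:
  assumes B: "B \<in> offdiag_rect_unions k \<mu>" "B \<subseteq> Pi\<^sub>E {..<k} D" and D: "\<And>i. i < k \<Longrightarrow> D i \<in> sets \<mu>"
    and s: "\<And>i. i < k \<Longrightarrow> 0 < s i" and K: "0 < K" and t: "0 < t"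
  shows "emeasure P {\<omega>\<in>space P. ennreal t < \<Phi> B \<omega> \<and> (\<forall>i<k. ennreal (s i) * M (D i \<inter> F) \<omega> \<le> ennreal K)}
    \<le> cell_bound s K t * emeasure \<nu> B"
proof -
  obtain C where C: "finite C" "disjoint C" "C \<subseteq> offdiag_rects k \<mu>" "B = \<Union>C"
    using offdiag_rect_unions_disjoint[OF k_pos B(1)] .
  have "\<exists>R. R \<in> offdiag_sides k \<mu> \<and> c = Pi\<^sub>E {..<k} R \<and> (\<forall>i<k. R i \<subseteq> D i)" if c: "c \<in> C" for c
  proof -
    obtain R where R: "R \<in> offdiag_sides k \<mu>" "c = Pi\<^sub>E {..<k} R" using C(3) c by (auto simp: offdiag_rects_def)
    have "(\<lambda>i. R i \<inter> D i) \<in> offdiag_sides k \<mu>"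
      by (rule offdiag_sides_subset[OF R(1)]) (auto intro!: sets.Int D offdiag_sides_sets[OF R(1)])
    moreover have "c = Pi\<^sub>E {..<k} (\<lambda>i. R i \<inter> D i)" unfolding PiE_Int[symmetric] R(2)[symmetric] using c C(4) B(2) by blast
    ultimately show ?thesis by blast
  qed
  then obtain R where R: "\<And>c. c \<in> C \<Longrightarrow> R c \<in> offdiag_sides k \<mu>" "\<And>c. c \<in> C \<Longrightarrow> c = Pi\<^sub>E {..<k} (R c)"
    "\<And>c i. c \<in> C \<Longrightarrow> i < k \<Longrightarrow> R c i \<subseteq> D i" by metis
  have Rm: "R c i \<in> sets \<mu>" if "c \<in> C" "i < k" for c i using R(1)[OF that(1)] that(2) by (rule offdiag_sides_sets)
  have RF: "(\<lambda>i. R c i \<inter> F) \<in> offdiag_sides k \<mu>" if "c \<in> C" for c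
    by (rule offdiag_sides_subset[OF R(1)[OF that]]) (auto intro!: sets.Int F(1) Rm that)
  let ?G = "\<lambda>\<omega>. \<forall>i<k. ennreal (s i) * M (D i \<inter> F) \<omega> \<le> ennreal K"
  let ?E = "\<lambda>c. {\<omega>\<in>space P. ennreal t < (\<Prod>i<k. M (R c i \<inter> F) \<omega>) \<and> ?G \<omega>}"
  have meas: "?E c \<in> events" if "c \<in> C" for c
  proof -
    have [measurable]: "M (R c i \<inter> F) \<in> borel_measurable P" "M (D i \<inter> F) \<in> borel_measurable P" if "i < k" for i
      using that \<open>c \<in> C\<close> by (auto intro!: M_measurable sets.Int F(1) Rm D)
    show ?thesis by measurable
  qed
  have "AE \<omega> in P. \<Phi> B \<omega> = (SUP c\<in>C. \<Phi> c \<omega>)"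
    unfolding C(4) by (rule Phi_Union_rects[OF C(1,3)])
  moreover have "AE \<omega> in P. \<forall>c\<in>C. \<Phi> c \<omega> = (\<Prod>i<k. M (R c i \<inter> F) \<omega>)"
    using C(1) Phi_rect[OF R(1)] R(2) by (intro AE_finite_allI) auto
  ultimately have "AE \<omega> in P. \<omega> \<in> {\<omega>\<in>space P. ennreal t < \<Phi> B \<omega> \<and> ?G \<omega>} \<longrightarrow> \<omega> \<in> (\<Union>c\<in>C. ?E c)"
    by eventually_elim (auto simp: less_SUP_iff)
  then have "emeasure P {\<omega>\<in>space P. ennreal t < \<Phi> B \<omega> \<and> ?G \<omega>} \<le> emeasure P (\<Union>c\<in>C. ?E c)"
    using C(1) meas by (intro emeasure_mono_AE sets.finite_UN) auto
  also have "\<dots> \<le> (\<Sum>c\<in>C. emeasure P (?E c))"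
    using C(1) meas by (intro emeasure_subadditive_finite) auto
  also have "\<dots> \<le> (\<Sum>c\<in>C. cell_bound s K t * emeasure \<nu> c)"
  proof (rule sum_mono)
    fix c assume c: "c \<in> C"
    have "emeasure P (?E c) \<le> cell_bound s K t * (\<Prod>i<k. emeasure \<mu> (R c i \<inter> F))"
    proof (rule rect_tail[OF RF[OF c]])
      fix i assume i: "i < k"
      show "emeasure \<mu> (R c i \<inter> F) < \<infinity>"
        using Rm[OF c i] F by (intro le_less_trans[OF emeasure_mono F(2)]) auto
    qed (use R(3)[OF c] s K t sets.Int[OF D F(1)] in \<open>blast+\<close>)
    also have "(\<Prod>i<k. emeasure \<mu> (R c i \<inter> F)) = emeasure \<nu> c"
      using Rm[OF c] by (subst (2) R(2)[OF c]) (simp add: emeasure_nu_PiE)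
    finally show "emeasure P (?E c) \<le> cell_bound s K t * emeasure \<nu> c" .
  qed
  also have "\<dots> = cell_bound s K t * (\<Sum>c\<in>C. emeasure \<nu> c)" by (simp add: sum_distrib_left)
  also have "(\<Sum>c\<in>C. emeasure \<nu> c) = emeasure \<nu> (\<Union>c\<in>C. c)"
  proof (rule sum_emeasure[OF _ _ C(1)])
    show "disjoint_family_on (\<lambda>c. c) C" using C(2) by (auto simp: disjoint_family_on_def disjoint_def)
    have "C \<subseteq> sets \<nu>" using R(1,2) offdiag_rects_in_offdiag_sets(2) unfolding sets_nu by (metis subsetI)
    then show "(\<lambda>c. c) ` C \<subseteq> sets \<nu>" by simp
  qed
  finally show ?thesis using C(4) by simp
qed

text \<open>The truncation level \<open>K\<close> is chosen such that \<open>M F > K\<close> has probability at most \<open>\<delta>\<close>; the constant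
\<open>C\<close> depends on \<open>\<delta>\<close>.\<close>

lemma Phi_rect_union_small:
  assumes "0 < \<delta>" "0 < t"
  shows "\<exists>C\<ge>0. \<forall>B\<in>offdiag_rect_unions k \<mu>.
      emeasure P {\<omega>\<in>space P. ennreal t < \<Phi> B \<omega>} \<le> ennreal \<delta> + ennreal C * emeasure \<nu> B"
proof -
  define v where "v = measure \<mu> F"
  have v: "0 \<le> v" "emeasure \<mu> F = ennreal v" using F by (auto simp: v_def emeasure_eq_ennreal_measure)
  define K where "K = (\<delta> / (v + 1)) powr (- 1 / \<alpha>)"
  have K: "0 < K" "K powr (-\<alpha>) = \<delta> / (v + 1)"
    using assms v alpha_pos by (auto simp: K_def powr_powr)
  define C where "C = enn2real (cell_bound (\<lambda>_. 1) K t)"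
  have cb: "cell_bound (\<lambda>_. 1) K t = ennreal C"
    using cell_bound_finite[of "\<lambda>_. 1" K t] by (simp add: C_def less_top)
  have sF: "space \<mu> \<inter> F = F" using sets.sets_into_space[OF F(1)] by auto
  note [measurable] = M_measurable[OF F(1)]
  have "emeasure P {\<omega>\<in>space P. ennreal t < \<Phi> B \<omega>} \<le> ennreal \<delta> + ennreal C * emeasure \<nu> B"
    if B: "B \<in> offdiag_rect_unions k \<mu>" for B
  proof -
    note [measurable] = Phi_measurable[OF rect_unions_offdiag[OF B]]
    have "emeasure P {\<omega>\<in>space P. ennreal t < \<Phi> B \<omega>}
      \<le> emeasure P ({\<omega>\<in>space P. ennreal K < M F \<omega>} \<union> {\<omega>\<in>space P. ennreal t < \<Phi> B \<omega> \<and> M F \<omega> \<le> ennreal K})"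
      by (intro emeasure_mono) auto
    also have "\<dots> \<le> emeasure P {\<omega>\<in>space P. ennreal K < M F \<omega>} + emeasure P {\<omega>\<in>space P. ennreal t < \<Phi> B \<omega> \<and> M F \<omega> \<le> ennreal K}"
      by (rule emeasure_subadditive) measurable
    also have "\<dots> \<le> ennreal \<delta> + ennreal C * emeasure \<nu> B"
    proof (rule add_mono)
      have "emeasure P {\<omega>\<in>space P. ennreal K < M F \<omega>} \<le> ennreal v * ennreal (\<delta> / (v + 1))"
        using M_tail_emeasure[OF F(1) K(1)] v(2) K(2) by simp
      also have "\<dots> \<le> ennreal \<delta>"
        using v assms by (subst ennreal_mult[symmetric]) (auto intro!: ennreal_leI simp: field_simps)
      finally show "emeasure P {\<omega>\<in>space P. ennreal K < M F \<omega>} \<le> ennreal \<delta>" .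
      have "B \<subseteq> Pi\<^sub>E {..<k} (\<lambda>_. space \<mu>)"
        using sets.sets_into_space[OF offdiag_sets_nu[OF rect_unions_offdiag[OF B]]] by (simp add: space_PiM)
      from Phi_rect_union_tail[OF B this, of "\<lambda>_. 1" K t] K assms k_pos
      have "emeasure P {\<omega>\<in>space P. ennreal t < \<Phi> B \<omega> \<and> (\<forall>i<k. M F \<omega> \<le> ennreal K)} \<le> ennreal C * emeasure \<nu> B"
        by (simp add: sF cb)
      moreover have "(\<forall>i<k. M F \<omega> \<le> ennreal K) = (M F \<omega> \<le> ennreal K)" for \<omega> using k_pos by auto
      ultimately show "emeasure P {\<omega>\<in>space P. ennreal t < \<Phi> B \<omega> \<and> M F \<omega> \<le> ennreal K} \<le> ennreal C * emeasure \<nu> B"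
        by simp
    qed
    finally show ?thesis .
  qed
  moreover have "0 \<le> C" by (simp add: C_def)
  ultimately show ?thesis by (intro exI[of _ C]) simp
qed

lemma Phi_approximation:
  assumes A: "A \<in> offdiag_sets k \<mu>" and pos: "0 < (\<eta>::real)" "0 < (x::real)"
  obtains B where "B \<in> offdiag_rect_unions k \<mu>" "emeasure \<nu> (sym_diff B A) < ennreal \<eta>"
    "emeasure P {\<omega>\<in>space P. \<Phi> A \<omega> + ennreal x < \<Phi> B \<omega> \<or> \<Phi> B \<omega> + ennreal x < \<Phi> A \<omega>} < ennreal \<eta>"
proof -
  obtain B where B: "range B \<subseteq> offdiag_rect_unions k \<mu>" "(\<lambda>n. emeasure \<nu> (sym_diff (B n) A)) \<longlonglongrightarrow> 0"
    "\<forall>\<gamma>\<in>{0<..<\<alpha>}. Lgamma_tendsto P \<gamma> (\<lambda>n. \<Phi> (B n)) (\<Phi> A)"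
    using Phi A unfolding finite_product_sup_measure_def offdiag_density by blast
  let ?bad = "\<lambda>n. emeasure P {\<omega>\<in>space P. \<Phi> A \<omega> + ennreal x < \<Phi> (B n) \<omega> \<or> \<Phi> (B n) \<omega> + ennreal x < \<Phi> A \<omega>}"
  have "?bad \<longlonglongrightarrow> 0"
  proof (rule Lgamma_tendsto_imp_prob)
    show "Lgamma_tendsto P (\<alpha> / 2) (\<lambda>n. \<Phi> (B n)) (\<Phi> A)" using B(3) alpha_pos by auto
  qed (use A B(1) pos alpha_pos rect_unions_offdiag in \<open>auto intro!: Phi_measurable\<close>)
  then have "\<forall>\<^sub>F n in sequentially. ?bad n < ennreal \<eta>"
    using pos by (intro order_tendstoD) auto
  moreover have "\<forall>\<^sub>F n in sequentially. emeasure \<nu> (sym_diff (B n) A) < ennreal \<eta>"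
    using pos by (intro order_tendstoD[OF B(2)]) auto
  ultimately have "\<forall>\<^sub>F n in sequentially.
      ?bad n < ennreal \<eta> \<and>
      emeasure \<nu> (sym_diff (B n) A) < ennreal \<eta>"
    by (rule eventually_conj)
  from eventually_happens'[OF sequentially_bot this] obtain n where
    n: "?bad n < ennreal \<eta> \<and>
     emeasure \<nu> (sym_diff (B n) A) < ennreal \<eta>" ..
  have "B n \<in> offdiag_rect_unions k \<mu>" using B(1) by auto
  then show thesis by (rule that[OF _ conjunct2[OF n] conjunct1[OF n]])
qed

text \<open>For unions of rectangles, \<open>\<Phi> B\<close> is at most the supremum of the \<open>\<Phi> (B i)\<close> and the value of the
uncovered part, which \<open>Phi_rect_union_small\<close> controls. All sets involved are then replaced by
approximating unions of rectangles, each at the cost of a small probability, a third of \<open>x\<close>, and a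
small change of control measure. Crucially \<open>C\<close> depends neither on the sets nor on their number.\<close>

lemma Phi_excess:
  assumes \<delta>: "0 < \<delta>" and x: "0 < (x::real)"
  shows "\<exists>C\<ge>0. \<forall>A As (n::nat). A \<in> offdiag_sets k \<mu> \<longrightarrow> (\<forall>i<n. As i \<in> offdiag_sets k \<mu>) \<longrightarrow>
      emeasure P {\<omega>\<in>space P. (SUP i\<in>{..<n}. \<Phi> (As i) \<omega>) + ennreal x < \<Phi> A \<omega>}
      \<le> ennreal \<delta> + ennreal C * emeasure \<nu> (A - (\<Union>i<n. As i))"
proof -
  define y where "y = x / 3"
  have y: "0 < y" "ennreal x = ennreal y + (ennreal y + ennreal y)"
    using x by (auto simp: y_def simp flip: ennreal_plus)
  obtain C where C: "0 \<le> C" "\<forall>B\<in>offdiag_rect_unions k \<mu>.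
      emeasure P {\<omega>\<in>space P. ennreal y < \<Phi> B \<omega>} \<le> ennreal \<delta> + ennreal C * emeasure \<nu> B"
    using Phi_rect_union_small[OF \<delta> y(1)] by (elim exE conjE)
  interpret G: ring_of_sets "space (power_measure k \<mu>)" "offdiag_rect_unions k \<mu>"
    by (rule ring_offdiag_rect_unions[OF k_pos])
  have "emeasure P {\<omega>\<in>space P. (SUP i\<in>{..<n}. \<Phi> (As i) \<omega>) + ennreal x < \<Phi> A \<omega>}
      \<le> ennreal \<delta> + ennreal C * emeasure \<nu> (A - (\<Union>i<n. As i))"
    if A: "A \<in> offdiag_sets k \<mu>" and As: "\<And>i. i < n \<Longrightarrow> As i \<in> offdiag_sets k \<mu>"
    for A As and n :: nat
  proof (rule ennreal_le_if_le_plus_multiples)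
    show "0 \<le> (1 + C) * (real n + 1)" using C by simp
    fix \<eta> :: real assume \<eta>: "0 < \<eta>"
    let ?bad = "\<lambda>A B. {\<omega>\<in>space P. \<Phi> A \<omega> + ennreal y < \<Phi> B \<omega> \<or> \<Phi> B \<omega> + ennreal y < \<Phi> A \<omega>}"
    obtain B where B: "B \<in> offdiag_rect_unions k \<mu>" "emeasure \<nu> (sym_diff B A) < ennreal \<eta>"
      "emeasure P (?bad A B) < ennreal \<eta>"
      using Phi_approximation[OF A \<eta> y(1)] .
    have "\<exists>B. B \<in> offdiag_rect_unions k \<mu> \<and> emeasure \<nu> (sym_diff B (As i)) < ennreal \<eta> \<and>
      emeasure P (?bad (As i) B) < ennreal \<eta>" if "i < n" for i
      by (rule Phi_approximation[OF As[OF that] \<eta> y(1)], intro exI conjI) assumption+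
    then have "\<forall>i\<in>{..<n}. \<exists>B. B \<in> offdiag_rect_unions k \<mu> \<and> emeasure \<nu> (sym_diff B (As i)) < ennreal \<eta> \<and>
      emeasure P (?bad (As i) B) < ennreal \<eta>" by blast
    from bchoice[OF this] obtain Bs where Bs': "\<forall>i\<in>{..<n}. Bs i \<in> offdiag_rect_unions k \<mu> \<and>
      emeasure \<nu> (sym_diff (Bs i) (As i)) < ennreal \<eta> \<and> emeasure P (?bad (As i) (Bs i)) < ennreal \<eta>" ..
    have Bs: "Bs i \<in> offdiag_rect_unions k \<mu>" "emeasure \<nu> (sym_diff (Bs i) (As i)) < ennreal \<eta>"
      "emeasure P (?bad (As i) (Bs i)) < ennreal \<eta>" if "i < n" for i
      using bspec[OF Bs', of i] that by (simp_all only: lessThan_iff)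
    define U where "U = (\<Union>i<n. Bs i)"
    have U: "U \<in> offdiag_rect_unions k \<mu>" unfolding U_def using Bs(1) by auto
    have BU: "B - U \<in> offdiag_rect_unions k \<mu>" using B(1) U by auto
    note [measurable] = Phi_measurable[OF A] Phi_measurable[OF rect_unions_offdiag[OF B(1)]]
      Phi_measurable[OF rect_unions_offdiag[OF BU]]
    have m1: "?bad A B \<in> events" by measurable
    have m2: "?bad (As i) (Bs i) \<in> events" if i: "i < n" for i
    proof -
      note [measurable] = Phi_measurable[OF As[OF i]] Phi_measurable[OF rect_unions_offdiag[OF Bs(1)[OF i]]]
      show ?thesis by measurable
    qed
    have m3: "{\<omega>\<in>space P. ennreal y < \<Phi> (B - U) \<omega>} \<in> events" by measurable
    have "AE \<omega> in P. \<Phi> B \<omega> \<le> \<Phi> (\<Union>c\<in>{U, B - U}. c) \<omega>"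
      using B(1) U BU by (intro Phi_rect_union_mono) auto
    moreover have "AE \<omega> in P. \<Phi> (\<Union>c\<in>{U, B - U}. c) \<omega> = (SUP c\<in>{U, B - U}. \<Phi> c \<omega>)"
      using U BU by (intro Phi_Union) auto
    moreover have "AE \<omega> in P. \<Phi> U \<omega> = (SUP i\<in>{..<n}. \<Phi> (Bs i) \<omega>)"
      unfolding U_def using Bs(1) by (intro Phi_Union) auto
    ultimately have "AE \<omega> in P. \<omega> \<in> {\<omega>\<in>space P. (SUP i\<in>{..<n}. \<Phi> (As i) \<omega>) + ennreal x < \<Phi> A \<omega>} \<longrightarrow>
       \<omega> \<in> ?bad A B \<union> ((\<Union>i<n. ?bad (As i) (Bs i)) \<union> {\<omega>\<in>space P. ennreal y < \<Phi> (B - U) \<omega>})"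
    proof eventually_elim
      case (elim \<omega>)
      let ?S = "SUP i\<in>{..<n}. \<Phi> (As i) \<omega>"
      show ?case
      proof (rule impI, rule ccontr)
        assume \<omega>: "\<omega> \<in> {\<omega>\<in>space P. (SUP i\<in>{..<n}. \<Phi> (As i) \<omega>) + ennreal x < \<Phi> A \<omega>}"
          and n: "\<omega> \<notin> ?bad A B \<union> ((\<Union>i<n. ?bad (As i) (Bs i)) \<union> {\<omega>\<in>space P. ennreal y < \<Phi> (B - U) \<omega>})"
        have 1: "\<Phi> A \<omega> \<le> \<Phi> B \<omega> + ennreal y" using \<omega> n by (auto simp: not_less)
        have "\<Phi> (Bs i) \<omega> \<le> ?S + ennreal y" if "i < n" for i
        proof -
          have "\<Phi> (Bs i) \<omega> \<le> \<Phi> (As i) \<omega> + ennreal y" using \<omega> n that by (auto simp: not_less)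
          also have "\<dots> \<le> ?S + ennreal y" using that by (intro add_right_mono SUP_upper) auto
          finally show ?thesis .
        qed
        then have 2: "\<Phi> U \<omega> \<le> ?S + ennreal y" using elim by (auto intro!: SUP_least)
        have "\<Phi> (B - U) \<omega> \<le> ennreal y" using \<omega> n by (auto simp: not_less)
        also have "\<dots> \<le> ?S + ennreal y" by simp
        finally have "\<Phi> B \<omega> \<le> ?S + ennreal y" using 2 elim
          by (auto intro: order_trans[OF _ sup_least])
        then have "\<Phi> A \<omega> \<le> ?S + ennreal y + ennreal y" using 1 by (meson add_right_mono order_trans)
        also have "\<dots> \<le> ?S + ennreal x" unfolding y(2) by (simp add: add.assoc add_left_mono)
        finally show False using \<omega> by auto
      qed
    qed
    then have "emeasure P {\<omega>\<in>space P. (SUP i\<in>{..<n}. \<Phi> (As i) \<omega>) + ennreal x < \<Phi> A \<omega>}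
      \<le> emeasure P (?bad A B \<union> ((\<Union>i<n. ?bad (As i) (Bs i)) \<union> {\<omega>\<in>space P. ennreal y < \<Phi> (B - U) \<omega>}))"
      using m1 m2 m3 by (intro emeasure_mono_AE sets.Un sets.finite_UN) auto
    also have "\<dots> \<le> emeasure P (?bad A B) + emeasure P ((\<Union>i<n. ?bad (As i) (Bs i)) \<union> {\<omega>\<in>space P. ennreal y < \<Phi> (B - U) \<omega>})"
      using m1 m2 m3 by (intro emeasure_subadditive sets.Un sets.finite_UN) auto
    also have "\<dots> \<le> emeasure P (?bad A B) + (emeasure P (\<Union>i<n. ?bad (As i) (Bs i)) + emeasure P {\<omega>\<in>space P. ennreal y < \<Phi> (B - U) \<omega>})"
      using m1 m2 m3 by (intro add_left_mono emeasure_subadditive sets.finite_UN) auto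
    also have "\<dots> \<le> ennreal \<eta> + (ennreal (real n) * ennreal \<eta> + (ennreal \<delta> + ennreal C * emeasure \<nu> (B - U)))"
    proof (intro add_mono)
      show "emeasure P (?bad A B) \<le> ennreal \<eta>" using B(3) by simp
      have "emeasure P (\<Union>i<n. ?bad (As i) (Bs i)) \<le> (\<Sum>i<n. emeasure P (?bad (As i) (Bs i)))"
        using m2 by (intro emeasure_subadditive_finite) auto
      also have "\<dots> \<le> (\<Sum>i<n. ennreal \<eta>)" using Bs(3) by (intro sum_mono less_imp_le) auto
      finally show "emeasure P (\<Union>i<n. ?bad (As i) (Bs i)) \<le> ennreal (real n) * ennreal \<eta>"
        by (simp add: ennreal_of_nat_eq_real_of_nat)
      show "emeasure P {\<omega>\<in>space P. ennreal y < \<Phi> (B - U) \<omega>} \<le> ennreal \<delta> + ennreal C * emeasure \<nu> (B - U)"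
        by (rule C(2)[rule_format, OF BU])
    qed
    also have "emeasure \<nu> (B - U) \<le> emeasure \<nu> (A - (\<Union>i<n. As i)) + (ennreal (real n + 1) * ennreal \<eta>)"
    proof -
      let ?D = "A - (\<Union>i<n. As i)"
      have s: "A \<in> sets \<nu>" "B \<in> sets \<nu>" "\<And>i. i < n \<Longrightarrow> As i \<in> sets \<nu>" "\<And>i. i < n \<Longrightarrow> Bs i \<in> sets \<nu>"
        using offdiag_sets_nu[OF A] offdiag_sets_nu[OF As] offdiag_sets_nu[OF rect_unions_offdiag[OF B(1)]]
          offdiag_sets_nu[OF rect_unions_offdiag[OF Bs(1)]] by blast+
      have m: "?D \<in> sets \<nu>" "sym_diff B A \<in> sets \<nu>" "(\<Union>i<n. sym_diff (Bs i) (As i)) \<in> sets \<nu>"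
        using s by (auto intro!: sets.Diff sets.Un sets.finite_UN)
      have "B - U \<subseteq> ?D \<union> (sym_diff B A \<union> (\<Union>i<n. sym_diff (Bs i) (As i)))"
        unfolding U_def by auto
      then have "emeasure \<nu> (B - U) \<le> emeasure \<nu> (?D \<union> (sym_diff B A \<union> (\<Union>i<n. sym_diff (Bs i) (As i))))"
        using m by (intro emeasure_mono) (auto intro!: sets.Un)
      also have "\<dots> \<le> emeasure \<nu> ?D + emeasure \<nu> (sym_diff B A \<union> (\<Union>i<n. sym_diff (Bs i) (As i)))"
        using m by (intro emeasure_subadditive) (auto intro!: sets.Un)
      also have "\<dots> \<le> emeasure \<nu> ?D + (emeasure \<nu> (sym_diff B A) + emeasure \<nu> (\<Union>i<n. sym_diff (Bs i) (As i)))"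
        using m by (intro add_left_mono emeasure_subadditive)
      also have "\<dots> \<le> emeasure \<nu> ?D + (ennreal \<eta> + ennreal (real n) * ennreal \<eta>)"
      proof (intro add_mono order_refl)
        show "emeasure \<nu> (sym_diff B A) \<le> ennreal \<eta>" using B(2) by simp
        have "emeasure \<nu> (\<Union>i<n. sym_diff (Bs i) (As i)) \<le> (\<Sum>i<n. emeasure \<nu> (sym_diff (Bs i) (As i)))"
          using s by (intro emeasure_subadditive_finite) auto
        also have "\<dots> \<le> (\<Sum>i<n. ennreal \<eta>)" using Bs(2) by (intro sum_mono less_imp_le) auto
        finally show "emeasure \<nu> (\<Union>i<n. sym_diff (Bs i) (As i)) \<le> ennreal (real n) * ennreal \<eta>"
          by (simp add: ennreal_of_nat_eq_real_of_nat)
      qed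
      also have "ennreal \<eta> + ennreal (real n) * ennreal \<eta> = ennreal (real n + 1) * ennreal \<eta>"
        using \<eta> by (simp add: ennreal_mult[symmetric] ennreal_plus[symmetric] algebra_simps del: ennreal_plus)
      finally show ?thesis .
    qed
    also have "ennreal \<eta> + (ennreal (real n) * ennreal \<eta> + (ennreal \<delta> + ennreal C *
        (emeasure \<nu> (A - (\<Union>i<n. As i)) + ennreal (real n + 1) * ennreal \<eta>)))
      = (ennreal \<delta> + ennreal C * emeasure \<nu> (A - (\<Union>i<n. As i))) +
        (ennreal \<eta> + ennreal (real n) * ennreal \<eta> + ennreal C * (ennreal (real n + 1) * ennreal \<eta>))"
      by (simp add: distrib_left ac_simps)
    also have "ennreal \<eta> + ennreal (real n) * ennreal \<eta> + ennreal C * (ennreal (real n + 1) * ennreal \<eta>)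
       = ennreal ((1 + C) * (real n + 1)) * ennreal \<eta>"
      using \<eta> C(1) by (simp add: ennreal_mult[symmetric] ennreal_plus[symmetric] algebra_simps del: ennreal_plus)
    finally show "emeasure P {\<omega>\<in>space P. (SUP i\<in>{..<n}. \<Phi> (As i) \<omega>) + ennreal x < \<Phi> A \<omega>}
      \<le> ennreal \<delta> + ennreal C * emeasure \<nu> (A - (\<Union>i<n. As i)) + ennreal ((1 + C) * (real n + 1)) * ennreal \<eta>"
      by (simp add: add_left_mono mult_left_mono)
  qed
  then show ?thesis using C(1) by (intro exI[of _ C]) simp
qed

lemma Phi_excess_single:
  assumes "0 < \<delta>" "0 < (x::real)"
  shows "\<exists>C\<ge>0. \<forall>A\<in>offdiag_sets k \<mu>. \<forall>B\<in>offdiag_sets k \<mu>.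
      emeasure P {\<omega>\<in>space P. \<Phi> B \<omega> + ennreal x < \<Phi> A \<omega>} \<le> ennreal \<delta> + ennreal C * emeasure \<nu> (A - B)"
proof -
  obtain C where C: "0 \<le> C" "\<forall>A As (n::nat). A \<in> offdiag_sets k \<mu> \<longrightarrow> (\<forall>i<n. As i \<in> offdiag_sets k \<mu>) \<longrightarrow>
      emeasure P {\<omega>\<in>space P. (SUP i\<in>{..<n}. \<Phi> (As i) \<omega>) + ennreal x < \<Phi> A \<omega>}
      \<le> ennreal \<delta> + ennreal C * emeasure \<nu> (A - (\<Union>i<n. As i))"
    using Phi_excess[OF assms] by (elim exE conjE)
  have 1: "{..<1::nat} = {0}" by auto
  show ?thesis
  proof (intro exI[of _ C] conjI ballI C(1))
    fix A B assume AB: "A \<in> offdiag_sets k \<mu>" "B \<in> offdiag_sets k \<mu>"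
    show "emeasure P {\<omega>\<in>space P. \<Phi> B \<omega> + ennreal x < \<Phi> A \<omega>} \<le> ennreal \<delta> + ennreal C * emeasure \<nu> (A - B)"
      using C(2)[rule_format, of A 1 "\<lambda>_. B"] AB unfolding 1 by simp
  qed
qed

text \<open>The part of \<open>A\<close> left uncovered by the first \<open>n\<close> sets has vanishing measure because \<open>\<nu>\<close> is finite.\<close>

lemma Phi_countable_cover:
  fixes As :: "nat \<Rightarrow> (nat \<Rightarrow> 'e) set"
  assumes A: "A \<in> offdiag_sets k \<mu>" and As: "\<And>i. As i \<in> offdiag_sets k \<mu>"
    and null: "emeasure \<nu> (A - (\<Union>i. As i)) = 0"
  shows "AE \<omega> in P. \<Phi> A \<omega> \<le> (SUP i. \<Phi> (As i) \<omega>)"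
proof (rule AE_le_if_excess_null)
  show m1: "\<Phi> A \<in> borel_measurable P" using A by (rule Phi_measurable)
  have m2: "\<Phi> (As i) \<in> borel_measurable P" for i using As by (rule Phi_measurable)
  show m3: "(\<lambda>\<omega>. SUP i. \<Phi> (As i) \<omega>) \<in> borel_measurable P" using m2 by (intro borel_measurable_SUP) auto
  note [measurable] = m1 m2 m3
  have s: "A \<in> sets \<nu>" "\<And>i. As i \<in> sets \<nu>" using A As by (auto intro: offdiag_sets_nu)
  have "(\<lambda>n. emeasure \<nu> (A - (\<Union>i<n. As i))) \<longlonglongrightarrow> emeasure \<nu> (\<Inter>n. A - (\<Union>i<n. As i))"
  proof (rule Lim_emeasure_decseq)
    show "range (\<lambda>n. A - (\<Union>i<n. As i)) \<subseteq> sets \<nu>" using s by auto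
    show "decseq (\<lambda>n. A - (\<Union>i<n. As i))" by (fastforce simp: decseq_def)
    show "emeasure \<nu> (A - (\<Union>i<n. As i)) \<noteq> \<infinity>" for n using finite_nu[of "A - (\<Union>i<n. As i)"] by auto
  qed
  also have "(\<Inter>n. A - (\<Union>i<n. As i)) = A - (\<Union>i. As i)" by auto
  finally have lim: "(\<lambda>n. emeasure \<nu> (A - (\<Union>i<n. As i))) \<longlonglongrightarrow> 0" using null by simp
  fix x :: real assume x: "0 < x"
  let ?p = "emeasure P {\<omega>\<in>space P. (SUP i. \<Phi> (As i) \<omega>) + ennreal x < \<Phi> A \<omega>}"
  have le: "?p \<le> 0 + ennreal \<delta>" if \<delta>: "0 < \<delta>" for \<delta> :: real
  proof -
    obtain C where C: "0 \<le> C" "\<forall>A As (n::nat). A \<in> offdiag_sets k \<mu> \<longrightarrow> (\<forall>i<n. As i \<in> offdiag_sets k \<mu>) \<longrightarrow>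
      emeasure P {\<omega>\<in>space P. (SUP i\<in>{..<n}. \<Phi> (As i) \<omega>) + ennreal x < \<Phi> A \<omega>}
      \<le> ennreal \<delta> + ennreal C * emeasure \<nu> (A - (\<Union>i<n. As i))"
      using Phi_excess[OF \<delta> x] by (elim exE conjE)
    have "?p \<le> ennreal \<delta> + ennreal C * emeasure \<nu> (A - (\<Union>i<n. As i))" for n
    proof -
      have "(SUP i\<in>{..<n}. \<Phi> (As i) \<omega>) \<le> (SUP i. \<Phi> (As i) \<omega>)" for \<omega> by (intro SUP_subset_mono) auto
      then have "?p \<le> emeasure P {\<omega>\<in>space P. (SUP i\<in>{..<n}. \<Phi> (As i) \<omega>) + ennreal x < \<Phi> A \<omega>}"
        by (intro emeasure_mono) (auto intro: le_less_trans[OF add_right_mono])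
      also have "\<dots> \<le> ennreal \<delta> + ennreal C * emeasure \<nu> (A - (\<Union>i<n. As i))" by (rule C(2)[rule_format]) (rule A As)+
      finally show ?thesis .
    qed
    moreover have "(\<lambda>n. ennreal \<delta> + ennreal C * emeasure \<nu> (A - (\<Union>i<n. As i))) \<longlonglongrightarrow> ennreal \<delta> + ennreal C * 0"
      by (intro tendsto_add tendsto_const ennreal_tendsto_cmult lim) simp
    ultimately have "?p \<le> ennreal \<delta> + ennreal C * 0" by (intro LIMSEQ_le_const) auto
    then show ?thesis by simp
  qed
  have "?p \<le> 0" by (rule ennreal_le_epsilon) (rule le)
  then show "?p = 0" by simp
qed

text \<open>Approximate by unions of rectangles and intersect these with the ambient rectangle. Passing from \<open>t\<close>
to \<open>t / 2\<close> leaves room for the approximation error.\<close>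

lemma Phi_tail:
  assumes A: "A \<in> offdiag_sets k \<mu>" "A \<subseteq> Pi\<^sub>E {..<k} D" and D: "\<And>i. i < k \<Longrightarrow> D i \<in> sets \<mu>"
    and s: "\<And>i. i < k \<Longrightarrow> 0 < s i" and K: "0 < K" and t: "0 < t"
  shows "emeasure P {\<omega>\<in>space P. ennreal t < \<Phi> A \<omega> \<and> (\<forall>i<k. ennreal (s i) * M (D i \<inter> F) \<omega> \<le> ennreal K)}
    \<le> cell_bound s K (t / 2) * emeasure \<nu> A"
    (is "?p \<le> _")
proof (rule ennreal_le_epsilon)
  fix \<delta> :: real assume \<delta>: "0 < \<delta>"
  define cb where "cb = enn2real (cell_bound s K (t / 2))"
  have cb: "cell_bound s K (t / 2) = ennreal cb" "0 \<le> cb"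
    using cell_bound_finite[of s K "t / 2"] by (auto simp: cb_def less_top)
  have t2: "0 < t / 2" "ennreal t = ennreal (t / 2) + ennreal (t / 2)"
    using t by (auto simp: ennreal_plus[symmetric] simp del: ennreal_plus)
  obtain C where C: "0 \<le> C" "\<forall>A\<in>offdiag_sets k \<mu>. \<forall>B\<in>offdiag_sets k \<mu>.
      emeasure P {\<omega>\<in>space P. \<Phi> B \<omega> + ennreal (t / 2) < \<Phi> A \<omega>} \<le> ennreal \<delta> + ennreal C * emeasure \<nu> (A - B)"
    using Phi_excess_single[OF \<delta> t2(1)] by (elim exE conjE)
  show "?p \<le> cell_bound s K (t / 2) * emeasure \<nu> A + ennreal \<delta>"
  proof (rule ennreal_le_if_le_plus_multiples)
    show "0 \<le> C + cb" using C cb by simp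
    fix \<eta> :: real assume \<eta>: "0 < \<eta>"
    obtain B where B: "B \<in> offdiag_rect_unions k \<mu>" "emeasure \<nu> (sym_diff B A) < ennreal \<eta>"
      by (rule Phi_approximation[OF A(1) \<eta> t2(1)]) blast
    let ?B = "B \<inter> Pi\<^sub>E {..<k} D"
    have B': "?B \<in> offdiag_rect_unions k \<mu>" by (rule rect_union_Int_PiE[OF B(1) D])
    note [measurable] = Phi_measurable[OF A(1)] Phi_measurable[OF rect_unions_offdiag[OF B']]
    have sB: "B \<in> sets \<nu>" "A \<in> sets \<nu>" using offdiag_sets_nu[OF A(1)] offdiag_sets_nu[OF rect_unions_offdiag[OF B(1)]] by blast+
    have DF[measurable]: "M (D i \<inter> F) \<in> borel_measurable P" if "i < k" for i
      using D[OF that] F(1) by (intro M_measurable sets.Int)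
    let ?G = "\<lambda>\<omega>. \<forall>i<k. ennreal (s i) * M (D i \<inter> F) \<omega> \<le> ennreal K"
    have "?p \<le> emeasure P ({\<omega>\<in>space P. \<Phi> ?B \<omega> + ennreal (t / 2) < \<Phi> A \<omega>} \<union> {\<omega>\<in>space P. ennreal (t / 2) < \<Phi> ?B \<omega> \<and> ?G \<omega>})"
    proof (rule emeasure_mono)
      show "{\<omega>\<in>space P. ennreal t < \<Phi> A \<omega> \<and> ?G \<omega>} \<subseteq>
        {\<omega>\<in>space P. \<Phi> ?B \<omega> + ennreal (t / 2) < \<Phi> A \<omega>} \<union> {\<omega>\<in>space P. ennreal (t / 2) < \<Phi> ?B \<omega> \<and> ?G \<omega>}"
      proof
        fix \<omega> assume \<omega>: "\<omega> \<in> {\<omega>\<in>space P. ennreal t < \<Phi> A \<omega> \<and> ?G \<omega>}"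
        have "\<Phi> ?B \<omega> + ennreal (t / 2) \<le> ennreal t" if "\<Phi> ?B \<omega> \<le> ennreal (t / 2)"
          unfolding t2(2) using that by (rule add_right_mono)
        then show "\<omega> \<in> {\<omega>\<in>space P. \<Phi> ?B \<omega> + ennreal (t / 2) < \<Phi> A \<omega>} \<union> {\<omega>\<in>space P. ennreal (t / 2) < \<Phi> ?B \<omega> \<and> ?G \<omega>}"
          using \<omega> by (cases "\<Phi> ?B \<omega> \<le> ennreal (t / 2)") (auto simp: not_le intro: le_less_trans)
      qed
      show "{\<omega>\<in>space P. \<Phi> ?B \<omega> + ennreal (t / 2) < \<Phi> A \<omega>} \<union> {\<omega>\<in>space P. ennreal (t / 2) < \<Phi> ?B \<omega> \<and> ?G \<omega>} \<in> events"
        by measurable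
    qed
    also have "\<dots> \<le> emeasure P {\<omega>\<in>space P. \<Phi> ?B \<omega> + ennreal (t / 2) < \<Phi> A \<omega>} + emeasure P {\<omega>\<in>space P. ennreal (t / 2) < \<Phi> ?B \<omega> \<and> ?G \<omega>}"
      by (rule emeasure_subadditive) measurable
    also have "\<dots> \<le> (ennreal \<delta> + ennreal C * emeasure \<nu> (A - ?B)) + cell_bound s K (t / 2) * emeasure \<nu> ?B"
      using B' D s K t2 A(1) by (intro add_mono C(2)[rule_format] Phi_rect_union_tail) (auto intro: rect_unions_offdiag)
    also have "\<dots> \<le> (ennreal \<delta> + ennreal C * ennreal \<eta>) + ennreal cb * (emeasure \<nu> A + ennreal \<eta>)"
    proof -
      have "emeasure \<nu> (A - ?B) \<le> emeasure \<nu> (sym_diff B A)"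
        using A(2) sB by (intro emeasure_mono) auto
      then have 1: "emeasure \<nu> (A - ?B) \<le> ennreal \<eta>" using B(2) by simp
      have "emeasure \<nu> ?B \<le> emeasure \<nu> (A \<union> sym_diff B A)" using sB by (intro emeasure_mono) auto
      also have "\<dots> \<le> emeasure \<nu> A + emeasure \<nu> (sym_diff B A)" using sB by (intro emeasure_subadditive) auto
      finally have 2: "emeasure \<nu> ?B \<le> emeasure \<nu> A + ennreal \<eta>" using B(2) by (meson add_left_mono less_imp_le order_trans)
      show ?thesis unfolding cb(1) using 1 2 by (intro add_mono mult_left_mono order_refl) auto
    qed
    also have "\<dots> = cell_bound s K (t / 2) * emeasure \<nu> A + ennreal \<delta> + ennreal (C + cb) * ennreal \<eta>"
      using C(1) cb(2) by (simp add: cb(1) distrib_left distrib_right ac_simps)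
    finally show "?p \<le> cell_bound s K (t / 2) * emeasure \<nu> A + ennreal \<delta> + ennreal (C + cb) * ennreal \<eta>" .
  qed
qed

end

section \<open>The product sup measure over a sigma-finite control measure\<close>

text \<open>The family \<open>\<Phi> n\<close> of product sup measures on \<open>En n\<close> is the one from which \<open>Mk\<close> arises.\<close>

locale frechet_product = frechet_noise P \<mu> \<alpha> k M
  for P :: "'w measure" and \<mu> :: "'e measure" and \<alpha> k M +
  fixes En :: "nat \<Rightarrow> 'e set" and \<Phi> :: "nat \<Rightarrow> (nat \<Rightarrow> 'e) set \<Rightarrow> 'w \<Rightarrow> ennreal"
    and Mk :: "(nat \<Rightarrow> 'e) set \<Rightarrow> 'w \<Rightarrow> ennreal"
  assumes En: "\<And>n. En n \<in> sets \<mu>" "incseq En" "\<And>n. emeasure \<mu> (En n) < \<infinity>"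
    and Phi: "\<And>n. finite_product_sup_measure P (density \<mu> (indicator (En n))) \<alpha> k (\<lambda>A. M (A \<inter> En n)) (\<Phi> n)"
    and Mk_measurable: "\<And>A. A \<in> offdiag_sets k \<mu> \<Longrightarrow> Mk A \<in> borel_measurable P"
    and Mk_eq: "\<And>A. A \<in> offdiag_sets k \<mu> \<Longrightarrow> AE \<omega> in P. Mk A \<omega> = (SUP n. \<Phi> n A \<omega>)"
begin

sublocale fin: finite_frechet_product P \<mu> \<alpha> k M "En n" "\<Phi> n" for n
  by unfold_locales (rule En(1) En(3) Phi)+

lemma Phi_rect_union_mono_index:
  assumes "n \<le> n'" and B: "B \<in> offdiag_rect_unions k \<mu>"
  shows "AE \<omega> in P. \<Phi> n B \<omega> \<le> \<Phi> n' B \<omega>"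
proof -
  obtain C where C: "finite C" "disjoint C" "C \<subseteq> offdiag_rects k \<mu>" "B = \<Union>C"
    using offdiag_rect_unions_disjoint[OF k_pos B] .
  have sub: "En n \<subseteq> En n'" using En(2) assms(1) by (auto simp: incseq_def)
  have "AE \<omega> in P. \<forall>c\<in>C. \<Phi> n c \<omega> \<le> \<Phi> n' c \<omega>"
  proof (intro AE_finite_allI C(1))
    fix c assume "c \<in> C"
    then obtain R where R: "R \<in> offdiag_sides k \<mu>" "c = Pi\<^sub>E {..<k} R" using C(3) by (auto simp: offdiag_rects_def)
    have "AE \<omega> in P. \<forall>i\<in>{..<k}. M (R i \<inter> En n) \<omega> \<le> M (R i \<inter> En n') \<omega>"
      using sub offdiag_sides_sets[OF R(1)] En(1)
      by (intro AE_finite_allI M_mono sets.Int) auto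
    with fin.Phi_rect[OF R(1), of n] fin.Phi_rect[OF R(1), of n'] show "AE \<omega> in P. \<Phi> n c \<omega> \<le> \<Phi> n' c \<omega>"
      unfolding R(2) by eventually_elim (auto intro!: prod_mono_ennreal)
  qed
  with fin.Phi_Union_rects[OF C(1,3), of n] fin.Phi_Union_rects[OF C(1,3), of n'] show ?thesis
    unfolding C(4) by eventually_elim (auto intro!: SUP_mono)
qed

lemma nu_mono_index:
  assumes "n \<le> n'" and A: "A \<in> sets (power_measure k \<mu>)"
  shows "emeasure (fin.\<nu> n) A \<le> emeasure (fin.\<nu> n') A"
proof -
  have sub: "En n \<subseteq> En n'" using En(2) assms(1) by (auto simp: incseq_def)
  show ?thesis unfolding fin.emeasure_nu[OF A]
  proof (intro nn_integral_mono mult_right_mono)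
    fix x :: "nat \<Rightarrow> 'e"
    show "tensor_power k (indicator (En n)) x \<le> (tensor_power k (indicator (En n')) x :: ennreal)"
      unfolding tensor_power_def using sub by (intro prod_mono_ennreal) (auto simp: indicator_def)
  qed simp
qed

text \<open>On rectangles this is monotonicity of \<open>M\<close>. In general the approximating unions are chosen for the
larger set \<open>En n'\<close>; they then approximate for \<open>En n\<close> as well, since the control measures increase.\<close>

lemma Phi_mono_index:
  assumes "n \<le> n'" and A: "A \<in> offdiag_sets k \<mu>"
  shows "AE \<omega> in P. \<Phi> n A \<omega> \<le> \<Phi> n' A \<omega>"
proof (rule AE_le_if_excess_null)
  note Am[measurable] = fin.Phi_measurable[OF A]
  show "\<Phi> n A \<in> borel_measurable P" "\<Phi> n' A \<in> borel_measurable P" by measurable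
  fix x :: real assume x: "0 < x"
  define y where "y = x / 2"
  have y: "0 < y" "ennreal x = ennreal y + ennreal y"
    using x by (auto simp: y_def simp flip: ennreal_plus)
  let ?p = "emeasure P {\<omega>\<in>space P. \<Phi> n' A \<omega> + ennreal x < \<Phi> n A \<omega>}"
  have le: "?p \<le> 0 + ennreal \<delta>" if \<delta>: "0 < \<delta>" for \<delta> :: real
  proof -
    obtain C where C: "0 \<le> C" "\<forall>A\<in>offdiag_sets k \<mu>. \<forall>B\<in>offdiag_sets k \<mu>.
      emeasure P {\<omega>\<in>space P. \<Phi> n B \<omega> + ennreal y < \<Phi> n A \<omega>} \<le> ennreal \<delta> + ennreal C * emeasure (fin.\<nu> n) (A - B)"
      using fin.Phi_excess_single[OF \<delta> y(1), of n] by (elim exE conjE)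
    have "?p \<le> ennreal \<delta>"
    proof (rule ennreal_le_if_le_plus_multiples)
      show "0 \<le> C + 1" using C by simp
      fix \<eta> :: real assume \<eta>: "0 < \<eta>"
      let ?bad = "\<lambda>B. {\<omega>\<in>space P. \<Phi> n' A \<omega> + ennreal y < \<Phi> n' B \<omega> \<or> \<Phi> n' B \<omega> + ennreal y < \<Phi> n' A \<omega>}"
      obtain B where B: "B \<in> offdiag_rect_unions k \<mu>" "emeasure (fin.\<nu> n') (sym_diff B A) < ennreal \<eta>"
        "emeasure P (?bad B) < ennreal \<eta>"
        using fin.Phi_approximation[OF A \<eta> y(1), of n'] .
      have BO: "B \<in> offdiag_sets k \<mu>" using B(1) by (rule fin.rect_unions_offdiag)
      note Bm[measurable] = fin.Phi_measurable[OF BO]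
      have s: "A \<in> sets (power_measure k \<mu>)" "B \<in> sets (power_measure k \<mu>)"
        using A BO by (auto simp: offdiag_sets_iff)
      have m: "{\<omega>\<in>space P. \<Phi> n B \<omega> + ennreal y < \<Phi> n A \<omega>} \<in> events" "?bad B \<in> events" by measurable
      have "AE \<omega> in P. \<omega> \<in> {\<omega>\<in>space P. \<Phi> n' A \<omega> + ennreal x < \<Phi> n A \<omega>} \<longrightarrow>
         \<omega> \<in> {\<omega>\<in>space P. \<Phi> n B \<omega> + ennreal y < \<Phi> n A \<omega>} \<union> ?bad B"
        using Phi_rect_union_mono_index[OF assms(1) B(1)]
      proof eventually_elim
        case (elim \<omega>)
        show ?case
        proof (rule impI, rule ccontr)
          assume \<omega>: "\<omega> \<in> {\<omega>\<in>space P. \<Phi> n' A \<omega> + ennreal x < \<Phi> n A \<omega>}"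
            and n: "\<omega> \<notin> {\<omega>\<in>space P. \<Phi> n B \<omega> + ennreal y < \<Phi> n A \<omega>} \<union> ?bad B"
          have "\<Phi> n A \<omega> \<le> \<Phi> n B \<omega> + ennreal y" using \<omega> n by (auto simp: not_less)
          also have "\<dots> \<le> \<Phi> n' B \<omega> + ennreal y" using elim by (rule add_right_mono)
          also have "\<Phi> n' B \<omega> \<le> \<Phi> n' A \<omega> + ennreal y" using \<omega> n by (auto simp: not_less)
          finally have "\<Phi> n A \<omega> \<le> \<Phi> n' A \<omega> + ennreal x"
            unfolding y(2) by (simp add: add.assoc add_right_mono)
          then show False using \<omega> by auto
        qed
      qed
      then have "?p \<le> emeasure P ({\<omega>\<in>space P. \<Phi> n B \<omega> + ennreal y < \<Phi> n A \<omega>} \<union> ?bad B)"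
        using m by (intro emeasure_mono_AE sets.Un)
      also have "\<dots> \<le> emeasure P {\<omega>\<in>space P. \<Phi> n B \<omega> + ennreal y < \<Phi> n A \<omega>} + emeasure P (?bad B)"
        using m by (rule emeasure_subadditive)
      also have "\<dots> \<le> (ennreal \<delta> + ennreal C * ennreal \<eta>) + ennreal \<eta>"
      proof (intro add_mono)
        have "emeasure (fin.\<nu> n) (A - B) \<le> emeasure (fin.\<nu> n') (A - B)"
          using s by (intro nu_mono_index assms(1) sets.Diff)
        also have "\<dots> \<le> emeasure (fin.\<nu> n') (sym_diff B A)"
          using s by (intro emeasure_mono) (auto simp: fin.sets_nu)
        finally have "emeasure (fin.\<nu> n) (A - B) \<le> ennreal \<eta>" using B(2) by simp
        then have "ennreal \<delta> + ennreal C * emeasure (fin.\<nu> n) (A - B) \<le> ennreal \<delta> + ennreal C * ennreal \<eta>"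
          by (intro add_left_mono mult_left_mono) auto
        with C(2)[rule_format, OF A BO]
        show "emeasure P {\<omega>\<in>space P. \<Phi> n B \<omega> + ennreal y < \<Phi> n A \<omega>} \<le> ennreal \<delta> + ennreal C * ennreal \<eta>"
          by (rule order_trans)
        show "emeasure P (?bad B) \<le> ennreal \<eta>" using B(3) by simp
      qed
      also have "\<dots> = ennreal \<delta> + ennreal (C + 1) * ennreal \<eta>"
        using C(1) by (simp add: distrib_right add.assoc)
      finally show "?p \<le> ennreal \<delta> + ennreal (C + 1) * ennreal \<eta>" .
    qed
    then show ?thesis by simp
  qed
  have "?p \<le> 0" by (rule ennreal_le_epsilon) (rule le)
  then show "?p = 0" by simp
qed

lemma Mk_countable_cover:
  fixes As :: "nat \<Rightarrow> (nat \<Rightarrow> 'e) set"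
  assumes A: "A \<in> offdiag_sets k \<mu>" and As: "\<And>i. As i \<in> offdiag_sets k \<mu>"
    and null: "emeasure (power_measure k \<mu>) (A - (\<Union>i. As i)) = 0"
  shows "AE \<omega> in P. Mk A \<omega> \<le> (SUP i. Mk (As i) \<omega>)"
proof -
  have "emeasure (fin.\<nu> n) (A - (\<Union>i. As i)) = 0" for n
    using fin.nu_le[of n "A - (\<Union>i. As i)"] null by simp
  then have "AE \<omega> in P. \<forall>n. \<Phi> n A \<omega> \<le> (SUP i. \<Phi> n (As i) \<omega>)"
    unfolding AE_all_countable using A As by (intro allI fin.Phi_countable_cover)
  moreover have "AE \<omega> in P. \<forall>i. Mk (As i) \<omega> = (SUP n. \<Phi> n (As i) \<omega>)"
    unfolding AE_all_countable using As by (intro allI Mk_eq)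
  ultimately show ?thesis using Mk_eq[OF A]
  proof eventually_elim
    case (elim \<omega>)
    have "\<Phi> n A \<omega> \<le> (SUP i. Mk (As i) \<omega>)" for n
    proof -
      have "\<Phi> n A \<omega> \<le> (SUP i. \<Phi> n (As i) \<omega>)" using elim(1) by simp
      also have "\<dots> \<le> (SUP i. Mk (As i) \<omega>)"
        using elim(2) by (intro SUP_mono') (auto intro: SUP_upper)
      finally show ?thesis .
    qed
    then show ?case unfolding elim(3) by (intro SUP_least)
  qed
qed

lemma Mk_empty: "AE \<omega> in P. Mk {} \<omega> = 0"
proof -
  have "AE \<omega> in P. \<forall>n. \<Phi> n {} \<omega> = 0"
    unfolding AE_all_countable
  proof
    fix n show "AE \<omega> in P. \<Phi> n {} \<omega> = 0"
      using fin.Phi_Union_rects[of "{}" n] by (simp add: bot_ennreal)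
  qed
  moreover have "AE \<omega> in P. Mk {} \<omega> = (SUP n. \<Phi> n {} \<omega>)"
    by (rule Mk_eq) (simp add: offdiag_sets_iff)
  ultimately show ?thesis by eventually_elim simp
qed

text \<open>By monotonicity in the index, \<open>Mk A > t\<close> is up to null sets an increasing union of events to which
\<open>Phi_tail\<close> applies with one constant.\<close>

lemma Mk_tail:
  assumes A: "A \<in> offdiag_sets k \<mu>" "A \<subseteq> Pi\<^sub>E {..<k} D" and D: "\<And>i. i < k \<Longrightarrow> D i \<in> sets \<mu>"
    and s: "\<And>i. i < k \<Longrightarrow> 0 < s i" and K: "0 < K" and t: "0 < t"
  shows "emeasure P {\<omega>\<in>space P. ennreal t < Mk A \<omega> \<and> (\<forall>i<k. ennreal (s i) * M (D i) \<omega> \<le> ennreal K)}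
    \<le> cell_bound s K (t / 2) * emeasure (power_measure k \<mu>) A"
proof -
  let ?G = "\<lambda>\<omega>. \<forall>i<k. ennreal (s i) * M (D i) \<omega> \<le> ennreal K"
  let ?Gn = "\<lambda>n \<omega>. \<forall>i<k. ennreal (s i) * M (D i \<inter> En n) \<omega> \<le> ennreal K"
  define U where "U N = {\<omega>\<in>space P. ennreal t < (SUP n\<in>{..N}. \<Phi> n A \<omega>) \<and> ?G \<omega>}" for N :: nat
  note Am[measurable] = fin.Phi_measurable[OF A(1)]
  have [measurable]: "M (D i) \<in> borel_measurable P" "M (D i \<inter> En n) \<in> borel_measurable P" if "i < k" for i n
    using D[OF that] En(1) by (auto intro!: M_measurable)
  have U_meas[measurable]: "U N \<in> events" for N unfolding U_def by measurable
  have inc: "incseq U"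
  proof (intro incseq_SucI subsetI)
    fix N \<omega> assume \<omega>: "\<omega> \<in> U N"
    have "(SUP n\<in>{..N}. \<Phi> n A \<omega>) \<le> (SUP n\<in>{..Suc N}. \<Phi> n A \<omega>)" by (intro SUP_subset_mono) auto
    then show "\<omega> \<in> U (Suc N)" using \<omega> by (auto simp: U_def intro: less_le_trans)
  qed
  have "AE \<omega> in P. \<omega> \<in> {\<omega>\<in>space P. ennreal t < Mk A \<omega> \<and> ?G \<omega>} \<longrightarrow> \<omega> \<in> (\<Union>N. U N)"
    using Mk_eq[OF A(1)]
  proof eventually_elim
    case (elim \<omega>)
    show ?case
    proof
      assume \<omega>: "\<omega> \<in> {\<omega>\<in>space P. ennreal t < Mk A \<omega> \<and> ?G \<omega>}"
      then obtain N where "ennreal t < \<Phi> N A \<omega>" using elim by (auto simp: less_SUP_iff)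
      also have "\<Phi> N A \<omega> \<le> (SUP n\<in>{..N}. \<Phi> n A \<omega>)" by (intro SUP_upper) auto
      finally show "\<omega> \<in> (\<Union>N. U N)" using \<omega> by (auto simp: U_def)
    qed
  qed
  then have "emeasure P {\<omega>\<in>space P. ennreal t < Mk A \<omega> \<and> ?G \<omega>} \<le> emeasure P (\<Union>N. U N)"
    by (rule emeasure_mono_AE) measurable
  also have "\<dots> = (SUP N. emeasure P (U N))"
    using inc U_meas by (intro SUP_emeasure_incseq[symmetric]) auto
  also have "\<dots> \<le> cell_bound s K (t / 2) * emeasure (power_measure k \<mu>) A"
  proof (rule SUP_least)
    fix N
    have "AE \<omega> in P. \<forall>n\<in>{..N}. \<Phi> n A \<omega> \<le> \<Phi> N A \<omega>"
      using A(1) by (intro AE_finite_allI Phi_mono_index) auto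
    moreover have "AE \<omega> in P. \<forall>i\<in>{..<k}. M (D i \<inter> En N) \<omega> \<le> M (D i) \<omega>"
      using D En(1) by (intro AE_finite_allI M_mono sets.Int) auto
    ultimately have "AE \<omega> in P. \<omega> \<in> U N \<longrightarrow> \<omega> \<in> {\<omega>\<in>space P. ennreal t < \<Phi> N A \<omega> \<and> ?Gn N \<omega>}"
    proof eventually_elim
      case (elim \<omega>)
      have 1: "(SUP n\<in>{..N}. \<Phi> n A \<omega>) \<le> \<Phi> N A \<omega>" using elim(1) by (intro SUP_least) auto
      have 2: "ennreal (s i) * M (D i \<inter> En N) \<omega> \<le> ennreal (s i) * M (D i) \<omega>" if "i < k" for i
        using elim(2) that by (intro mult_left_mono) auto
      show ?case
      proof
        assume \<omega>: "\<omega> \<in> U N"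
        then have "?Gn N \<omega>" using 2 by (auto simp: U_def intro: order_trans)
        moreover have "ennreal t < \<Phi> N A \<omega>" using \<omega> 1 by (auto simp: U_def intro: less_le_trans)
        ultimately show "\<omega> \<in> {\<omega>\<in>space P. ennreal t < \<Phi> N A \<omega> \<and> ?Gn N \<omega>}" using \<omega> by (auto simp: U_def)
      qed
    qed
    then have "emeasure P (U N) \<le> emeasure P {\<omega>\<in>space P. ennreal t < \<Phi> N A \<omega> \<and> ?Gn N \<omega>}"
      by (rule emeasure_mono_AE) measurable
    also have "\<dots> \<le> cell_bound s K (t / 2) * emeasure (fin.\<nu> N) A"
      using A D s K t by (rule fin.Phi_tail)
    also have "\<dots> \<le> cell_bound s K (t / 2) * emeasure (power_measure k \<mu>) A"
      by (intro mult_left_mono fin.nu_le) simp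
    finally show "emeasure P (U N) \<le> cell_bound s K (t / 2) * emeasure (power_measure k \<mu>) A" .
  qed
  finally show ?thesis .
qed

end

section \<open>The extremal integral as a supremum over level sets\<close>

definition pos_rats :: "real set" where
  "pos_rats = {q \<in> \<rat>. 0 < q}"

lemma countable_pos_rats: "countable pos_rats"
  unfolding pos_rats_def by (rule countable_subset[OF _ countable_rat]) auto

lemma ennreal_eq_SUP_pos_rats:
  assumes "0 < (a::real)"
  shows "ennreal a = (SUP q\<in>{q\<in>pos_rats. q < a}. ennreal q)"
proof (rule antisym)
  show "(SUP q\<in>{q\<in>pos_rats. q < a}. ennreal q) \<le> ennreal a"
    by (intro SUP_least) (auto intro: ennreal_leI)
  show "ennreal a \<le> (SUP q\<in>{q\<in>pos_rats. q < a}. ennreal q)"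
  proof (rule dense_le)
    fix y assume y: "y < ennreal a"
    then obtain r where r: "y = ennreal r" "0 \<le> r" by (cases y) auto
    then have "r < a" using y assms by (simp add: ennreal_less_iff)
    then obtain q where q: "q \<in> \<rat>" "r < q" "q < a" using Rats_dense_in_real by blast
    then have "y \<le> ennreal q" using r by (auto intro: ennreal_leI)
    also have "\<dots> \<le> (SUP q\<in>{q\<in>pos_rats. q < a}. ennreal q)"
      using q r by (intro SUP_upper) (auto simp: pos_rats_def)
    finally show "y \<le> (SUP q\<in>{q\<in>pos_rats. q < a}. ennreal q)" .
  qed
qed

context frechet_product
begin

definition level :: "((nat \<Rightarrow> 'e) \<Rightarrow> ennreal) \<Rightarrow> real \<Rightarrow> (nat \<Rightarrow> 'e) set" where
  "level h q = {u \<in> space (power_measure k \<mu>). ennreal q < h u}"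

text \<open>The extremal integral in a form that depends on \<open>h\<close> only through countably many level sets, so that
almost sure statements about the product sup measure can be applied to all of them at once.\<close>

definition level_sup :: "((nat \<Rightarrow> 'e) \<Rightarrow> ennreal) \<Rightarrow> 'w \<Rightarrow> ennreal" where
  "level_sup h \<omega> = (SUP q\<in>pos_rats. ennreal q * Mk (level h q) \<omega>)"

lemma level_offdiag:
  assumes "h \<in> offdiag_functions k \<mu>"
  shows "level h q \<in> offdiag_sets k \<mu>"
proof -
  have [measurable]: "h \<in> borel_measurable (power_measure k \<mu>)" and z: "\<forall>x\<in>diagonal_set k \<mu>. h x = 0"
    using assms by (auto simp: offdiag_functions_def)
  have "level h q \<in> sets (power_measure k \<mu>)" unfolding level_def by measurable
  moreover have "level h q \<inter> diagonal_set k \<mu> = {}" using z by (auto simp: level_def)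
  ultimately show ?thesis by (simp add: offdiag_sets_iff)
qed

lemma level_sup_measurable:
  assumes "h \<in> offdiag_functions k \<mu>"
  shows "level_sup h \<in> borel_measurable P"
proof -
  have [measurable]: "Mk (level h q) \<in> borel_measurable P" for q
    using assms by (intro Mk_measurable level_offdiag)
  have "(\<lambda>\<omega>. SUP q\<in>pos_rats. ennreal q * Mk (level h q) \<omega>) \<in> borel_measurable P"
    by (intro borel_measurable_SUP countable_pos_rats) measurable
  then show ?thesis by (simp add: level_sup_def[abs_def])
qed

text \<open>Each level set of \<open>h\<close> is covered by the level sets of the \<open>hs n\<close>. Monotonicity, monotone convergence,
Fatou-type bounds and the behaviour under maxima are all instances.\<close>

lemma level_sup_countable_cover:
  fixes hs :: "nat \<Rightarrow> (nat \<Rightarrow> 'e) \<Rightarrow> ennreal"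
  assumes h: "h \<in> offdiag_functions k \<mu>" and hs: "\<And>n. hs n \<in> offdiag_functions k \<mu>"
    and le: "AE u in power_measure k \<mu>. h u \<le> (SUP n. hs n u)"
  shows "AE \<omega> in P. level_sup h \<omega> \<le> (SUP n. level_sup (hs n) \<omega>)"
proof -
  have "AE \<omega> in P. \<forall>q\<in>pos_rats. Mk (level h q) \<omega> \<le> (SUP n. Mk (level (hs n) q) \<omega>)"
    unfolding AE_ball_countable[OF countable_pos_rats]
  proof
    fix q assume "q \<in> pos_rats"
    have "AE u in power_measure k \<mu>. u \<in> level h q \<longrightarrow> u \<in> (\<Union>n. level (hs n) q)"
      using le by eventually_elim (auto simp: level_def less_SUP_iff dest: less_le_trans)
    then show "AE \<omega> in P. Mk (level h q) \<omega> \<le> (SUP n. Mk (level (hs n) q) \<omega>)"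
      using h hs by (intro Mk_countable_cover level_offdiag emeasure_Diff_eq_0_if_AE)
  qed
  then show ?thesis
  proof eventually_elim
    case (elim \<omega>)
    show ?case unfolding level_sup_def[of h]
    proof (rule SUP_least)
      fix q assume q: "q \<in> pos_rats"
      have "ennreal q * Mk (level h q) \<omega> \<le> ennreal q * (SUP n. Mk (level (hs n) q) \<omega>)"
        using elim q by (intro mult_left_mono) auto
      also have "\<dots> = (SUP n. ennreal q * Mk (level (hs n) q) \<omega>)"
        by (simp add: SUP_mult_left_ennreal)
      also have "\<dots> \<le> (SUP n. level_sup (hs n) \<omega>)"
        unfolding level_sup_def using q by (intro SUP_mono' SUP_upper)
      finally show "ennreal q * Mk (level h q) \<omega> \<le> (SUP n. level_sup (hs n) \<omega>)" .
    qed
  qed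
qed

lemma level_sup_mono:
  assumes "h \<in> offdiag_functions k \<mu>" "h' \<in> offdiag_functions k \<mu>"
    and "AE u in power_measure k \<mu>. h u \<le> h' u"
  shows "AE \<omega> in P. level_sup h \<omega> \<le> level_sup h' \<omega>"
  using level_sup_countable_cover[of h "\<lambda>_. h'"] assms by simp

lemma level_sup_sup_le:
  assumes "h \<in> offdiag_functions k \<mu>" "h1 \<in> offdiag_functions k \<mu>" "h2 \<in> offdiag_functions k \<mu>"
    and le: "AE u in power_measure k \<mu>. h u \<le> sup (h1 u) (h2 u)"
  shows "AE \<omega> in P. level_sup h \<omega> \<le> sup (level_sup h1 \<omega>) (level_sup h2 \<omega>)"
proof -
  define hs where "hs n = (if n = 0 then h1 else h2)" for n :: nat
  have "AE \<omega> in P. level_sup h \<omega> \<le> (SUP n. level_sup (hs n) \<omega>)"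
  proof (rule level_sup_countable_cover)
    show "AE u in power_measure k \<mu>. h u \<le> (SUP n. hs n u)"
      using le
    proof eventually_elim
      case (elim u)
      have "hs 0 u \<le> (SUP n. hs n u)" "hs 1 u \<le> (SUP n. hs n u)" by (intro SUP_upper; simp)+
      then have "sup (h1 u) (h2 u) \<le> (SUP n. hs n u)" by (simp add: hs_def)
      then show ?case using elim by (rule order_trans[rotated])
    qed
  qed (use assms in \<open>auto simp: hs_def\<close>)
  then show ?thesis
  proof eventually_elim
    case (elim \<omega>)
    have "(SUP n. level_sup (hs n) \<omega>) \<le> sup (level_sup h1 \<omega>) (level_sup h2 \<omega>)" by (intro SUP_least) (auto simp: hs_def)
    with elim show ?case by (rule order_trans)
  qed
qed

lemma level_sup_scale_le:
  assumes c: "c \<in> \<rat>" "0 < c"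
  shows "level_sup (\<lambda>u. ennreal c * h u) \<omega> \<le> ennreal c * level_sup h \<omega>"
  unfolding level_sup_def[of "\<lambda>u. ennreal c * h u"]
proof (rule SUP_least)
  fix q assume q: "q \<in> pos_rats"
  have "ennreal q < ennreal c * h u \<longleftrightarrow> ennreal (q / c) < h u" for u
  proof -
    have "ennreal q = ennreal c * ennreal (q / c)"
      using c q by (simp add: ennreal_mult[symmetric] pos_rats_def)
    then show ?thesis using ennreal_mult_less_iff[OF c(2)] by simp
  qed
  then have lev: "level (\<lambda>u. ennreal c * h u) q = level h (q / c)" by (simp add: level_def)
  have "ennreal q = ennreal c * ennreal (q / c)"
    using c q by (simp add: ennreal_mult[symmetric] pos_rats_def)
  then have "ennreal q * Mk (level (\<lambda>u. ennreal c * h u) q) \<omega> = ennreal c * (ennreal (q / c) * Mk (level h (q / c)) \<omega>)"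
    unfolding lev by (simp add: mult.assoc)
  also have "\<dots> \<le> ennreal c * level_sup h \<omega>"
    unfolding level_sup_def using c q by (intro mult_left_mono SUP_upper) (auto simp: pos_rats_def)
  finally show "ennreal q * Mk (level (\<lambda>u. ennreal c * h u) q) \<omega> \<le> ennreal c * level_sup h \<omega>" .
qed

text \<open>For rational \<open>q\<close> the level set is the union of the \<open>A i\<close> with \<open>a i > q\<close>. Density of the rationals
recovers the coefficients \<open>a i\<close>.\<close>

lemma simple_extremal_integral_eq_level_sup:
  assumes "simple_extremal_integral P \<mu> k Mk h Y"
  shows "h \<in> offdiag_functions k \<mu>" "AE \<omega> in P. Y \<omega> = level_sup h \<omega>"
proof -
  obtain N :: nat and a :: "nat \<Rightarrow> real" and A where a: "\<forall>i<N. 0 < a i"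
    and A: "A ` {..<N} \<subseteq> offdiag_sets k \<mu>" and disj: "disjoint_family_on A {..<N}"
    and h: "\<forall>x\<in>space (power_measure k \<mu>). h x = (\<Sum>i<N. ennreal (a i) * indicator (A i) x)"
    and Y: "AE \<omega> in P. Y \<omega> = (SUP i\<in>{..<N}. ennreal (a i) * Mk (A i) \<omega>)"
    using assms unfolding simple_extremal_integral_def by blast
  have AO: "A i \<in> offdiag_sets k \<mu>" if "i < N" for i using A that by auto
  then have As: "A i \<in> sets (power_measure k \<mu>)" "A i \<inter> diagonal_set k \<mu> = {}" if "i < N" for i
    using that by (auto simp: offdiag_sets_iff)
  have "(\<lambda>x. \<Sum>i<N. ennreal (a i) * indicator (A i) x) \<in> borel_measurable (power_measure k \<mu>)"
    using As(1) by (intro borel_measurable_sum borel_measurable_times_ennreal borel_measurable_const borel_measurable_indicator) auto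
  then have hm: "h \<in> borel_measurable (power_measure k \<mu>)"
    using h by (subst measurable_cong) auto
  have "h x = 0" if x: "x \<in> diagonal_set k \<mu>" for x
  proof -
    have "x \<in> space (power_measure k \<mu>)" using x by (auto simp: diagonal_set_def)
    moreover have "x \<notin> A i" if "i < N" for i using x As(2)[OF that] by auto
    ultimately show ?thesis by (subst h[rule_format]) (auto intro!: sum.neutral simp: indicator_def)
  qed
  then show hO: "h \<in> offdiag_functions k \<mu>" using hm by (simp add: offdiag_functions_def)
  have h_in: "h x = ennreal (a i)" if "i < N" "x \<in> A i" for i x
  proof -
    have "x \<in> space (power_measure k \<mu>)" using sets.sets_into_space[OF As(1)[OF that(1)]] that(2) by auto
    then have "h x = (\<Sum>j<N. ennreal (a j) * indicator (A j) x)" using h by simp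
    also have "\<dots> = (\<Sum>j\<in>{i}. ennreal (a j) * indicator (A j) x)"
    proof (rule sum.mono_neutral_right)
      show "\<forall>j\<in>{..<N} - {i}. ennreal (a j) * indicator (A j) x = 0"
      proof
        fix j assume j: "j \<in> {..<N} - {i}"
        then have "A i \<inter> A j = {}" using disj that(1) by (auto simp: disjoint_family_on_def)
        then show "ennreal (a j) * indicator (A j) x = 0" using that(2) by (auto simp: indicator_def)
      qed
    qed (use that in auto)
    finally show ?thesis using that by simp
  qed
  have h_out: "h x = 0" if "x \<in> space (power_measure k \<mu>)" "\<And>i. i < N \<Longrightarrow> x \<notin> A i" for x
    unfolding h[rule_format, OF that(1)] using that(2) by (intro sum.neutral) (simp add: indicator_def)
  have lower: "AE \<omega> in P. \<forall>i\<in>{..<N}. \<forall>q\<in>pos_rats. q < a i \<longrightarrow> Mk (A i) \<omega> \<le> Mk (level h q) \<omega>"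
  proof (rule AE_finite_allI[OF finite_lessThan])
    fix i assume "i \<in> {..<N}"
    then have i: "i < N" by simp
    show "AE \<omega> in P. \<forall>q\<in>pos_rats. q < a i \<longrightarrow> Mk (A i) \<omega> \<le> Mk (level h q) \<omega>"
      unfolding AE_ball_countable[OF countable_pos_rats]
    proof
      fix q assume q: "q \<in> pos_rats"
      show "AE \<omega> in P. q < a i \<longrightarrow> Mk (A i) \<omega> \<le> Mk (level h q) \<omega>"
      proof (cases "q < a i")
        case True
        have "A i \<subseteq> level h q"
          using h_in[OF i] sets.sets_into_space[OF As(1)[OF i]] True q
          by (auto simp: level_def pos_rats_def ennreal_less_iff)
        then have e: "A i - (\<Union>j::nat. level h q) = {}" by auto
        have "AE \<omega> in P. Mk (A i) \<omega> \<le> (SUP j::nat. Mk (level h q) \<omega>)"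
          by (intro Mk_countable_cover AO i level_offdiag hO) (simp only: e emeasure_empty)
        then show ?thesis by simp
      qed simp
    qed
  qed
  have upper: "AE \<omega> in P. \<forall>q\<in>pos_rats. ennreal q * Mk (level h q) \<omega> \<le> (SUP i\<in>{..<N}. ennreal (a i) * Mk (A i) \<omega>)"
    unfolding AE_ball_countable[OF countable_pos_rats]
  proof
    fix q assume q: "q \<in> pos_rats"
    define As where "As i = (if i < N \<and> q < a i then A i else {})" for i
    have "level h q \<subseteq> (\<Union>i. As i)"
    proof
      fix x assume x: "x \<in> level h q"
      then have "h x \<noteq> 0" by (auto simp: level_def)
      then obtain i where i: "i < N" "x \<in> A i" using h_out x by (auto simp: level_def)
      then have "q < a i" using x h_in[OF i] q by (auto simp: level_def pos_rats_def ennreal_less_iff)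
      then show "x \<in> (\<Union>i. As i)" using i by (auto simp: As_def)
    qed
    then have e: "level h q - (\<Union>i. As i) = {}" by auto
    have n: "emeasure (power_measure k \<mu>) (level h q - (\<Union>i. As i)) = 0" unfolding e by (rule emeasure_empty)
    have AsO: "As i \<in> offdiag_sets k \<mu>" for i unfolding As_def using AO by (simp add: offdiag_sets_iff)
    have "AE \<omega> in P. Mk (level h q) \<omega> \<le> (SUP i. Mk (As i) \<omega>)"
      by (rule Mk_countable_cover[OF level_offdiag[OF hO] AsO n])
    with Mk_empty show "AE \<omega> in P. ennreal q * Mk (level h q) \<omega> \<le> (SUP i\<in>{..<N}. ennreal (a i) * Mk (A i) \<omega>)"
    proof eventually_elim
      case (elim \<omega>)
      have "ennreal q * Mk (level h q) \<omega> \<le> ennreal q * (SUP i. Mk (As i) \<omega>)"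
        using elim by (intro mult_left_mono) auto
      also have "\<dots> = (SUP i. ennreal q * Mk (As i) \<omega>)" by (simp add: SUP_mult_left_ennreal)
      also have "\<dots> \<le> (SUP i\<in>{..<N}. ennreal (a i) * Mk (A i) \<omega>)"
      proof (rule SUP_least)
        fix i
        show "ennreal q * Mk (As i) \<omega> \<le> (SUP i\<in>{..<N}. ennreal (a i) * Mk (A i) \<omega>)"
        proof (cases "i < N \<and> q < a i")
          case True
          then have "ennreal q * Mk (As i) \<omega> \<le> ennreal (a i) * Mk (A i) \<omega>"
            by (auto simp: As_def intro!: mult_right_mono ennreal_leI)
          also have "\<dots> \<le> (SUP i\<in>{..<N}. ennreal (a i) * Mk (A i) \<omega>)" using True by (intro SUP_upper) auto
          finally show ?thesis .
        next
          case False
          then have "As i = {}" by (auto simp: As_def)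
          then show ?thesis using elim by simp
        qed
      qed
      finally show ?case .
    qed
  qed
  show "AE \<omega> in P. Y \<omega> = level_sup h \<omega>"
    using Y lower upper
  proof eventually_elim
    case (elim \<omega>)
    show ?case
    proof (rule antisym)
      show "Y \<omega> \<le> level_sup h \<omega>" unfolding elim(1)
      proof (rule SUP_least)
        fix i assume i: "i \<in> {..<N}"
        have "ennreal (a i) * Mk (A i) \<omega> = (SUP q\<in>{q\<in>pos_rats. q < a i}. ennreal q * Mk (A i) \<omega>)"
          using a i by (subst ennreal_eq_SUP_pos_rats) (auto simp: SUP_mult_right_ennreal)
        also have "\<dots> \<le> level_sup h \<omega>"
        proof (rule SUP_least)
          fix q assume q: "q \<in> {q\<in>pos_rats. q < a i}"
          have "ennreal q * Mk (A i) \<omega> \<le> ennreal q * Mk (level h q) \<omega>"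
            using elim(2) i q by (intro mult_left_mono) auto
          also have "\<dots> \<le> level_sup h \<omega>" unfolding level_sup_def using q by (intro SUP_upper) auto
          finally show "ennreal q * Mk (A i) \<omega> \<le> level_sup h \<omega>" .
        qed
        finally show "ennreal (a i) * Mk (A i) \<omega> \<le> level_sup h \<omega>" .
      qed
      show "level_sup h \<omega> \<le> Y \<omega>" unfolding elim(1) level_sup_def using elim(3) by (intro SUP_least) auto
    qed
  qed
qed

lemma multiple_extremal_integral_eq_level_sup:
  assumes h: "h \<in> offdiag_functions k \<mu>" and X: "multiple_extremal_integral P \<mu> k Mk h X"
  shows "AE \<omega> in P. X \<omega> = level_sup h \<omega>"
proof -
  obtain H Y where S: "\<And>n. simple_extremal_integral P \<mu> k Mk (H n) (Y n)"
    and inc: "\<forall>n. \<forall>x\<in>space (power_measure k \<mu>). H n x \<le> H (Suc n) x"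
    and lim: "AE x in power_measure k \<mu>. (\<lambda>n. H n x) \<longlonglongrightarrow> h x"
    and YX: "AE \<omega> in P. (\<lambda>n. Y n \<omega>) \<longlonglongrightarrow> X \<omega>"
    using X unfolding multiple_extremal_integral_def by blast
  note HO = simple_extremal_integral_eq_level_sup(1)[OF S]
  have SUP_eq: "AE x in power_measure k \<mu>. h x = (SUP n. H n x)"
    using lim AE_space
  proof eventually_elim
    case (elim x)
    have "incseq (\<lambda>n. H n x)" using inc elim(2) by (intro incseq_SucI) auto
    then have "(\<lambda>n. H n x) \<longlonglongrightarrow> (SUP n. H n x)" by (rule LIMSEQ_SUP)
    with elim(1) show ?case by (rule LIMSEQ_unique)
  qed
  have "AE \<omega> in P. \<forall>n. Y n \<omega> = level_sup (H n) \<omega>"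
    unfolding AE_all_countable using simple_extremal_integral_eq_level_sup(2)[OF S] ..
  moreover have "AE \<omega> in P. \<forall>n. level_sup (H n) \<omega> \<le> level_sup (H (Suc n)) \<omega>"
    unfolding AE_all_countable
  proof
    fix n
    have "AE x in power_measure k \<mu>. H n x \<le> H (Suc n) x" using inc by (intro AE_I2) auto
    then show "AE \<omega> in P. level_sup (H n) \<omega> \<le> level_sup (H (Suc n)) \<omega>" by (intro level_sup_mono HO)
  qed
  moreover have "AE \<omega> in P. \<forall>n. level_sup (H n) \<omega> \<le> level_sup h \<omega>"
    unfolding AE_all_countable
  proof
    fix n
    have "AE x in power_measure k \<mu>. H n x \<le> h x"
      using SUP_eq by eventually_elim (auto intro: SUP_upper)
    then show "AE \<omega> in P. level_sup (H n) \<omega> \<le> level_sup h \<omega>" by (intro level_sup_mono HO h)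
  qed
  moreover have "AE \<omega> in P. level_sup h \<omega> \<le> (SUP n. level_sup (H n) \<omega>)"
  proof (rule level_sup_countable_cover[OF h HO])
    show "AE x in power_measure k \<mu>. h x \<le> (SUP n. H n x)" using SUP_eq by eventually_elim simp
  qed
  ultimately show ?thesis using YX
  proof eventually_elim
    case (elim \<omega>)
    have "incseq (\<lambda>n. level_sup (H n) \<omega>)" using elim(2) by (intro incseq_SucI) auto
    then have "(\<lambda>n. level_sup (H n) \<omega>) \<longlonglongrightarrow> (SUP n. level_sup (H n) \<omega>)" by (rule LIMSEQ_SUP)
    moreover have "(SUP n. level_sup (H n) \<omega>) = level_sup h \<omega>" using elim(3,4) by (intro antisym SUP_least) auto
    moreover have "(\<lambda>n. level_sup (H n) \<omega>) \<longlonglongrightarrow> X \<omega>" using elim(1,5) by simp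
    ultimately show ?case using LIMSEQ_unique by metis
  qed
qed

end

section \<open>A tail bound for the extremal integral\<close>

text \<open>A union bound in which the bounds of the single events are the masses of disjoint sets under the
measure with density \<open>W\<close>.\<close>

lemma emeasure_countable_Union_le_nn_integral:
  fixes H :: "'i \<Rightarrow> 'u set"
  assumes I: "countable I" and A: "\<And>i. i \<in> I \<Longrightarrow> A i \<in> sets P"
    and H: "\<And>i. i \<in> I \<Longrightarrow> H i \<in> sets N" "disjoint_family_on H I"
    and W[measurable]: "W \<in> borel_measurable N"
    and bound: "\<And>i. i \<in> I \<Longrightarrow> emeasure P (A i) \<le> (\<integral>\<^sup>+u. W u * indicator (H i) u \<partial>N)"
  shows "emeasure P (\<Union>i\<in>I. A i) \<le> (\<integral>\<^sup>+u. W u \<partial>N)"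
proof -
  let ?e = "from_nat_into I" and ?R = "to_nat_on I ` I"
  define A' where "A' n = (if n \<in> ?R then A (?e n) else {})" for n
  define H' where "H' n = (if n \<in> ?R then H (?e n) else {})" for n
  have eI: "?e n \<in> I" if "n \<in> ?R" for n using that I by (auto simp: from_nat_into_to_nat_on)
  have A'm: "range A' \<subseteq> sets P" using A eI by (auto simp: A'_def)
  have H'm: "H' n \<in> sets N" for n using H(1) eI by (auto simp: H'_def)
  have disj: "disjoint_family H'"
    unfolding disjoint_family_on_def
  proof (intro ballI impI)
    fix m n :: nat assume "m \<noteq> n"
    show "H' m \<inter> H' n = {}"
    proof (cases "m \<in> ?R \<and> n \<in> ?R")
      case True
      then have "?e m \<noteq> ?e n" using \<open>m \<noteq> n\<close> I by (metis to_nat_on_from_nat_into)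
      then show ?thesis using True H(2) eI by (auto simp: H'_def disjoint_family_on_def)
    qed (auto simp: H'_def)
  qed
  have "(\<Union>i\<in>I. A i) \<subseteq> (\<Union>n. A' n)"
  proof
    fix x assume "x \<in> (\<Union>i\<in>I. A i)"
    then obtain i where i: "i \<in> I" "x \<in> A i" by blast
    then have "x \<in> A' (to_nat_on I i)" using I by (simp add: A'_def)
    then show "x \<in> (\<Union>n. A' n)" by blast
  qed
  then have "emeasure P (\<Union>i\<in>I. A i) \<le> emeasure P (\<Union>n. A' n)"
    using A'm by (intro emeasure_mono) auto
  also have "\<dots> \<le> (\<Sum>n. emeasure P (A' n))" by (rule emeasure_subadditive_countably[OF A'm])
  also have "\<dots> \<le> (\<Sum>n. emeasure (density N W) (H' n))"
  proof (intro suminf_le summableI)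
    fix n
    show "emeasure P (A' n) \<le> emeasure (density N W) (H' n)"
      using bound[OF eI] H(1)[OF eI] by (auto simp: A'_def H'_def emeasure_density)
  qed
  also have "\<dots> = emeasure (density N W) (\<Union>n. H' n)"
    using H'm disj by (intro suminf_emeasure) auto
  also have "\<dots> \<le> emeasure (density N W) (space (density N W))" by (rule emeasure_space)
  also have "\<dots> = (\<integral>\<^sup>+u. W u * indicator (space N) u \<partial>N)"
    unfolding space_density by (rule emeasure_density) auto
  also have "\<dots> = (\<integral>\<^sup>+u. W u \<partial>N)"
    by (intro nn_integral_cong) simp
  finally show ?thesis .
qed

definition dyadic :: "int \<Rightarrow> ennreal set" where
  "dyadic j = {ennreal (2 powr j)<..ennreal (2 powr (real_of_int j + 1))}"

lemma dyadic_exists: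
  assumes "0 < y" "y < \<infinity>"
  shows "\<exists>j. y \<in> dyadic j"
proof -
  obtain r where r: "y = ennreal r" "0 < r" using assms by (cases y) auto
  define j where "j = \<lceil>log 2 r\<rceil> - 1"
  have "real_of_int j < log 2 r" "log 2 r \<le> real_of_int j + 1" unfolding j_def by linarith+
  then have "2 powr j < r" "r \<le> 2 powr (real_of_int j + 1)" using r(2) by (auto simp: less_log_iff log_le_iff)
  then show ?thesis using r by (intro exI[of _ j]) (auto simp: dyadic_def ennreal_less_iff intro: ennreal_leI)
qed

lemma dyadic_disjoint:
  assumes "y \<in> dyadic i" "y \<in> dyadic j"
  shows "i = j"
proof -
  have "i \<le> j" if "y \<in> dyadic i" "y \<in> dyadic j" for i j
  proof -
    have "ennreal (2 powr i) < ennreal (2 powr (real_of_int j + 1))" using that by (auto simp: dyadic_def)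
    then have "(2::real) powr i < 2 powr (real_of_int j + 1)" by (simp add: ennreal_less_iff)
    then show ?thesis by simp
  qed
  with assms show ?thesis by (meson antisym)
qed

text \<open>A probability measure \<open>m\<close> in the role of a normalised control measure.\<close>

locale frechet_product_density = frechet_product P \<mu> \<alpha> k M En \<Phi> Mk
  for P :: "'w measure" and \<mu> :: "'e measure" and \<alpha> k M En \<Phi> Mk +
  fixes m :: "'e measure" and \<psi> :: "'e \<Rightarrow> ennreal"
  assumes prob_m: "prob_space m" and sets_m: "sets m = sets \<mu>"
    and psi_measurable: "\<psi> \<in> borel_measurable m" and density_m: "density m \<psi> = \<mu>"
    and psi_pos: "AE x in m. 0 < \<psi> x \<and> \<psi> x < \<infinity>"
begin

sublocale m: prob_space m by (rule prob_m)

abbreviation \<mu>k :: "(nat \<Rightarrow> 'e) measure" where "\<mu>k \<equiv> power_measure k \<mu>"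
abbreviation mk :: "(nat \<Rightarrow> 'e) measure" where "mk \<equiv> power_measure k m"

definition weight :: "(nat \<Rightarrow> 'e) \<Rightarrow> ennreal" where
  "weight u = ennreal_powr (tensor_power k \<psi> u) (1 / \<alpha>)"

definition cell :: "int \<Rightarrow> 'e set" where
  "cell j = {x \<in> space \<mu>. \<psi> x \<in> dyadic j}"

text \<open>On \<open>cell j\<close> the measure \<open>\<mu>\<close> is at most \<open>2\<^bsup>j+1\<^esup> m\<close>, and scaling \<open>M\<close> by a factor multiplies its control
measure by the \<open>\<alpha>\<close>-th power of that factor. This scale therefore brings the control measure down to at
most \<open>m\<close>.\<close>

definition cell_scale :: "int \<Rightarrow> real" where
  "cell_scale j = 2 powr (- (real_of_int j + 1) / \<alpha>)"

lemma cell_scale_pos: "0 < cell_scale j"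
  by (simp add: cell_scale_def)

lemma sets_mk: "sets mk = sets \<mu>k"
  by (rule sets_PiM_cong) (auto simp: sets_m)

lemma space_mk: "space mk = space \<mu>k"
  by (rule sets_eq_imp_space_eq[OF sets_mk])

lemma tensor_measurable: "tensor_power k \<psi> \<in> borel_measurable mk"
  unfolding tensor_power_def using psi_measurable by measurable

lemma muk_density: "\<mu>k = density mk (tensor_power k \<psi>)"
  using power_measure_density[of m \<psi> k] E.sigma_finite_measure_axioms m.sigma_finite_measure_axioms psi_measurable
  by (simp add: density_m)

lemma psi_pos_all: "AE u in mk. \<forall>i\<in>{..<k}. 0 < \<psi> (u i) \<and> \<psi> (u i) < \<infinity>"
proof (rule AE_finite_allI[OF finite_lessThan])
  fix i assume "i \<in> {..<k}"
  then show "AE u in mk. 0 < \<psi> (u i) \<and> \<psi> (u i) < \<infinity>"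
    using psi_pos prob_m by (intro AE_PiM_component) auto
qed

lemma tensor_pos: "AE u in mk. 0 < tensor_power k \<psi> u \<and> tensor_power k \<psi> u < \<infinity>"
  using psi_pos_all
proof eventually_elim
  case (elim u)
  have "(\<Prod>i<n. \<psi> (u i)) \<noteq> 0 \<and> (\<Prod>i<n. \<psi> (u i)) < \<infinity>" if "n \<le> k" for n
    using that
  proof (induction n)
    case (Suc n)
    then have "0 < \<psi> (u n)" "\<psi> (u n) < \<infinity>" using elim by auto
    then show ?case using Suc by (simp add: ennreal_mult_less_top)
  qed simp
  then show ?case by (auto simp: tensor_power_def zero_less_iff_neq_zero)
qed

lemma AE_muk_iff: "(AE u in \<mu>k. Q u) \<longleftrightarrow> (AE u in mk. Q u)"
  unfolding muk_density AE_density[OF tensor_measurable]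
proof
  assume "AE u in mk. 0 < tensor_power k \<psi> u \<longrightarrow> Q u"
  with tensor_pos show "AE u in mk. Q u" by eventually_elim auto
next
  assume "AE u in mk. Q u"
  then show "AE u in mk. 0 < tensor_power k \<psi> u \<longrightarrow> Q u" by eventually_elim auto
qed

lemma cell_sets: "cell j \<in> sets \<mu>"
proof -
  have [measurable]: "\<psi> \<in> borel_measurable \<mu>" using psi_measurable sets_m by (simp cong: measurable_cong_sets)
  have "dyadic j \<in> sets borel" by (simp add: dyadic_def)
  then show ?thesis unfolding cell_def by measurable
qed

text \<open>The rescaled values have control measures at most \<open>m (cell j)\<close>, which sum to at most 1.\<close>

lemma cells_rarely_large:
  assumes K: "0 < K"
  shows "emeasure P (\<Union>j. {\<omega>\<in>space P. ennreal K < ennreal (cell_scale j) * M (cell j) \<omega>}) \<le> ennreal (K powr (-\<alpha>))"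
proof -
  have "emeasure P (\<Union>j. {\<omega>\<in>space P. ennreal K < ennreal (cell_scale j) * M (cell j) \<omega>})
    \<le> (\<integral>\<^sup>+x. ennreal (K powr (-\<alpha>)) \<partial>m)"
  proof (rule emeasure_countable_Union_le_nn_integral[where H = cell])
    note [measurable] = M_measurable[OF cell_sets]
    show "{\<omega>\<in>space P. ennreal K < ennreal (cell_scale j) * M (cell j) \<omega>} \<in> events" for j by measurable
    show "cell j \<in> sets m" for j using cell_sets sets_m by simp
    show "disjoint_family cell" unfolding disjoint_family_on_def cell_def using dyadic_disjoint by blast
    fix j
    have K': "0 < K / cell_scale j" using K cell_scale_pos by simp
    have "ennreal K = ennreal (cell_scale j) * ennreal (K / cell_scale j)"
      using K cell_scale_pos[of j] by (simp add: ennreal_mult[symmetric])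
    then have "emeasure P {\<omega>\<in>space P. ennreal K < ennreal (cell_scale j) * M (cell j) \<omega>}
      = emeasure P {\<omega>\<in>space P. ennreal (K / cell_scale j) < M (cell j) \<omega>}"
      by (simp add: ennreal_mult_less_iff[OF cell_scale_pos])
    also have "\<dots> \<le> emeasure \<mu> (cell j) * ennreal ((K / cell_scale j) powr (-\<alpha>))"
      by (rule M_tail_emeasure[OF cell_sets K'])
    also have "emeasure \<mu> (cell j) \<le> ennreal (2 powr (real_of_int j + 1)) * emeasure m (cell j)"
    proof -
      have "emeasure \<mu> (cell j) = (\<integral>\<^sup>+x. \<psi> x * indicator (cell j) x \<partial>m)"
        using cell_sets[of j] sets_m psi_measurable unfolding density_m[symmetric]
        by (subst emeasure_density) (auto simp: density_m)
      also have "\<dots> \<le> (\<integral>\<^sup>+x. ennreal (2 powr (real_of_int j + 1)) * indicator (cell j) x \<partial>m)"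
        by (intro nn_integral_mono) (auto simp: cell_def dyadic_def indicator_def)
      also have "\<dots> = ennreal (2 powr (real_of_int j + 1)) * emeasure m (cell j)"
        using cell_sets sets_m by (intro nn_integral_cmult_indicator) simp
      finally show ?thesis .
    qed
    also have "ennreal (2 powr (real_of_int j + 1)) * emeasure m (cell j) * ennreal ((K / cell_scale j) powr (-\<alpha>))
      = ennreal (K powr (-\<alpha>)) * emeasure m (cell j)"
    proof -
      have "(2 powr (real_of_int j + 1)) * (K / cell_scale j) powr (-\<alpha>) = K powr (-\<alpha>)"
      proof -
        have "(K / cell_scale j) powr (-\<alpha>) = K powr (-\<alpha>) * cell_scale j powr \<alpha>"
          using K cell_scale_pos[of j] by (simp add: powr_divide powr_minus field_simps)
        also have "cell_scale j powr \<alpha> = 2 powr (- (real_of_int j + 1))"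
          using alpha_pos by (simp add: cell_scale_def powr_powr)
        finally have "(2 powr (real_of_int j + 1)) * (K / cell_scale j) powr (-\<alpha>)
          = K powr (-\<alpha>) * (2 powr (real_of_int j + 1) * 2 powr (- (real_of_int j + 1)))" by simp
        also have "2 powr (real_of_int j + 1) * 2 powr (- (real_of_int j + 1)) = (1::real)"
          by (simp only: powr_add[symmetric]) simp
        finally show ?thesis by simp
      qed
      then have "ennreal (2 powr (real_of_int j + 1)) * ennreal ((K / cell_scale j) powr (-\<alpha>)) = ennreal (K powr (-\<alpha>))"
        by (simp add: ennreal_mult[symmetric])
      then show ?thesis by (metis mult.assoc mult.commute)
    qed
    also have "\<dots> = (\<integral>\<^sup>+x. ennreal (K powr (-\<alpha>)) * indicator (cell j) x \<partial>m)"
      using cell_sets sets_m by (intro nn_integral_cmult_indicator[symmetric]) simp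
    finally show "emeasure P {\<omega>\<in>space P. ennreal K < ennreal (cell_scale j) * M (cell j) \<omega>}
      \<le> (\<integral>\<^sup>+x. ennreal (K powr (-\<alpha>)) * indicator (cell j) x \<partial>m)"
      by (simp add: mult_right_mono)
  qed simp_all
  then show ?thesis by (simp add: m.emeasure_space_1)
qed

lemma weight_measurable: "weight \<in> borel_measurable mk"
proof -
  note [measurable] = tensor_measurable
  show ?thesis unfolding weight_def[abs_def] ennreal_powr_def by measurable
qed

text \<open>A piece of \<open>E\<^sup>k\<close> on which \<open>h\<close> and all the \<open>\<psi> (u i)\<close> are constant up to a factor 2; the index consists of the
level of \<open>h\<close> and the cells of the coordinates.\<close>

definition block :: "((nat \<Rightarrow> 'e) \<Rightarrow> ennreal) \<Rightarrow> int \<times> (nat \<Rightarrow> int) \<Rightarrow> (nat \<Rightarrow> 'e) set" where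
  "block h = (\<lambda>(l, v). {u \<in> space \<mu>k. h u \<in> dyadic l} \<inter> Pi\<^sub>E {..<k} (\<lambda>i. cell (v i)))"

text \<open>The factor \<open>2 powr (k / \<alpha>)\<close> pays for the dyadic rounding of \<open>\<psi>\<close>; the factor 4 pays for the
rounding of \<open>h\<close> and for the loss from \<open>t\<close> to \<open>t / 2\<close> in \<open>Mk_tail\<close>.\<close>

definition tail_const :: "real \<Rightarrow> real" where
  "tail_const x = 4 * 2 powr (real k / \<alpha>) / x"

lemma tail_const_pos: "0 < x \<Longrightarrow> 0 < tail_const x"
  by (simp add: tail_const_def)

lemma block_offdiag:
  assumes "h \<in> offdiag_functions k \<mu>"
  shows "block h \<kappa> \<in> offdiag_sets k \<mu>"
proof -
  obtain l v where \<kappa>: "\<kappa> = (l, v)" by (cases \<kappa>)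
  have [measurable]: "h \<in> borel_measurable \<mu>k" and z: "\<forall>x\<in>diagonal_set k \<mu>. h x = 0"
    using assms by (auto simp: offdiag_functions_def)
  have [measurable]: "dyadic l \<in> sets borel" by (simp add: dyadic_def)
  have "{u \<in> space \<mu>k. h u \<in> dyadic l} \<in> sets \<mu>k" by measurable
  moreover have "Pi\<^sub>E {..<k} (\<lambda>i. cell (v i)) \<in> sets \<mu>k" by (intro sets_PiM_I_finite cell_sets) auto
  ultimately have "block h \<kappa> \<in> sets \<mu>k" unfolding \<kappa> block_def by auto
  moreover have "block h \<kappa> \<inter> diagonal_set k \<mu> = {}"
    using z by (auto simp: \<kappa> block_def dyadic_def)
  ultimately show ?thesis by (simp add: offdiag_sets_iff)
qed

text \<open>The density of \<open>\<mu>\<^sup>k\<close> cancels against the scales, and the argument of \<open>product_tail\<close> is comparable to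
\<open>h u * weight u / x\<close>, because on the block both \<open>h\<close> and \<open>\<psi>\<close> are known up to a factor 2.\<close>

lemma block_pointwise:
  assumes u: "u \<in> block h (l, v)" and x: "0 < x" and K: "0 < K"
  shows "tensor_power k \<psi> u * cell_bound (\<lambda>i. cell_scale (v i)) K (x / 2 powr (real_of_int l + 1) / 2)
    \<le> ennreal (product_tail \<alpha> k K (tail_const x * enn2real (h u * weight u)))"
proof -
  define s where "s i = cell_scale (v i)" for i
  define p where "p i = enn2real (\<psi> (u i))" for i
  define r where "r = enn2real (h u)"
  have s: "0 < s i" for i by (simp add: s_def cell_scale_pos)
  have p: "\<psi> (u i) = ennreal (p i)" "2 powr (v i) < p i" "p i \<le> 2 powr (real_of_int (v i) + 1)" if "i < k" for i
  proof -
    have "u i \<in> cell (v i)" using u that by (auto simp: block_def)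
    then have d: "\<psi> (u i) \<in> dyadic (v i)" by (simp add: cell_def)
    then have "\<psi> (u i) < \<top>" by (auto simp: dyadic_def intro: le_less_trans)
    then show e: "\<psi> (u i) = ennreal (p i)" by (simp add: p_def)
    have "0 \<le> p i" by (simp add: p_def)
    then show "2 powr (v i) < p i" "p i \<le> 2 powr (real_of_int (v i) + 1)" using d unfolding e dyadic_def
      by (auto simp: ennreal_less_iff)
  qed
  have pp: "0 < p i" if "i < k" for i using p(2)[OF that] by (rule le_less_trans[rotated]) simp
  have r: "h u = ennreal r" "2 powr l < r"
  proof -
    have d: "h u \<in> dyadic l" using u by (auto simp: block_def)
    then have "h u < \<top>" by (auto simp: dyadic_def intro: le_less_trans)
    then show e: "h u = ennreal r" by (simp add: r_def)
    have "0 \<le> r" by (simp add: r_def)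
    then show "2 powr l < r" using d unfolding e dyadic_def by (auto simp: ennreal_less_iff)
  qed
  have r0: "0 < r" using r(2) by (rule le_less_trans[rotated]) simp
  have tp: "tensor_power k \<psi> u = ennreal (\<Prod>i<k. p i)"
    unfolding tensor_power_def using p(1) pp by (subst prod_ennreal[symmetric]) (auto intro: less_imp_le)
  have prodp: "0 < (\<Prod>i<k. p i)" using pp by (intro prod_pos) auto
  have prods: "0 < (\<Prod>i<k. s i)" using s by (intro prod_pos) auto
  have w: "weight u = ennreal ((\<Prod>i<k. p i) powr (1 / \<alpha>))"
    using prodp by (simp add: weight_def tp ennreal_powr_def)
  have y: "enn2real (h u * weight u) = r * (\<Prod>i<k. p i) powr (1 / \<alpha>)"
    using r0 by (simp add: r(1) w ennreal_mult[symmetric])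
  have sa: "s i powr \<alpha> = 2 powr (- (real_of_int (v i) + 1))" for i
    using alpha_pos by (simp add: s_def cell_scale_def powr_powr)
  have 1: "(\<Prod>i<k. p i) * (\<Prod>i<k. s i powr \<alpha>) \<le> 1"
    unfolding prod.distrib[symmetric]
  proof (rule prod_le_1, safe)
    fix i assume i: "i < k"
    show "0 \<le> p i * s i powr \<alpha>" using pp[OF i] by simp
    have "p i * s i powr \<alpha> \<le> 2 powr (real_of_int (v i) + 1) * 2 powr (- (real_of_int (v i) + 1))"
      unfolding sa using p(3)[OF i] by (intro mult_right_mono) auto
    also have "\<dots> = 1" by (simp only: powr_add[symmetric]) simp
    finally show "p i * s i powr \<alpha> \<le> 1" .
  qed
  have z: "1 / (x / 2 powr (real_of_int l + 1) / 2 * (\<Prod>i<k. s i)) \<le> tail_const x * (r * (\<Prod>i<k. p i) powr (1 / \<alpha>))"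
  proof -
    have "1 \<le> 2 powr (real k / \<alpha>) * ((\<Prod>i<k. p i) powr (1 / \<alpha>) * (\<Prod>i<k. s i))"
    proof -
      have "(1::real) = (\<Prod>i<k. 1)" by simp
      also have "\<dots> \<le> (\<Prod>i<k. 2 powr (1 / \<alpha>) * (p i powr (1 / \<alpha>) * s i))"
      proof (intro prod_mono conjI)
        fix i assume "i \<in> {..<k}"
        then have i: "i < k" by simp
        have "(1::real) = 2 powr (1 / \<alpha>) * ((2 powr (v i)) powr (1 / \<alpha>) * s i)"
          unfolding s_def cell_scale_def powr_powr powr_add[symmetric]
          using alpha_pos by (simp add: field_simps)
        also have "\<dots> \<le> 2 powr (1 / \<alpha>) * (p i powr (1 / \<alpha>) * s i)"
          using p(2)[OF i] alpha_pos s[of i] by (intro mult_left_mono mult_right_mono powr_mono2) auto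
        finally show "1 \<le> 2 powr (1 / \<alpha>) * (p i powr (1 / \<alpha>) * s i)" .
      qed simp
      also have "\<dots> = 2 powr (real k / \<alpha>) * ((\<Prod>i<k. p i) powr (1 / \<alpha>) * (\<Prod>i<k. s i))"
        by (simp add: prod.distrib prod_powr_distrib powr_power)
      finally show ?thesis .
    qed
    then have "1 / (\<Prod>i<k. s i) \<le> 2 powr (real k / \<alpha>) * (\<Prod>i<k. p i) powr (1 / \<alpha>)"
      using prods by (simp add: pos_divide_le_eq mult.assoc)
    then have "4 * 2 powr l / x * (1 / (\<Prod>i<k. s i)) \<le> 4 * r / x * (2 powr (real k / \<alpha>) * (\<Prod>i<k. p i) powr (1 / \<alpha>))"
      using x r(2) r0 prods by (intro mult_mono divide_right_mono) auto
    moreover have "1 / (x / 2 powr (real_of_int l + 1) / 2 * (\<Prod>i<k. s i)) = 4 * 2 powr l / x * (1 / (\<Prod>i<k. s i))"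
      by (simp add: powr_add)
    moreover have "4 * r / x * (2 powr (real k / \<alpha>) * (\<Prod>i<k. p i) powr (1 / \<alpha>))
      = tail_const x * (r * (\<Prod>i<k. p i) powr (1 / \<alpha>))"
      by (simp add: tail_const_def)
    ultimately show ?thesis by argo
  qed
  let ?z = "1 / (x / 2 powr (real_of_int l + 1) / 2 * (\<Prod>i<k. s i))"
  have z0: "0 \<le> ?z" using x prods by simp
  have "tensor_power k \<psi> u * cell_bound s K (x / 2 powr (real_of_int l + 1) / 2)
     = ennreal ((\<Prod>i<k. p i) * (\<Prod>i<k. s i powr \<alpha>)) * ennreal (product_tail \<alpha> k K ?z)"
    using prodp by (simp add: tp cell_bound_def ennreal_mult prod_nonneg mult.assoc)
  also have "\<dots> \<le> 1 * ennreal (product_tail \<alpha> k K ?z)"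
    using 1 by (intro mult_right_mono) (auto simp: ennreal_le_1)
  also have "\<dots> \<le> ennreal (product_tail \<alpha> k K (tail_const x * enn2real (h u * weight u)))"
    unfolding y using product_tail_mono[OF alpha_pos K z0 z] by (simp add: ennreal_leI)
  finally show ?thesis by (simp add: s_def[abs_def])
qed

text \<open>Off the event that some cell is large, \<open>level_sup h > x\<close> forces \<open>Mk\<close> of some block to exceed \<open>x\<close>
divided by the upper end of the level of \<open>h\<close> there. The bounds of these events are integrals over
the blocks, which are disjoint.\<close>

lemma level_sup_tail:
  assumes h: "h \<in> offdiag_functions k \<mu>" and fin: "AE u in mk. h u * weight u < \<infinity>"
    and K: "0 < K" and x: "0 < x"
  shows "emeasure P {\<omega>\<in>space P. ennreal x < level_sup h \<omega>} \<le>
    ennreal (K powr (-\<alpha>)) + (\<integral>\<^sup>+u. ennreal (product_tail \<alpha> k K (tail_const x * enn2real (h u * weight u))) \<partial>mk)"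
proof -
  let ?W = "\<lambda>u. ennreal (product_tail \<alpha> k K (tail_const x * enn2real (h u * weight u)))"
  define I where "I = (UNIV :: int set) \<times> Pi\<^sub>E {..<k} (\<lambda>_. UNIV :: int set)"
  have I: "countable I" unfolding I_def by (intro countable_SIGMA countable_PiE) auto
  have hm: "h \<in> borel_measurable mk"
    using h sets_mk by (simp add: offdiag_functions_def cong: measurable_cong_sets)
  let ?G = "\<lambda>v \<omega>. \<forall>i<k. ennreal (cell_scale (v i)) * M (cell (v i)) \<omega> \<le> ennreal K"
  define bad where "bad = (\<Union>j. {\<omega>\<in>space P. ennreal K < ennreal (cell_scale j) * M (cell j) \<omega>})"
  define A where "A = (\<lambda>(l, v). {\<omega>\<in>space P. ennreal (x / 2 powr (real_of_int l + 1)) < Mk (block h (l, v)) \<omega> \<and> ?G v \<omega>})"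
  note [measurable] = M_measurable[OF cell_sets] Mk_measurable[OF block_offdiag[OF h]]
  have bad_meas: "bad \<in> events" unfolding bad_def by measurable
  have A_meas: "A \<kappa> \<in> events" for \<kappa> by (cases \<kappa>) (simp add: A_def, measurable)
  \<comment> \<open>Almost everywhere \<open>h u\<close> is finite and all \<open>\<psi> (u i)\<close> are positive and finite, so each has a
    dyadic level.\<close>
  have cover: "AE u in \<mu>k. 0 < h u \<longrightarrow> (\<exists>\<kappa>\<in>I. u \<in> block h \<kappa>)"
    unfolding AE_muk_iff using fin psi_pos_all tensor_pos AE_space
  proof eventually_elim
    case (elim u)
    show ?case
    proof
      assume h0: "0 < h u"
      have "weight u \<noteq> 0" using elim(3) by (auto simp: weight_def ennreal_powr_def enn2real_eq_0_iff)
      then have "h u < \<infinity>" using elim(1) h0 by (auto simp: ennreal_mult_less_top)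
      then obtain l where l: "h u \<in> dyadic l" using dyadic_exists h0 by blast
      have "\<forall>i\<in>{..<k}. \<exists>j. \<psi> (u i) \<in> dyadic j" using elim(2) dyadic_exists by blast
      then obtain v where v: "\<forall>i\<in>{..<k}. \<psi> (u i) \<in> dyadic (v i)" by metis
      have us: "u \<in> Pi\<^sub>E {..<k} (\<lambda>_. space \<mu>)" using elim(4) unfolding space_mk by (simp add: space_PiM)
      have "u \<in> block h (l, restrict v {..<k})"
        using l v us by (auto simp: block_def cell_def space_PiM PiE_def Pi_iff)
      moreover have "(l, restrict v {..<k}) \<in> I" by (auto simp: I_def)
      ultimately show "\<exists>\<kappa>\<in>I. u \<in> block h \<kappa>" by blast
    qed
  qed
  let ?S = "\<lambda>\<omega>. SUP \<kappa>\<in>I. ennreal (2 powr (real_of_int (fst \<kappa>) + 1)) * Mk (block h \<kappa>) \<omega>"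
  have level_sup_le: "AE \<omega> in P. level_sup h \<omega> \<le> ?S \<omega>"
  proof -
    have "AE \<omega> in P. \<forall>q\<in>pos_rats. ennreal q * Mk (level h q) \<omega> \<le> ?S \<omega>"
      unfolding AE_ball_countable[OF countable_pos_rats]
    proof
      fix q assume q: "q \<in> pos_rats"
      define As where "As n = (if from_nat_into I n \<in> I \<and> q < 2 powr (real_of_int (fst (from_nat_into I n)) + 1)
        then block h (from_nat_into I n) else {})" for n
      have AsO: "As n \<in> offdiag_sets k \<mu>" for n
        using block_offdiag[OF h] by (simp add: As_def offdiag_sets_iff)
      have "AE u in \<mu>k. u \<in> level h q \<longrightarrow> u \<in> (\<Union>n. As n)"
        using cover
      proof eventually_elim
        case (elim u)
        show ?case
        proof
          assume u: "u \<in> level h q"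
          then have "0 < h u" by (auto simp: level_def intro: le_less_trans)
          then obtain \<kappa> where \<kappa>: "\<kappa> \<in> I" "u \<in> block h \<kappa>" using elim by blast
          have "ennreal q < h u" using u by (simp add: level_def)
          also have "h u \<le> ennreal (2 powr (real_of_int (fst \<kappa>) + 1))"
            using \<kappa>(2) by (cases \<kappa>) (simp add: block_def dyadic_def)
          finally have "q < 2 powr (real_of_int (fst \<kappa>) + 1)" using q by (simp add: ennreal_less_iff pos_rats_def)
          then have "u \<in> As (to_nat_on I \<kappa>)" using \<kappa> I by (simp add: As_def)
          then show "u \<in> (\<Union>n. As n)" by blast
        qed
      qed
      then have null: "emeasure \<mu>k (level h q - (\<Union>n. As n)) = 0" by (rule emeasure_Diff_eq_0_if_AE)
      have "AE \<omega> in P. Mk (level h q) \<omega> \<le> (SUP n. Mk (As n) \<omega>)"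
        by (rule Mk_countable_cover[OF level_offdiag[OF h] AsO null])
      with Mk_empty show "AE \<omega> in P. ennreal q * Mk (level h q) \<omega> \<le> ?S \<omega>"
      proof eventually_elim
        case (elim \<omega>)
        have "ennreal q * Mk (level h q) \<omega> \<le> ennreal q * (SUP n. Mk (As n) \<omega>)"
          using elim by (intro mult_left_mono) auto
        also have "\<dots> = (SUP n. ennreal q * Mk (As n) \<omega>)" by (simp add: SUP_mult_left_ennreal)
        also have "\<dots> \<le> ?S \<omega>"
        proof (rule SUP_least)
          fix n
          let ?\<kappa> = "from_nat_into I n"
          show "ennreal q * Mk (As n) \<omega> \<le> ?S \<omega>"
          proof (cases "?\<kappa> \<in> I \<and> q < 2 powr (real_of_int (fst ?\<kappa>) + 1)")
            case True
            then have "ennreal q * Mk (As n) \<omega> \<le> ennreal (2 powr (real_of_int (fst ?\<kappa>) + 1)) * Mk (block h ?\<kappa>) \<omega>"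
              by (auto simp: As_def intro!: mult_right_mono ennreal_leI)
            also have "\<dots> \<le> ?S \<omega>"
              using True by (intro SUP_upper) auto
            finally show ?thesis .
          next
            case False
            then have "As n = {}" by (auto simp: As_def)
            then show ?thesis using elim by simp
          qed
        qed
        finally show ?case .
      qed
    qed
    then show ?thesis by eventually_elim (auto simp: level_sup_def intro: SUP_least)
  qed
  have "AE \<omega> in P. \<omega> \<in> {\<omega>\<in>space P. ennreal x < level_sup h \<omega>} \<longrightarrow> \<omega> \<in> bad \<union> (\<Union>\<kappa>\<in>I. A \<kappa>)"
    using level_sup_le
  proof eventually_elim
    case (elim \<omega>)
    show ?case
    proof
      assume \<omega>: "\<omega> \<in> {\<omega>\<in>space P. ennreal x < level_sup h \<omega>}"
      show "\<omega> \<in> bad \<union> (\<Union>\<kappa>\<in>I. A \<kappa>)"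
      proof (cases "\<omega> \<in> bad")
        case False
        then have G: "?G v \<omega>" for v using \<omega> by (auto simp: bad_def not_less)
        obtain \<kappa> where \<kappa>: "\<kappa> \<in> I" "ennreal x < ennreal (2 powr (real_of_int (fst \<kappa>) + 1)) * Mk (block h \<kappa>) \<omega>"
          using less_le_trans[OF _ elim, of "ennreal x"] \<omega> by (auto simp: less_SUP_iff)
        obtain l v where lv: "\<kappa> = (l, v)" by (cases \<kappa>)
        have "ennreal x = ennreal (2 powr (real_of_int l + 1)) * ennreal (x / 2 powr (real_of_int l + 1))"
          using x by (simp add: ennreal_mult[symmetric])
        then have "ennreal (x / 2 powr (real_of_int l + 1)) < Mk (block h \<kappa>) \<omega>"
          using \<kappa>(2) ennreal_mult_less_iff[of "2 powr (real_of_int l + 1)"] by (simp add: lv)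
        then have "\<omega> \<in> A \<kappa>" using \<omega> G by (simp add: A_def lv)
        then show ?thesis using \<kappa>(1) by blast
      qed simp
    qed
  qed
  then have "emeasure P {\<omega>\<in>space P. ennreal x < level_sup h \<omega>} \<le> emeasure P (bad \<union> (\<Union>\<kappa>\<in>I. A \<kappa>))"
    using bad_meas A_meas I by (intro emeasure_mono_AE sets.Un sets.countable_UN') auto
  also have "\<dots> \<le> emeasure P bad + emeasure P (\<Union>\<kappa>\<in>I. A \<kappa>)"
    using bad_meas A_meas I by (intro emeasure_subadditive sets.countable_UN') auto
  also have "\<dots> \<le> ennreal (K powr (-\<alpha>)) + (\<integral>\<^sup>+u. ?W u \<partial>mk)"
  proof (intro add_mono)
    show "emeasure P bad \<le> ennreal (K powr (-\<alpha>))" unfolding bad_def by (rule cells_rarely_large[OF K])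
    show "emeasure P (\<Union>\<kappa>\<in>I. A \<kappa>) \<le> (\<integral>\<^sup>+u. ?W u \<partial>mk)"
    proof (rule emeasure_countable_Union_le_nn_integral[where H = "block h", OF I])
      show "A \<kappa> \<in> events" for \<kappa> by (rule A_meas)
      show bm: "block h \<kappa> \<in> sets mk" for \<kappa>
        using block_offdiag[OF h] by (simp add: offdiag_sets_iff sets_mk)
      show "disjoint_family_on (block h) I"
        unfolding disjoint_family_on_def
      proof (intro ballI impI)
        fix \<kappa> \<kappa>' assume \<kappa>: "\<kappa> \<in> I" "\<kappa>' \<in> I" "\<kappa> \<noteq> \<kappa>'"
        obtain l v l' v' where lv: "\<kappa> = (l, v)" "\<kappa>' = (l', v')" by (cases \<kappa>, cases \<kappa>')
        have "\<kappa> = \<kappa>'" if u: "u \<in> block h \<kappa>" "u \<in> block h \<kappa>'" for u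
        proof -
          have "l = l'" using u dyadic_disjoint by (auto simp: lv block_def)
          moreover have "v i = v' i" if "i \<in> {..<k}" for i
          proof -
            have "u i \<in> cell (v i)" "u i \<in> cell (v' i)" using u that by (auto simp: lv block_def)
            then show ?thesis using dyadic_disjoint by (auto simp: cell_def)
          qed
          then have "v = v'" using \<kappa> by (intro PiE_ext[of v _ _ v']) (auto simp: lv I_def)
          ultimately show ?thesis by (simp add: lv)
        qed
        then show "block h \<kappa> \<inter> block h \<kappa>' = {}" using \<kappa>(3) by blast
      qed
      note [measurable] = hm weight_measurable
      show "?W \<in> borel_measurable mk"
        unfolding product_tail_def by measurable
      fix \<kappa> assume "\<kappa> \<in> I"
      obtain l v where lv: "\<kappa> = (l, v)" by (cases \<kappa>)
      let ?c = "cell_bound (\<lambda>i. cell_scale (v i)) K (x / 2 powr (real_of_int l + 1) / 2)"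
      have "emeasure P (A \<kappa>) \<le> ?c * emeasure \<mu>k (block h \<kappa>)"
        unfolding A_def lv prod.case using x K
        by (intro Mk_tail[where s = "\<lambda>i. cell_scale (v i)" and D = "\<lambda>i. cell (v i)"]
            block_offdiag h cell_sets cell_scale_pos) (auto simp: block_def)
      also have "emeasure \<mu>k (block h \<kappa>) = (\<integral>\<^sup>+u. tensor_power k \<psi> u * indicator (block h \<kappa>) u \<partial>mk)"
        unfolding muk_density using bm by (intro emeasure_density tensor_measurable)
      also have "?c * \<dots> = (\<integral>\<^sup>+u. ?c * (tensor_power k \<psi> u * indicator (block h \<kappa>) u) \<partial>mk)"
        using bm tensor_measurable by (intro nn_integral_cmult[symmetric]) auto
      also have "\<dots> \<le> (\<integral>\<^sup>+u. ?W u * indicator (block h \<kappa>) u \<partial>mk)"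
      proof (intro nn_integral_mono)
        fix u
        show "?c * (tensor_power k \<psi> u * indicator (block h \<kappa>) u) \<le>
          ?W u * indicator (block h \<kappa>) u"
          using block_pointwise[of u h l v x K] x K by (auto simp: lv indicator_def mult.commute)
      qed
      finally show "emeasure P (A \<kappa>) \<le> (\<integral>\<^sup>+u. ?W u * indicator (block h \<kappa>) u \<partial>mk)" .
    qed
  qed
  finally show ?thesis .
qed

end

section \<open>Dominated convergence\<close>

context frechet_product_density
begin

text \<open>In the tail bound with \<open>K\<^bsup>-\<alpha>\<^esup> = \<delta>\<close> the integrals tend to zero: the integrand is dominated by a
multiple of the \<open>LlnL\<close> integrand of \<open>g\<close>, and at almost every point it is eventually zero by
\<open>product_tail_eq_0\<close>.\<close>

lemma level_sup_vanishes_in_probability: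
  assumes k: "2 \<le> k" and g: "g \<in> offdiag_functions k \<mu>" and rs: "\<And>n. rs n \<in> offdiag_functions k \<mu>"
    and LlnL: "LlnL \<alpha> k (\<lambda>u. g u * weight u) m < \<infinity>"
    and le: "AE u in \<mu>k. \<forall>n. rs n u \<le> g u" and lim: "AE u in \<mu>k. (\<lambda>n. rs n u) \<longlonglongrightarrow> 0"
    and x: "0 < x"
  shows "AE \<omega> in P. \<exists>n. level_sup (rs n) \<omega> \<le> ennreal x"
proof -
  have meas: "h \<in> borel_measurable mk" if "h \<in> offdiag_functions k \<mu>" for h
    using that sets_mk by (simp add: offdiag_functions_def cong: measurable_cong_sets)
  note [measurable] = meas[OF g] meas[OF rs] weight_measurable
  define w where "w u = ennreal_powr (g u * weight u) \<alpha> * (1 + ln_plus (g u * weight u) ^ (k - 1))" for u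
  have w_meas[measurable]: "w \<in> borel_measurable mk"
    unfolding w_def[abs_def] ennreal_powr_def ln_plus_def by measurable
  have w_int: "(\<integral>\<^sup>+u. w u \<partial>mk) < \<infinity>" using LlnL by (simp add: LlnL_def w_def)
  have w_fin: "AE u in mk. w u \<noteq> \<infinity>" using w_int by (intro nn_integral_noteq_infinite w_meas) auto
  have g_fin: "AE u in mk. g u * weight u < \<infinity>"
    using w_fin
  proof eventually_elim
    case (elim u)
    show ?case
    proof (rule ccontr)
      assume "\<not> g u * weight u < \<infinity>"
      then have t: "g u * weight u = \<top>" by (simp add: less_top[symmetric])
      then have "w u = \<top>" unfolding w_def t by (simp add: ennreal_powr_def ennreal_top_mult)
      then show False using elim by simp
    qed
  qed
  have le': "AE u in mk. \<forall>n. rs n u \<le> g u" and lim': "AE u in mk. (\<lambda>n. rs n u) \<longlonglongrightarrow> 0"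
    using le lim by (simp_all add: AE_muk_iff)
  have rs_fin: "AE u in mk. rs n u * weight u < \<infinity>" for n
    using g_fin le'
  proof eventually_elim
    case (elim u)
    have "rs n u * weight u \<le> g u * weight u" using elim(2) by (intro mult_right_mono) auto
    then show ?case using elim(1) by (rule le_less_trans)
  qed
  have weight_fin: "AE u in mk. weight u < \<infinity>"
    using tensor_pos by eventually_elim (auto simp: weight_def less_top[symmetric] ennreal_powr_top_iff)
  note [measurable] = level_sup_measurable[OF rs]
  let ?Z = "{\<omega>\<in>space P. \<forall>n. ennreal x < level_sup (rs n) \<omega>}"
  have Z_meas: "?Z \<in> events" by measurable
  have le_delta: "emeasure P ?Z \<le> 0 + ennreal \<delta>" if \<delta>: "0 < \<delta>" for \<delta> :: real
  proof -
    define K where "K = \<delta> powr (- 1 / \<alpha>)"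
    have K: "0 < K" "K powr (-\<alpha>) = \<delta>" using \<delta> alpha_pos by (auto simp: K_def powr_powr)
    let ?W = "\<lambda>n u. ennreal (product_tail \<alpha> k K (tail_const x * enn2real (rs n u * weight u)))"
    obtain C where C: "0 \<le> C" "\<forall>y\<ge>0. product_tail \<alpha> k K (tail_const x * y) \<le> C * (y powr \<alpha> * (1 + ln (max y 1) ^ (k - 1)))"
      using product_tail_le_log[OF alpha_pos K(1) tail_const_pos[OF x]] by blast
    have "(\<lambda>n. \<integral>\<^sup>+u. ?W n u \<partial>mk) \<longlonglongrightarrow> (\<integral>\<^sup>+u. 0 \<partial>mk)"
    proof (rule nn_integral_dominated_convergence[where w = "\<lambda>u. ennreal C * w u"])
      show "?W n \<in> borel_measurable mk" for n unfolding product_tail_def by measurable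
      show "(\<lambda>u. ennreal C * w u) \<in> borel_measurable mk" by measurable
      show "(\<integral>\<^sup>+u. ennreal C * w u \<partial>mk) < \<infinity>"
        using w_int by (simp add: nn_integral_cmult ennreal_mult_less_top)
      show "AE u in mk. ?W n u \<le> ennreal C * w u" for n
        using g_fin le'
      proof eventually_elim
        case (elim u)
        define y where "y = enn2real (g u * weight u)"
        have gy: "g u * weight u = ennreal y" "0 \<le> y" using elim(1) by (auto simp: y_def)
        have "rs n u * weight u \<le> ennreal y" unfolding gy(1)[symmetric] using elim(2) by (intro mult_right_mono) auto
        then have "enn2real (rs n u * weight u) \<le> y" using gy(2) by (intro enn2real_leI) auto
        then have "product_tail \<alpha> k K (tail_const x * enn2real (rs n u * weight u)) \<le> product_tail \<alpha> k K (tail_const x * y)"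
          using tail_const_pos[OF x] by (intro product_tail_mono alpha_pos K mult_left_mono) auto
        also have "\<dots> \<le> C * (y powr \<alpha> * (1 + ln (max y 1) ^ (k - 1)))" using C(2) gy(2) by blast
        finally have "?W n u \<le> ennreal (C * (y powr \<alpha> * (1 + ln (max y 1) ^ (k - 1))))" by (rule ennreal_leI)
        also have "\<dots> = ennreal C * w u"
          using gy(2) C(1)
          by (simp add: w_def gy(1) ennreal_powr_def ln_plus_def ennreal_mult ennreal_power[symmetric])
        finally show ?case .
      qed
      show "AE u in mk. (\<lambda>n. ?W n u) \<longlonglongrightarrow> 0"
        using g_fin le' lim' weight_fin
      proof eventually_elim
        case (elim u)
        have "(\<lambda>n. weight u * rs n u) \<longlonglongrightarrow> weight u * 0"
          using elim(3,4) by (intro ennreal_tendsto_cmult) auto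
        then have 0: "(\<lambda>n. rs n u * weight u) \<longlonglongrightarrow> 0" by (simp add: mult.commute)
        \<comment> \<open>the threshold of \<open>product_tail_eq_0\<close>\<close>
        define e where "e = 1 / (K ^ k * tail_const x)"
        have e: "0 < e" using K tail_const_pos[OF x] by (simp add: e_def)
        have "\<forall>\<^sub>F n in sequentially. rs n u * weight u < ennreal e"
          using e by (intro order_tendstoD[OF 0]) simp
        then have "\<forall>\<^sub>F n in sequentially. ?W n u = 0"
        proof eventually_elim
          case (elim n)
          have "enn2real (rs n u * weight u) \<le> e" using elim e by (intro enn2real_leI) auto
          then have "K ^ k * (tail_const x * enn2real (rs n u * weight u)) \<le> K ^ k * (tail_const x * e)"
            using K tail_const_pos[OF x] by (intro mult_left_mono) auto
          also have "\<dots> = 1" using K tail_const_pos[OF x] by (simp add: e_def)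
          finally have "product_tail \<alpha> k K (tail_const x * enn2real (rs n u * weight u)) = 0"
            using K tail_const_pos[OF x] k by (intro product_tail_eq_0) auto
          then show ?case by simp
        qed
        then show ?case by (rule tendsto_eventually)
      qed
    qed simp
    then have "(\<lambda>n. ennreal \<delta> + (\<integral>\<^sup>+u. ?W n u \<partial>mk)) \<longlonglongrightarrow> ennreal \<delta> + 0"
      by (intro tendsto_add tendsto_const) simp
    moreover have "emeasure P ?Z \<le> ennreal \<delta> + (\<integral>\<^sup>+u. ?W n u \<partial>mk)" for n
    proof -
      have "emeasure P ?Z \<le> emeasure P {\<omega>\<in>space P. ennreal x < level_sup (rs n) \<omega>}" by (intro emeasure_mono) auto
      also have "\<dots> \<le> ennreal \<delta> + (\<integral>\<^sup>+u. ?W n u \<partial>mk)"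
        using level_sup_tail[OF rs rs_fin K(1) x, of n] by (simp add: K(2))
      finally show ?thesis .
    qed
    ultimately have "emeasure P ?Z \<le> ennreal \<delta> + 0" by (intro LIMSEQ_le_const) auto
    then show ?thesis by simp
  qed
  have "emeasure P ?Z \<le> 0" by (rule ennreal_le_epsilon) (rule le_delta)
  then have "?Z \<in> null_sets P" using Z_meas by (intro null_setsI) auto
  from AE_not_in[OF this] AE_space show ?thesis by eventually_elim (auto simp: not_less)
qed

lemma offdiag_SUP:
  assumes "\<And>n. fs n \<in> offdiag_functions k \<mu>"
  shows "(\<lambda>u. SUP n\<in>{N::nat..}. fs n u) \<in> offdiag_functions k \<mu>"
proof -
  have [measurable]: "fs n \<in> borel_measurable \<mu>k" for n using assms by (simp add: offdiag_functions_def)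
  have "(\<lambda>u. SUP n\<in>{N..}. fs n u) \<in> borel_measurable \<mu>k" by measurable
  then show ?thesis using assms by (auto simp: offdiag_functions_def)
qed

lemma offdiag_INF:
  assumes "\<And>n. fs n \<in> offdiag_functions k \<mu>"
  shows "(\<lambda>u. INF n\<in>{N::nat..}. fs n u) \<in> offdiag_functions k \<mu>"
proof -
  have [measurable]: "fs n \<in> borel_measurable \<mu>k" for n using assms by (simp add: offdiag_functions_def)
  have "(\<lambda>u. INF n\<in>{N..}. fs n u) \<in> borel_measurable \<mu>k" by measurable
  then show ?thesis using assms by (auto simp: offdiag_functions_def)
qed

text \<open>Fatou: \<open>f\<close> is the supremum over \<open>N\<close> of the infima of the \<open>fs n\<close> with \<open>n \<ge> N\<close>.\<close>

lemma level_sup_lower_limit: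
  assumes f: "f \<in> offdiag_functions k \<mu>" and fs: "\<And>n. fs n \<in> offdiag_functions k \<mu>"
    and lim: "AE u in \<mu>k. (\<lambda>n. fs n u) \<longlonglongrightarrow> f u"
  shows "AE \<omega> in P. \<forall>a<level_sup f \<omega>. \<forall>\<^sub>F n in sequentially. a < level_sup (fs n) \<omega>"
proof -
  define lo where "lo N u = (INF n\<in>{N..}. fs n u)" for N u
  have lo: "lo N \<in> offdiag_functions k \<mu>" for N unfolding lo_def[abs_def] by (rule offdiag_INF[OF fs])
  have "AE \<omega> in P. level_sup f \<omega> \<le> (SUP N. level_sup (lo N) \<omega>)"
  proof (rule level_sup_countable_cover[OF f lo])
    show "AE u in \<mu>k. f u \<le> (SUP N. lo N u)"
      using lim
    proof eventually_elim
      case (elim u)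
      then have "liminf (\<lambda>n. fs n u) = f u" by (intro lim_imp_Liminf) auto
      then show ?case by (simp add: liminf_SUP_INF lo_def)
    qed
  qed
  moreover have "AE \<omega> in P. \<forall>N n. N \<le> n \<longrightarrow> level_sup (lo N) \<omega> \<le> level_sup (fs n) \<omega>"
    unfolding AE_all_countable
  proof (intro allI)
    fix N n
    show "AE \<omega> in P. N \<le> n \<longrightarrow> level_sup (lo N) \<omega> \<le> level_sup (fs n) \<omega>"
    proof (cases "N \<le> n")
      case True
      then have "AE \<omega> in P. level_sup (lo N) \<omega> \<le> level_sup (fs n) \<omega>"
        by (intro level_sup_mono lo fs) (auto simp: lo_def intro!: INF_lower)
      then show ?thesis by eventually_elim simp
    qed simp
  qed
  ultimately show ?thesis
  proof eventually_elim
    case (elim \<omega>)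
    show ?case
    proof (intro allI impI)
      fix a assume "a < level_sup f \<omega>"
      from less_le_trans[OF this elim(1)] obtain N where N: "a < level_sup (lo N) \<omega>" by (auto simp: less_SUP_iff)
      show "\<forall>\<^sub>F n in sequentially. a < level_sup (fs n) \<omega>"
        unfolding eventually_sequentially using N elim(2) by (intro exI[of _ N]) (auto intro: less_le_trans)
    qed
  qed
qed

text \<open>Where \<open>f\<close> is positive, the tail suprema \<open>hi N\<close> do not tend to zero, but they eventually stay below \<open>c f\<close>
since \<open>c > 1\<close>, so that \<open>r N\<close> vanishes. The factor is rational so that it permutes the levels that
enter \<open>level_sup\<close>.\<close>

lemma level_sup_upper_limit:
  assumes k: "2 \<le> k" and f: "f \<in> offdiag_functions k \<mu>" and g: "g \<in> offdiag_functions k \<mu>"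
    and fs: "\<And>n. fs n \<in> offdiag_functions k \<mu>"
    and LlnL: "LlnL \<alpha> k (\<lambda>u. g u * weight u) m < \<infinity>"
    and lim: "AE u in \<mu>k. (\<lambda>n. fs n u) \<longlonglongrightarrow> f u" and le: "\<And>n. AE u in \<mu>k. fs n u \<le> g u"
    and c: "c \<in> \<rat>" "1 < c" and x: "0 < x"
  shows "AE \<omega> in P. \<forall>\<^sub>F n in sequentially. level_sup (fs n) \<omega> \<le> sup (ennreal c * level_sup f \<omega>) (ennreal x)"
proof -
  define hi where "hi N u = (SUP n\<in>{N..}. fs n u)" for N u
  have hi: "hi N \<in> offdiag_functions k \<mu>" for N unfolding hi_def[abs_def] by (rule offdiag_SUP[OF fs])
  define r where "r N u = (if ennreal c * f u < hi N u then hi N u else 0)" for N u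
  have cf: "(\<lambda>u. ennreal c * f u) \<in> offdiag_functions k \<mu>" using f by (auto simp: offdiag_functions_def)
  have r: "r N \<in> offdiag_functions k \<mu>" for N
  proof -
    have [measurable]: "f \<in> borel_measurable \<mu>k" "hi N \<in> borel_measurable \<mu>k"
      using f hi by (auto simp: offdiag_functions_def)
    have "r N \<in> borel_measurable \<mu>k" unfolding r_def[abs_def] by measurable
    then show ?thesis using hi[of N] by (auto simp: offdiag_functions_def r_def)
  qed
  have "AE u in \<mu>k. \<forall>n. fs n u \<le> g u" unfolding AE_all_countable using le by blast
  then have r_le: "AE u in \<mu>k. \<forall>N. r N u \<le> g u"
    by eventually_elim (auto simp: r_def hi_def intro: SUP_least)
  have r_lim: "AE u in \<mu>k. (\<lambda>N. r N u) \<longlonglongrightarrow> 0"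
    using lim
  proof eventually_elim
    case (elim u)
    have "decseq (\<lambda>N. hi N u)" unfolding hi_def by (intro decseq_SucI SUP_subset_mono) auto
    then have "(\<lambda>N. hi N u) \<longlonglongrightarrow> (INF N. hi N u)" by (rule LIMSEQ_INF)
    moreover have "(INF N. hi N u) = f u"
      using lim_imp_Limsup[OF _ elim] by (simp add: limsup_INF_SUP hi_def)
    ultimately have hlim: "(\<lambda>N. hi N u) \<longlonglongrightarrow> f u" by simp
    \<comment> \<open>Where \<open>f = 0\<close>, \<open>r N\<close> is bounded by the tail suprema, which tend to \<open>0\<close>; where \<open>f = \<top>\<close>, nothing
      exceeds \<open>c f\<close>.\<close>
    consider "f u = 0" | "f u = \<top>" | "0 < f u" "f u < \<top>"
      by (metis less_top zero_less_iff_neq_zero)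
    then show ?case
    proof cases
      case 1
      have "r N u \<le> hi N u" for N by (simp add: r_def)
      then show ?thesis using hlim unfolding 1
        by (intro tendsto_sandwich[of "\<lambda>_. 0" "\<lambda>N. r N u" sequentially "\<lambda>N. hi N u"]) auto
    next
      case 2
      then have "ennreal c * f u = \<top>" using c by (simp add: ennreal_mult_top)
      then show ?thesis by (simp add: r_def)
    next
      case 3
      obtain y where y: "f u = ennreal y" "0 < y" using 3 by (cases "f u") auto
      have "ennreal y < ennreal c * ennreal y" using y c by (simp add: ennreal_mult[symmetric] ennreal_less_iff)
      then have "f u < ennreal c * f u" by (simp add: y)
      then have "\<forall>\<^sub>F N in sequentially. hi N u < ennreal c * f u" by (rule order_tendstoD[OF hlim])
      then have "\<forall>\<^sub>F N in sequentially. r N u = 0" by eventually_elim (simp add: r_def)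
      then show ?thesis by (rule tendsto_eventually)
    qed
  qed
  have "AE \<omega> in P. \<exists>N. level_sup (r N) \<omega> \<le> ennreal x"
    by (rule level_sup_vanishes_in_probability[OF k g r LlnL r_le r_lim x])
  moreover have "AE \<omega> in P. \<forall>N n. N \<le> n \<longrightarrow> level_sup (fs n) \<omega> \<le> sup (level_sup (\<lambda>u. ennreal c * f u) \<omega>) (level_sup (r N) \<omega>)"
    unfolding AE_all_countable
  proof (intro allI)
    fix N n
    show "AE \<omega> in P. N \<le> n \<longrightarrow> level_sup (fs n) \<omega> \<le> sup (level_sup (\<lambda>u. ennreal c * f u) \<omega>) (level_sup (r N) \<omega>)"
    proof (cases "N \<le> n")
      case True
      have "fs n u \<le> sup (ennreal c * f u) (r N u)" for u
      proof -
        have "fs n u \<le> hi N u" unfolding hi_def using True by (intro SUP_upper) auto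
        also have "\<dots> \<le> sup (ennreal c * f u) (r N u)" by (auto simp: r_def not_less intro: le_supI1)
        finally show ?thesis .
      qed
      then have "AE \<omega> in P. level_sup (fs n) \<omega> \<le> sup (level_sup (\<lambda>u. ennreal c * f u) \<omega>) (level_sup (r N) \<omega>)"
        by (intro level_sup_sup_le fs cf r AE_I2)
      then show ?thesis by eventually_elim simp
    qed simp
  qed
  ultimately show ?thesis
  proof eventually_elim
    case (elim \<omega>)
    obtain N where N: "level_sup (r N) \<omega> \<le> ennreal x" using elim(1) by blast
    have "level_sup (fs n) \<omega> \<le> sup (ennreal c * level_sup f \<omega>) (ennreal x)" if "N \<le> n" for n
    proof -
      have "level_sup (fs n) \<omega> \<le> sup (level_sup (\<lambda>u. ennreal c * f u) \<omega>) (level_sup (r N) \<omega>)" using elim(2) that by blast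
      also have "\<dots> \<le> sup (ennreal c * level_sup f \<omega>) (ennreal x)"
        using level_sup_scale_le[of c f \<omega>] c N by (intro sup_mono) auto
      finally show ?thesis .
    qed
    then show ?case unfolding eventually_sequentially by blast
  qed
qed

lemma level_sup_dominated_convergence:
  assumes k: "2 \<le> k" and f: "f \<in> offdiag_functions k \<mu>" and g: "g \<in> offdiag_functions k \<mu>"
    and fs: "\<And>n. fs n \<in> offdiag_functions k \<mu>"
    and LlnL: "LlnL \<alpha> k (\<lambda>u. g u * weight u) m < \<infinity>"
    and lim: "AE u in \<mu>k. (\<lambda>n. fs n u) \<longlonglongrightarrow> f u" and le: "\<And>n. AE u in \<mu>k. fs n u \<le> g u"
  shows "AE \<omega> in P. (\<lambda>n. level_sup (fs n) \<omega>) \<longlonglongrightarrow> level_sup f \<omega>"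
proof -
  define e where "e p = 1 / real (Suc p)" for p
  have e: "0 < e p" "e p \<in> \<rat>" for p by (auto simp: e_def)
  have e0: "e \<longlonglongrightarrow> 0" unfolding e_def[abs_def] using LIMSEQ_Suc[OF lim_const_over_n[of 1]] by simp
  have "AE \<omega> in P. \<forall>p. \<forall>\<^sub>F n in sequentially. level_sup (fs n) \<omega> \<le> sup (ennreal (1 + e p) * level_sup f \<omega>) (ennreal (e p))"
    unfolding AE_all_countable
  proof
    fix p
    show "AE \<omega> in P. \<forall>\<^sub>F n in sequentially. level_sup (fs n) \<omega> \<le> sup (ennreal (1 + e p) * level_sup f \<omega>) (ennreal (e p))"
      by (rule level_sup_upper_limit[OF k f g fs LlnL lim le]) (use e in auto)
  qed
  with level_sup_lower_limit[OF f fs lim] show ?thesis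
  proof eventually_elim
    case (elim \<omega>)
    show ?case
    proof (rule order_tendstoI)
      fix a assume "a < level_sup f \<omega>"
      then show "\<forall>\<^sub>F n in sequentially. a < level_sup (fs n) \<omega>" using elim(1) by blast
    next
      fix b assume b: "level_sup f \<omega> < b"
      then have "level_sup f \<omega> < \<top>" by (rule less_le_trans) simp
      then obtain j where j: "level_sup f \<omega> = ennreal j" "0 \<le> j" by (cases "level_sup f \<omega>") auto
      have "(\<lambda>p. ennreal ((1 + e p) * j)) \<longlonglongrightarrow> ennreal ((1 + 0) * j)"
        by (intro tendsto_ennrealI tendsto_mult tendsto_add tendsto_const e0)
      then have "(\<lambda>p. ennreal ((1 + e p) * j)) \<longlonglongrightarrow> level_sup f \<omega>" by (simp add: j)
      then have 1: "\<forall>\<^sub>F p in sequentially. ennreal ((1 + e p) * j) < b" using b by (rule order_tendstoD)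
      have "(\<lambda>p. ennreal (e p)) \<longlonglongrightarrow> ennreal 0" by (intro tendsto_ennrealI e0)
      moreover have "ennreal 0 < b" using b by (simp add: le_less_trans[OF zero_le])
      ultimately have 2: "\<forall>\<^sub>F p in sequentially. ennreal (e p) < b" by (rule order_tendstoD)
      from eventually_happens'[OF sequentially_bot eventually_conj[OF 1 2]]
      obtain p where p: "ennreal ((1 + e p) * j) < b \<and> ennreal (e p) < b" ..
      have "\<forall>\<^sub>F n in sequentially. level_sup (fs n) \<omega> \<le> sup (ennreal (1 + e p) * level_sup f \<omega>) (ennreal (e p))"
        using elim(2) by blast
      then show "\<forall>\<^sub>F n in sequentially. level_sup (fs n) \<omega> < b"
      proof eventually_elim
        case (elim n)
        have "ennreal (1 + e p) * level_sup f \<omega> = ennreal ((1 + e p) * j)"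
          using j e[of p] by (simp add: ennreal_mult less_imp_le)
        then have "sup (ennreal (1 + e p) * level_sup f \<omega>) (ennreal (e p)) < b" using p by (simp add: sup_max)
        with elim show ?case by (rule le_less_trans)
      qed
    qed
  qed
qed

end

theorem proposition4p2:
  fixes P :: "'w measure" and \<mu> :: "'e measure" and \<alpha> :: real and k :: nat
    and M :: "'e set \<Rightarrow> 'w \<Rightarrow> ennreal" and Mk :: "(nat \<Rightarrow> 'e) set \<Rightarrow> 'w \<Rightarrow> ennreal"
    and f g :: "(nat \<Rightarrow> 'e) \<Rightarrow> ennreal" and fs :: "nat \<Rightarrow> (nat \<Rightarrow> 'e) \<Rightarrow> ennreal"
    and If :: "'w \<Rightarrow> ennreal" and Ifs :: "nat \<Rightarrow> 'w \<Rightarrow> ennreal"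
  assumes "prob_space P"
    and "borel_space \<mu>" and "sigma_finite_measure \<mu>" and "emeasure \<mu> (space \<mu>) \<noteq> 0"
    and "0 < \<alpha>" and "2 \<le> k"
    and "frechet_sup_measure P \<mu> \<alpha> M"
    and "product_sup_measure P \<mu> \<alpha> k M Mk"
    and "f \<in> offdiag_functions k \<mu>" and "g \<in> offdiag_functions k \<mu>"
    and "\<And>n. fs n \<in> offdiag_functions k \<mu>"
    and "multiple_extremal_integral P \<mu> k Mk f If"
    and "\<And>n. multiple_extremal_integral P \<mu> k Mk (fs n) (Ifs n)"
    and "\<exists>m \<psi>. prob_space m \<and> sets m = sets \<mu> \<and>
           absolutely_continuous m \<mu> \<and> absolutely_continuous \<mu> m \<and>
           \<psi> \<in> borel_measurable m \<and> density m \<psi> = \<mu> \<and>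
           (AE x in m. 0 < \<psi> x \<and> \<psi> x < \<infinity>) \<and>
           LlnL \<alpha> k (\<lambda>u. g u * ennreal_powr (tensor_power k \<psi> u) (1 / \<alpha>)) m < \<infinity>"
    and "AE x in power_measure k \<mu>. (\<lambda>n. fs n x) \<longlonglongrightarrow> f x"
    and "\<And>n. AE x in power_measure k \<mu>. fs n x \<le> g x"
  shows "AE \<omega> in P. (\<lambda>n. Ifs n \<omega>) \<longlonglongrightarrow> If \<omega>"
proof -
  obtain m \<psi> where m: "prob_space m" "sets m = sets \<mu>" "\<psi> \<in> borel_measurable m" "density m \<psi> = \<mu>"
    "AE x in m. 0 < \<psi> x \<and> \<psi> x < \<infinity>"
    and LlnL: "LlnL \<alpha> k (\<lambda>u. g u * ennreal_powr (tensor_power k \<psi> u) (1 / \<alpha>)) m < \<infinity>"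
    using assms(14) by (elim exE conjE)
  have Mk: "\<forall>A\<in>offdiag_sets k \<mu>. Mk A \<in> borel_measurable P"
    using assms(8) unfolding product_sup_measure_def by (rule conjunct1)
  obtain E \<Phi> where E: "range E \<subseteq> sets \<mu>" "incseq E" "\<forall>n. 0 < emeasure \<mu> (E n) \<and> emeasure \<mu> (E n) < \<infinity>"
    and \<Phi>: "\<forall>n. finite_product_sup_measure P (density \<mu> (indicator (E n))) \<alpha> k (\<lambda>A. M (A \<inter> E n)) (\<Phi> n)"
    and Mk_eq: "\<forall>A\<in>offdiag_sets k \<mu>. AE \<omega> in P. Mk A \<omega> = (SUP n. \<Phi> n A \<omega>)"
    using assms(8) unfolding product_sup_measure_def by (elim exE conjE)
  interpret prob_space P by fact
  interpret sigma_finite_measure \<mu> by fact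
  interpret frechet_noise P \<mu> \<alpha> k M
    using assms by unfold_locales (auto intro: borel_space_diagonal_set)
  interpret frechet_product P \<mu> \<alpha> k M E \<Phi> Mk
    using E \<Phi> Mk Mk_eq by unfold_locales auto
  interpret frechet_product_density P \<mu> \<alpha> k M E \<Phi> Mk m \<psi>
    using m by (intro frechet_product_density.intro frechet_product_density_axioms.intro frechet_product_axioms) auto
  have "AE \<omega> in P. (\<lambda>n. level_sup (fs n) \<omega>) \<longlonglongrightarrow> level_sup f \<omega>"
    using assms(6,9,10,11) LlnL assms(15,16) unfolding weight_def[symmetric] by (rule level_sup_dominated_convergence)
  moreover have "AE \<omega> in P. If \<omega> = level_sup f \<omega>"
    using assms(9,12) by (rule multiple_extremal_integral_eq_level_sup)
  moreover have "AE \<omega> in P. \<forall>n. Ifs n \<omega> = level_sup (fs n) \<omega>"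
    unfolding AE_all_countable using assms(11,13) by (intro allI multiple_extremal_integral_eq_level_sup)
  ultimately show ?thesis by eventually_elim simp
qed

end
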